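(* Let $N\ge1$ be an integer, $\alpha>0$, and let $H$ be the self-adjoint operator $-\frac{d^2}{dx^2}$ on the infinite star graph with the Exner--Šeba vertex condition, as defined in the context. For $t>0$, the integral (distributional) kernel $G_{Sj}{}^{l}(t,x,y)$, $x,y>0$, of the wave solution operator $\cos(t\sqrt H)$ is $$G_{Sj}{}^{l}(t,x,y)=\tfrac12\delta_j{}^{l}\,[\delta(x-y-t)+\delta(x-y+t)]+\frac12\left(\frac2N-\delta_j{}^{l}\right)\delta(x+y-t)-\frac{\alpha}{N^2}\,e^{-\alpha(t-y-x)/N}\,\theta(t-y-x).$$ Equivalently, for every $f=(f_1,\dots,f_N)\in L^2(0,\infty)^N$, the solution $u(t)=\cos(t\sqrt H)f$ of $u_{tt}=-Hu$ with $u(0,x)=f(x)$, $u_t(0,x)=0$ is given, for every $t>0$ and almost every $x>0$, by $$u_j(t,x)=\tfrac12[f_j(x-t)+f_j(x+t)]-\tfrac12 f_j(t-x)+\frac1N\sum_{l=1}^N f_l(t-x)-\frac{\alpha}{N^2}\,\theta(t-x)\int_0^{t-x}e^{-\alpha\epsilon/N}\sum_{l=1}^N f_l(t-x-\epsilon)\,d\epsilon,$$ where each $f_l$ is extended by $0$ to negative arguments.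
   Context: Operator $H$: on $L^2(0,\infty)^N$, $(Hu)_j=-u_j''$ with domain consisting of all $u=(u_1,\dots,u_N)$ with $u_j\in H^2(0,\infty)$ (Sobolev space) satisfying $u_1(0)=\dots=u_N(0)=:u(0)$ and $\sum_{j=1}^N u_j'(0)=\alpha u(0)$. For $\alpha>0$, $H$ is self-adjoint and nonnegative, and $\cos(t\sqrt H)$ is defined by functional calculus. $\delta_j{}^{l}$ is the Kronecker delta, $\delta(\cdot)$ the Dirac delta, $\theta$ the unit step function ($\theta(s)=1$ for $s>0$, $0$ for $s<0$). The kernel acts by $(\cos(t\sqrt H)f)_j(x)=\sum_{l=1}^N\int_0^\infty G_{Sj}{}^{l}(t,x,y)f_l(y)\,dy$. *)

theory Defs
  imports "HOL-Analysis.Analysis"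
begin

text \<open>
  The edges of the star graph are indexed by a finite type, so the number of edges is
  \<open>N = CARD('n) \<ge> 1\<close>. Elements of \<open>L\<^sup>2(0,\<infinity>)\<^sup>N\<close> are represented by functions whose values outside
  \<open>(0,\<infinity>)\<close> are irrelevant, and equality of classes is \<open>ae_eq\<close>.
\<close>

type_synonym 'n wavefun = "'n \<Rightarrow> real \<Rightarrow> complex"

abbreviation half_line :: "real measure" where
  "half_line \<equiv> lebesgue_on {0<..}"

definition L2_half :: "(real \<Rightarrow> complex) set" where
  "L2_half = {f \<in> borel_measurable half_line. integrable half_line (\<lambda>x. (cmod (f x))\<^sup>2)}"

definition L2 :: "('n::finite) wavefun set" where
  "L2 = {f. \<forall>j. f j \<in> L2_half}"

definition ae_eq :: "'n wavefun \<Rightarrow> 'n wavefun \<Rightarrow> bool" where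
  "ae_eq f g \<longleftrightarrow> (\<forall>j. AE x in half_line. f j x = g j x)"

definition l2_inner :: "('n::finite) wavefun \<Rightarrow> 'n wavefun \<Rightarrow> complex" where
  "l2_inner f g = (\<Sum>j\<in>UNIV. \<integral>x. f j x * cnj (g j x) \<partial>half_line)"

definition l2_norm :: "('n::finite) wavefun \<Rightarrow> real" where
  "l2_norm f = sqrt (Re (l2_inner f f))"


subsection \<open>The operator \<open>H\<close>\<close>

definition test_function :: "(real \<Rightarrow> real) \<Rightarrow> bool" where
  "test_function \<phi> \<longleftrightarrow>
     (\<forall>k x. (deriv ^^ k) \<phi> differentiable (at x)) \<and>
     (\<exists>a b. 0 < a \<and> (\<forall>x. \<phi> x \<noteq> 0 \<longrightarrow> x \<in> {a..b}))"

definition has_weak_deriv :: "(real \<Rightarrow> complex) \<Rightarrow> (real \<Rightarrow> complex) \<Rightarrow> bool" where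
  "has_weak_deriv u u' \<longleftrightarrow>
     (\<forall>\<phi>. test_function \<phi> \<longrightarrow>
        (\<integral>x. u x * of_real (deriv \<phi> x) \<partial>half_line) = - (\<integral>x. u' x * of_real (\<phi> x) \<partial>half_line))"

text \<open>
  \<open>u \<in> H\<^sup>2(0,\<infinity>)\<close> with first and second weak derivatives \<open>u'\<close> and \<open>u''\<close>.
\<close>

definition sobolev_H2 ::
  "(real \<Rightarrow> complex) \<Rightarrow> (real \<Rightarrow> complex) \<Rightarrow> (real \<Rightarrow> complex) \<Rightarrow> bool" where
  "sobolev_H2 u u' u'' \<longleftrightarrow> u \<in> L2_half \<and> u' \<in> L2_half \<and> u'' \<in> L2_half \<and>
     has_weak_deriv u u' \<and> has_weak_deriv u' u''"

text \<open>
  Boundary values at the vertex are those of the representative that is continuous up to \<open>0\<close>.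
\<close>

definition has_trace :: "(real \<Rightarrow> complex) \<Rightarrow> complex \<Rightarrow> bool" where
  "has_trace u c \<longleftrightarrow> (\<exists>v. continuous_on {0..} v \<and> (AE x in half_line. u x = v x) \<and> v 0 = c)"

text \<open>
  The graph of \<open>H\<close>: the pairs \<open>(u, v)\<close> with \<open>u\<close> in the domain and \<open>v = H u\<close>.
\<close>

definition star_H :: "real \<Rightarrow> (('n::finite) wavefun \<times> 'n wavefun) set" where
  "star_H \<alpha> = {(u, v). u \<in> L2 \<and> v \<in> L2 \<and>
     (\<exists>u' u'' u0 d0. (\<forall>j. sobolev_H2 (u j) (u' j) (u'' j)) \<and>
        (\<forall>j. has_trace (u j) u0) \<and>
        (\<forall>j. has_trace (u' j) (d0 j)) \<and>
        (\<Sum>j\<in>UNIV. d0 j) = of_real \<alpha> * u0 \<and>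
        ae_eq v (\<lambda>j x. - u'' j x))}"


subsection \<open>Spectral resolutions and functional calculus\<close>

definition orthogonal_projection :: "(('n::finite) wavefun \<Rightarrow> 'n wavefun) \<Rightarrow> bool" where
  "orthogonal_projection P \<longleftrightarrow>
     (\<forall>f\<in>L2. P f \<in> L2) \<and>
     (\<forall>f\<in>L2. \<forall>g\<in>L2. \<forall>a b. ae_eq (P (\<lambda>j x. a * f j x + b * g j x))
                                  (\<lambda>j x. a * P f j x + b * P g j x)) \<and>
     (\<forall>f\<in>L2. ae_eq (P (P f)) (P f)) \<and>
     (\<forall>f\<in>L2. \<forall>g\<in>L2. l2_inner (P f) g = l2_inner f (P g))"

definition projection_valued_measure ::
  "(real set \<Rightarrow> ('n::finite) wavefun \<Rightarrow> 'n wavefun) \<Rightarrow> bool" where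
  "projection_valued_measure E \<longleftrightarrow>
     (\<forall>B\<in>sets borel. orthogonal_projection (E B)) \<and>
     (\<forall>f\<in>L2. ae_eq (E UNIV f) f) \<and>
     (\<forall>A\<in>sets borel. \<forall>B\<in>sets borel. \<forall>f\<in>L2. ae_eq (E (A \<inter> B) f) (E A (E B f))) \<and>
     (\<forall>f\<in>L2. \<forall>F :: nat \<Rightarrow> real set. range F \<subseteq> sets borel \<longrightarrow> disjoint_family F \<longrightarrow>
        (\<lambda>n. l2_norm (\<lambda>j x. E (\<Union>i. F i) f j x - (\<Sum>i<n. E (F i) f j x))) \<longlonglongrightarrow> 0)"

definition spectral_dist ::
  "(real set \<Rightarrow> ('n::finite) wavefun \<Rightarrow> 'n wavefun) \<Rightarrow> 'n wavefun \<Rightarrow> real measure" where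
  "spectral_dist E f = measure_of UNIV (sets borel) (\<lambda>B. ennreal (Re (l2_inner (E B f) f)))"

definition simple_spectral_integral ::
  "(real set \<Rightarrow> ('n::finite) wavefun \<Rightarrow> 'n wavefun) \<Rightarrow> (real \<Rightarrow> real) \<Rightarrow> 'n wavefun \<Rightarrow> 'n wavefun" where
  "simple_spectral_integral E s f = (\<lambda>j x. \<Sum>c\<in>range s. of_real c * E (s -` {c}) f j x)"

text \<open>
  \<open>f\<close> lies in the domain of \<open>\<integral> \<phi> dE\<close> and \<open>g = (\<integral> \<phi> dE) f\<close>. Simple functions being dense in
  \<open>L\<^sup>2(\<mu>\<^sub>f)\<close> with \<open>\<mu>\<^sub>f = spectral_dist E f\<close>, and \<open>s \<mapsto> (\<integral> s dE) f\<close> being an isometry into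
  \<open>L\<^sup>2(0,\<infinity>)\<^sup>N\<close>, the domain is \<open>{f. \<integral> \<phi>\<^sup>2 d\<mu>\<^sub>f < \<infinity>}\<close> and \<open>g\<close> is unique.
\<close>

definition has_spectral_integral ::
  "(real set \<Rightarrow> ('n::finite) wavefun \<Rightarrow> 'n wavefun) \<Rightarrow> (real \<Rightarrow> real) \<Rightarrow>
     'n wavefun \<Rightarrow> 'n wavefun \<Rightarrow> bool" where
  "has_spectral_integral E \<phi> f g \<longleftrightarrow> f \<in> L2 \<and> g \<in> L2 \<and>
     (\<exists>s :: nat \<Rightarrow> real \<Rightarrow> real. (\<forall>n. simple_function borel (s n)) \<and>
        (\<lambda>n. \<integral>\<^sup>+ r. ennreal ((s n r - \<phi> r)\<^sup>2) \<partial>spectral_dist E f) \<longlonglongrightarrow> 0 \<and>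
        (\<lambda>n. l2_norm (\<lambda>j x. simple_spectral_integral E (s n) f j x - g j x)) \<longlonglongrightarrow> 0)"

text \<open>
  \<open>A = \<integral> r dE(r)\<close>, including equality of domains. For a self-adjoint operator with graph \<open>A\<close>,
  the spectral theorem provides exactly one such \<open>E\<close> (up to \<open>ae_eq\<close>).
\<close>

definition spectral_resolution ::
  "(('n::finite) wavefun \<times> 'n wavefun) set \<Rightarrow> (real set \<Rightarrow> 'n wavefun \<Rightarrow> 'n wavefun) \<Rightarrow> bool" where
  "spectral_resolution A E \<longleftrightarrow> projection_valued_measure E \<and>
     (\<forall>u v. (u, v) \<in> A \<longleftrightarrow> has_spectral_integral E (\<lambda>r. r) u v)"

definition functional_calculus ::
  "(real set \<Rightarrow> ('n::finite) wavefun \<Rightarrow> 'n wavefun) \<Rightarrow> (real \<Rightarrow> real) \<Rightarrow> 'n wavefun \<Rightarrow> 'n wavefun" where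
  "functional_calculus E \<phi> f = (SOME g. has_spectral_integral E \<phi> f g)"

text \<open>
  \<open>cos(t \<surd>A)\<close> for a nonnegative self-adjoint \<open>A\<close> with spectral resolution \<open>E\<close>; then \<open>E\<close> vanishes
  on \<open>(-\<infinity>,0)\<close>, so the value of \<open>sqrt\<close> there plays no role.
\<close>

definition cos_sqrt_op ::
  "(real set \<Rightarrow> ('n::finite) wavefun \<Rightarrow> 'n wavefun) \<Rightarrow> real \<Rightarrow> 'n wavefun \<Rightarrow> 'n wavefun" where
  "cos_sqrt_op E t = functional_calculus E (\<lambda>r. cos (t * sqrt r))"


subsection \<open>The kernel\<close>

definition kronecker :: "'n \<Rightarrow> 'n \<Rightarrow> complex" where
  "kronecker j l = (if j = l then 1 else 0)"

definition unit_step :: "real \<Rightarrow> real" where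
  "unit_step s = (if s > 0 then 1 else 0)"

text \<open>
  The pairing \<open>\<integral>\<^sub>0\<^sup>\<infinity> \<delta>(h(y)) f(y) dy\<close> for \<open>h\<close> with finitely many zeros, all simple.
\<close>

definition delta_pairing :: "(real \<Rightarrow> real) \<Rightarrow> (real \<Rightarrow> complex) \<Rightarrow> complex" where
  "delta_pairing h f = (\<Sum>y | 0 < y \<and> h y = 0. f y / of_real \<bar>deriv h y\<bar>)"

text \<open>
  The kernel \<open>G\<^sub>S\<^sub>j\<^sup>l(t,x,y)\<close>, for fixed \<open>t, x\<close> a generalized function of \<open>y\<close>, given by its action
  \<open>f \<mapsto> \<integral>\<^sub>0\<^sup>\<infinity> G\<^sub>S\<^sub>j\<^sup>l(t,x,y) f(y) dy\<close>.
\<close>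

definition G_S :: "real \<Rightarrow> ('n::finite) \<Rightarrow> 'n \<Rightarrow> real \<Rightarrow> real \<Rightarrow> (real \<Rightarrow> complex) \<Rightarrow> complex" where
  "G_S \<alpha> j l t x f = (let N = real CARD('n) in
       1/2 * kronecker j l * (delta_pairing (\<lambda>y. x - y - t) f + delta_pairing (\<lambda>y. x - y + t) f)
     + 1/2 * (of_real (2 / N) - kronecker j l) * delta_pairing (\<lambda>y. x + y - t) f
     - (\<integral>y. of_real (\<alpha> / N\<^sup>2 * exp (- \<alpha> * (t - y - x) / N) * unit_step (t - y - x)) * f y \<partial>half_line))"

definition zero_ext :: "(real \<Rightarrow> complex) \<Rightarrow> real \<Rightarrow> complex" where
  "zero_ext f s = (if s > 0 then f s else 0)"

end

theory Submission
  imports Defs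
begin

text \<open>
  Both sides of the claimed identity are compared through their Laplace transforms in \<open>t\<close>, tested
  against indicators of \<open>(0,b)\<close> on one edge. For the functional calculus,
  \<open>\<integral>\<^sub>0\<^sup>\<infinity> e\<^sup>-\<^sup>p\<^sup>t cos(t\<surd>r) dt = p / (p\<^sup>2 + r)\<close> turns the transform into \<open>p (H + p\<^sup>2)\<^sup>-\<^sup>1\<close>; only
  explicit solutions \<open>u\<close> of \<open>(H + p\<^sup>2) u = f\<close> are needed, never a description of the whole domain of
  \<open>H\<close>. That \<open>E\<close> vanishes on \<open>(-\<infinity>,0)\<close> follows from boundedness of these resolvents. For the
  d'Alembert-type formula, integration over \<open>(0,b)\<close> leaves continuous primitives of \<open>f\<close>, whose
  transforms are elementary. Continuity in \<open>t\<close> and injectivity of the Laplace transform conclude.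
\<close>

section \<open>The space \<open>L\<^sup>2(0,\<infinity>)\<^sup>N\<close>\<close>

text \<open>The definitions give access to \<open>E\<close> only through norm limits of simple
  functions, and \<open>cos_sqrt_op\<close> is a \<open>SOME\<close> choice. Everything is therefore
  read off weakly: \<open>has_spectral_integral\<close> is converted into the form
  \<open>sform\<close>, assembled by polarization from the finite positive measures
  \<open>spectral_dist\<close>, where dominated convergence and Fubini apply. Solving the wave
  equation directly and invoking uniqueness would need time derivatives of the formula, which a
  merely square integrable datum does not provide. The resolvent is a bounded integral operator and
  avoids this. Point values of elements of \<open>L2\<close> mean nothing either, so functions are
  compared through their integrals over (0,b), which determine a locally integrable function almost
  everywhere. The decay rate \<alpha>/N comes from the vertex: the homogeneous part of the resolvent
  carries the denominator \<alpha> + N p = N (p + \<alpha>/N), and 1/(p + \<alpha>/N) is the Laplace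
  transform of \<open>e^(-\<alpha> t/N)\<close>.\<close>

lemma L2_half_measurable: "f \<in> L2_half \<Longrightarrow> f \<in> borel_measurable half_line"
  by (simp add: L2_half_def)

lemma L2_half_integrable_sq: "f \<in> L2_half \<Longrightarrow> integrable half_line (\<lambda>x. (cmod (f x))\<^sup>2)"
  by (simp add: L2_half_def)

lemma L2_half_integrable_mult:
  assumes "f \<in> L2_half" "g \<in> L2_half"
  shows "integrable half_line (\<lambda>x. f x * cnj (g x))"
proof (rule Bochner_Integration.integrable_bound)
  show "integrable half_line (\<lambda>x. (cmod (f x))\<^sup>2 + (cmod (g x))\<^sup>2)"
    using assms by (simp add: L2_half_integrable_sq)
  have [measurable]: "f \<in> borel_measurable half_line" "g \<in> borel_measurable half_line"
    using assms by (auto dest: L2_half_measurable)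
  show "(\<lambda>x. f x * cnj (g x)) \<in> borel_measurable half_line"
    by (intro borel_measurable_times measurable_compose[OF L2_half_measurable[OF assms(2)] borel_measurable_continuous_onI[of cnj]])
       (auto intro: continuous_intros)
  have "cmod a * cmod b \<le> (cmod a)\<^sup>2 + (cmod b)\<^sup>2" for a b
  proof -
    have "2 * (cmod a * cmod b) \<le> (cmod a)\<^sup>2 + (cmod b)\<^sup>2" "0 \<le> cmod a * cmod b"
      using sum_squares_bound[of "cmod a" "cmod b"] by (simp_all add: mult.assoc)
    then show ?thesis by linarith
  qed
  then show "AE x in half_line. norm (f x * cnj (g x)) \<le> norm ((cmod (f x))\<^sup>2 + (cmod (g x))\<^sup>2)"
    by (auto simp: norm_mult)
qed

lemma cmod_lincomb_sq_le:
  "(cmod (a * z + b * w))\<^sup>2 \<le> 2 * (cmod a)\<^sup>2 * (cmod z)\<^sup>2 + 2 * (cmod b)\<^sup>2 * (cmod w)\<^sup>2"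
proof -
  have "(cmod (a * z + b * w))\<^sup>2 \<le> (cmod (a*z) + cmod (b*w))\<^sup>2"
    by (intro power_mono norm_triangle_ineq) auto
  also have "\<dots> \<le> 2 * (cmod (a*z))\<^sup>2 + 2 * (cmod (b*w))\<^sup>2"
    using sum_squares_bound[of "cmod (a*z)" "cmod (b*w)"] by (simp add: power2_sum)
  finally show ?thesis by (simp add: norm_mult power_mult_distrib)
qed

lemma L2_half_lincomb:
  assumes "f \<in> L2_half" "g \<in> L2_half"
  shows "(\<lambda>x. a * f x + b * g x) \<in> L2_half"
proof -
  have [measurable]: "f \<in> borel_measurable half_line" "g \<in> borel_measurable half_line"
    using assms by (auto dest: L2_half_measurable)
  have "integrable half_line (\<lambda>x. (cmod (a * f x + b * g x))\<^sup>2)"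
  proof (rule Bochner_Integration.integrable_bound)
    show "integrable half_line (\<lambda>x. 2 * (cmod a)\<^sup>2 * (cmod (f x))\<^sup>2 + 2 * (cmod b)\<^sup>2 * (cmod (g x))\<^sup>2)"
      using assms by (simp add: L2_half_integrable_sq)
    show "AE x in half_line. norm ((cmod (a * f x + b * g x))\<^sup>2)
        \<le> norm (2 * (cmod a)\<^sup>2 * (cmod (f x))\<^sup>2 + 2 * (cmod b)\<^sup>2 * (cmod (g x))\<^sup>2)"
      by (intro AE_I2) (use cmod_lincomb_sq_le in simp)
  qed measurable
  then show ?thesis by (simp add: L2_half_def)
qed

lemma L2_half_zero: "(\<lambda>x. 0) \<in> L2_half" by (simp add: L2_half_def)

lemma L2_lincomb: "f \<in> L2 \<Longrightarrow> g \<in> L2 \<Longrightarrow> (\<lambda>j x. a * f j x + b * g j x) \<in> L2"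
  by (auto simp: L2_def intro: L2_half_lincomb)

lemma L2_zero: "(\<lambda>j x. 0) \<in> L2" by (simp add: L2_def L2_half_zero)

lemma L2_diff: "f \<in> L2 \<Longrightarrow> g \<in> L2 \<Longrightarrow> (\<lambda>j x. f j x - g j x) \<in> L2"
  using L2_lincomb[of f g 1 "-1"] by simp

lemma L2_add_scale: "f \<in> L2 \<Longrightarrow> g \<in> L2 \<Longrightarrow> (\<lambda>j x. f j x + c * g j x) \<in> L2"
  using L2_lincomb[of f g 1 c] by simp

lemma L2_sum: "(\<And>i. i \<in> I \<Longrightarrow> F i \<in> L2) \<Longrightarrow> (\<lambda>j x. \<Sum>i\<in>I. c i * F i j x) \<in> L2"
proof (induction I rule: infinite_finite_induct)
  case (insert i I)
  then show ?case using L2_lincomb[of "F i" "\<lambda>j x. \<Sum>i\<in>I. c i * F i j x" "c i" 1] by simp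
qed (auto simp: L2_zero)

lemma l2_inner_lincomb_left:
  assumes "f \<in> L2" "g \<in> L2" "h \<in> L2"
  shows "l2_inner (\<lambda>j x. a * f j x + b * g j x) h = a * l2_inner f h + b * l2_inner g h"
proof -
  have "(\<integral>x. (a * f j x + b * g j x) * cnj (h j x) \<partial>half_line) =
        a * (\<integral>x. f j x * cnj (h j x) \<partial>half_line) + b * (\<integral>x. g j x * cnj (h j x) \<partial>half_line)" for j
  proof -
    have "integrable half_line (\<lambda>x. f j x * cnj (h j x))" "integrable half_line (\<lambda>x. g j x * cnj (h j x))"
      using assms by (auto simp: L2_def intro: L2_half_integrable_mult)
    then have "(\<integral>x. a * (f j x * cnj (h j x)) + b * (g j x * cnj (h j x)) \<partial>half_line) =
        a * (\<integral>x. f j x * cnj (h j x) \<partial>half_line) + b * (\<integral>x. g j x * cnj (h j x) \<partial>half_line)"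
      by (subst Bochner_Integration.integral_add) auto
    then show ?thesis by (simp add: algebra_simps)
  qed
  then show ?thesis by (simp add: l2_inner_def sum.distrib sum_distrib_left)
qed

lemma l2_inner_commute: "l2_inner g f = cnj (l2_inner f g)"
proof -
  have "(\<integral>x. g j x * cnj (f j x) \<partial>half_line) = cnj (\<integral>x. f j x * cnj (g j x) \<partial>half_line)" for j
    using Bochner_Integration.integral_cnj[of half_line "\<lambda>x. f j x * cnj (g j x)"] by (simp add: mult.commute)
  then show ?thesis by (simp add: l2_inner_def)
qed

lemma l2_inner_lincomb_right:
  assumes "f \<in> L2" "g \<in> L2" "h \<in> L2"
  shows "l2_inner h (\<lambda>j x. a * f j x + b * g j x) = cnj a * l2_inner h f + cnj b * l2_inner h g"
  by (subst (1 2 3) l2_inner_commute) (simp add: l2_inner_lincomb_left assms)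

lemma l2_inner_zero: "l2_inner (\<lambda>j x. 0) h = 0" "l2_inner h (\<lambda>j x. 0) = 0"
  by (simp_all add: l2_inner_def)

lemma l2_inner_diff_left: "f \<in> L2 \<Longrightarrow> g \<in> L2 \<Longrightarrow> h \<in> L2 \<Longrightarrow>
    l2_inner (\<lambda>j x. f j x - g j x) h = l2_inner f h - l2_inner g h"
  using l2_inner_lincomb_left[of f g h 1 "-1"] by simp

lemma l2_inner_sum_left:
  assumes "\<And>i. i \<in> I \<Longrightarrow> F i \<in> L2" "h \<in> L2"
  shows "l2_inner (\<lambda>j x. \<Sum>i\<in>I. c i * F i j x) h = (\<Sum>i\<in>I. c i * l2_inner (F i) h)"
  using assms(1)
proof (induction I rule: infinite_finite_induct)
  case (insert i I)
  have "l2_inner (\<lambda>j x. c i * F i j x + 1 * (\<Sum>i\<in>I. c i * F i j x)) h =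
      c i * l2_inner (F i) h + 1 * l2_inner (\<lambda>j x. \<Sum>i\<in>I. c i * F i j x) h"
    using insert assms(2) by (intro l2_inner_lincomb_left L2_sum) auto
  then show ?case using insert by simp
qed (auto simp: l2_inner_zero)

lemma l2_inner_self: "l2_inner f f = of_real (\<Sum>j\<in>UNIV. \<integral>x. (cmod (f j x))\<^sup>2 \<partial>half_line)"
proof -
  have "(\<integral>x. f j x * cnj (f j x) \<partial>half_line) = of_real (\<integral>x. (cmod (f j x))\<^sup>2 \<partial>half_line)" for j
    by (subst integral_complex_of_real[symmetric]) (simp add: complex_norm_square del: of_real_power)
  then show ?thesis by (simp add: l2_inner_def)
qed

text \<open>The square of \<open>l2_norm\<close>. Expansions, orthogonality and limits to 0 are
  polynomial statements in it, free of square roots.\<close>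

definition sqn :: "('n::finite) wavefun \<Rightarrow> real" where
  "sqn f = Re (l2_inner f f)"

lemma sqn_eq: "sqn f = (\<Sum>j\<in>UNIV. \<integral>x. (cmod (f j x))\<^sup>2 \<partial>half_line)"
  by (simp add: sqn_def l2_inner_self)

lemma l2_inner_self_sqn: "l2_inner f f = of_real (sqn f)"
  by (simp add: sqn_eq l2_inner_self)

lemma sqn_nonneg: "0 \<le> sqn f"
  by (auto simp: sqn_eq intro!: sum_nonneg Bochner_Integration.integral_nonneg)

lemma l2_norm_sqn: "l2_norm f = sqrt (sqn f)" "(l2_norm f)\<^sup>2 = sqn f"
  by (simp_all add: l2_norm_def sqn_def[symmetric] sqn_nonneg)

lemma l2_norm_tendsto_0_iff: "((\<lambda>n. l2_norm (f n)) \<longlonglongrightarrow> 0) \<longleftrightarrow> ((\<lambda>n. sqn (f n)) \<longlonglongrightarrow> 0)"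
proof
  assume "(\<lambda>n. l2_norm (f n)) \<longlonglongrightarrow> 0"
  then have "(\<lambda>n. (l2_norm (f n))\<^sup>2) \<longlonglongrightarrow> 0\<^sup>2" by (rule tendsto_power)
  then show "(\<lambda>n. sqn (f n)) \<longlonglongrightarrow> 0" by (simp add: l2_norm_sqn(2))
next
  assume "(\<lambda>n. sqn (f n)) \<longlonglongrightarrow> 0"
  then have "(\<lambda>n. sqrt (sqn (f n))) \<longlonglongrightarrow> sqrt 0" by (rule tendsto_real_sqrt)
  then show "(\<lambda>n. l2_norm (f n)) \<longlonglongrightarrow> 0" by (simp add: l2_norm_sqn)
qed

lemma sqn_zero_imp_ae_zero:
  assumes "f \<in> L2" "sqn f = 0"
  shows "AE x in half_line. f j x = 0"
proof -
  have "(\<integral>x. (cmod (f j x))\<^sup>2 \<partial>half_line) = 0"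
    using assms(2) unfolding sqn_eq by (subst (asm) sum_nonneg_eq_0_iff) auto
  moreover have "integrable half_line (\<lambda>x. (cmod (f j x))\<^sup>2)"
    using assms(1) by (auto simp: L2_def intro: L2_half_integrable_sq)
  ultimately have "AE x in half_line. (cmod (f j x))\<^sup>2 = 0"
    by (subst (asm) integral_nonneg_eq_0_iff_AE) auto
  then show ?thesis by simp
qed

lemma sqn_diff_zero_imp_ae_eq:
  assumes "f \<in> L2" "g \<in> L2" "sqn (\<lambda>j x. f j x - g j x) = 0"
  shows "ae_eq f g"
  using sqn_zero_imp_ae_zero[OF L2_diff[OF assms(1,2)] assms(3)] by (simp add: ae_eq_def)

lemma ae_eqI_inner:
  assumes "f \<in> L2" "g \<in> L2" "\<And>h. h \<in> L2 \<Longrightarrow> l2_inner f h = l2_inner g h"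
  shows "ae_eq f g"
  by (rule sqn_diff_zero_imp_ae_eq)
     (use assms L2_diff[OF assms(1,2)] in \<open>auto simp: sqn_def l2_inner_diff_left\<close>)

lemma l2_inner_cong:
  assumes "ae_eq f f'" "ae_eq g g'" "f \<in> L2" "g \<in> L2" "f' \<in> L2" "g' \<in> L2"
  shows "l2_inner f g = l2_inner f' g'"
  unfolding l2_inner_def
proof (intro sum.cong refl integral_cong_AE)
  fix j
  have "integrable half_line (\<lambda>x. f j x * cnj (g j x))" "integrable half_line (\<lambda>x. f' j x * cnj (g' j x))"
    using assms by (auto simp: L2_def intro: L2_half_integrable_mult)
  then show "(\<lambda>x. f j x * cnj (g j x)) \<in> borel_measurable half_line"
    "(\<lambda>x. f' j x * cnj (g' j x)) \<in> borel_measurable half_line"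
    by (auto dest: borel_measurable_integrable)
  have "AE x in half_line. f j x = f' j x" "AE x in half_line. g j x = g' j x"
    using assms by (auto simp: ae_eq_def)
  then show "AE x in half_line. f j x * cnj (g j x) = f' j x * cnj (g' j x)" by eventually_elim simp
qed

lemma sqn_cong: "ae_eq f g \<Longrightarrow> f \<in> L2 \<Longrightarrow> g \<in> L2 \<Longrightarrow> sqn f = sqn g"
  unfolding sqn_def by (simp add: l2_inner_cong[of f g f g])

lemma sqn_scale: "sqn (\<lambda>j x. c * f j x) = (cmod c)\<^sup>2 * sqn f"
  by (simp add: sqn_eq norm_mult power_mult_distrib sum_distrib_left)

lemma sqn_lincomb:
  assumes "f \<in> L2" "g \<in> L2"
  shows "sqn (\<lambda>j x. f j x + c * g j x) = sqn f + 2 * Re (cnj c * l2_inner f g) + (cmod c)\<^sup>2 * sqn g"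
proof -
  have "l2_inner (\<lambda>j x. 1 * f j x + c * g j x) (\<lambda>j x. 1 * f j x + c * g j x)
     = l2_inner f f + cnj c * l2_inner f g + c * cnj (l2_inner f g) + c * cnj c * l2_inner g g"
    using assms L2_lincomb[OF assms, of 1 c]
    by (simp only: l2_inner_lincomb_left l2_inner_lincomb_right l2_inner_commute[of g f])
       (simp add: algebra_simps)
  moreover have "Re (c * cnj z) = Re (cnj c * z)" for z by (simp add: algebra_simps)
  moreover have "Re (c * cnj c * of_real r) = (cmod c)\<^sup>2 * r" for r
    by (metis complex_norm_square Re_complex_of_real of_real_mult)
  ultimately show ?thesis
    unfolding sqn_def[of "\<lambda>j x. f j x + c * g j x"] by (simp add: l2_inner_self_sqn del: complex_cnj_mult)
qed

text \<open>The parallelogram law for f - g and g - h with one nonnegative term dropped. It stands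
  in for the triangle inequality at the level of squared norms.\<close>

lemma sqn_diff_le:
  assumes "f \<in> L2" "g \<in> L2" "h \<in> L2"
  shows "sqn (\<lambda>j x. f j x - h j x) \<le> 2 * sqn (\<lambda>j x. f j x - g j x) + 2 * sqn (\<lambda>j x. g j x - h j x)"
proof -
  let ?u = "\<lambda>j x. f j x - g j x" and ?v = "\<lambda>j x. g j x - h j x"
  have uv: "?u \<in> L2" "?v \<in> L2" using assms by (auto intro: L2_diff)
  have "sqn (\<lambda>j x. ?u j x + 1 * ?v j x) + sqn (\<lambda>j x. ?u j x + (-1) * ?v j x) = 2 * sqn ?u + 2 * sqn ?v"
    by (simp only: sqn_lincomb[OF uv]) simp
  moreover have "(\<lambda>j x. ?u j x + 1 * ?v j x) = (\<lambda>j x. f j x - h j x)" by (simp add: fun_eq_iff)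
  ultimately show ?thesis using sqn_nonneg[of "\<lambda>j x. ?u j x + (-1) * ?v j x"] by simp
qed

lemma l2_Cauchy_Schwarz:
  assumes "f \<in> L2" "g \<in> L2"
  shows "cmod (l2_inner f g) \<le> l2_norm f * l2_norm g"
proof -
  let ?z = "l2_inner f g"
  \<comment> \<open>This is the nonnegativity of \<open>sqn\<close> at f - r z g. The factor z =
    \<open>l2_inner f g\<close> makes the cross term real. The best choice is r = 1 /
    \<open>sqn g\<close>; when \<open>sqn g\<close> vanishes, a large r forces z = 0.\<close>
  have ineq: "0 \<le> sqn f - 2 * r * (cmod ?z)\<^sup>2 + r\<^sup>2 * (cmod ?z)\<^sup>2 * sqn g" for r :: real
  proof -
    have e: "Re (cnj (- of_real r * ?z) * ?z) = - r * (cmod ?z)\<^sup>2"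
      by (simp add: cmod_power2 algebra_simps) (simp add: power2_eq_square)
    have "sqn (\<lambda>j x. f j x + (- of_real r * ?z) * g j x)
        = sqn f + 2 * (- r * (cmod ?z)\<^sup>2) + (cmod (- of_real r * ?z))\<^sup>2 * sqn g"
      unfolding sqn_lincomb[OF assms] e ..
    moreover have "(cmod (- of_real r * ?z))\<^sup>2 = r\<^sup>2 * (cmod ?z)\<^sup>2"
      by (simp add: norm_mult power_mult_distrib)
    ultimately show ?thesis
      using sqn_nonneg[of "\<lambda>j x. f j x + (- of_real r * ?z) * g j x"] by simp
  qed
  have "(cmod ?z)\<^sup>2 \<le> sqn f * sqn g"
  proof (cases "sqn g = 0")
    case True
    have "(cmod ?z)\<^sup>2 = 0"
    proof (rule ccontr)
      assume "(cmod ?z)\<^sup>2 \<noteq> 0"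
      then have "0 \<le> sqn f - 2 * ((sqn f + 1) / (cmod ?z)\<^sup>2) * (cmod ?z)\<^sup>2"
        using ineq[of "(sqn f + 1) / (cmod ?z)\<^sup>2"] True by simp
      then show False using \<open>(cmod ?z)\<^sup>2 \<noteq> 0\<close> sqn_nonneg[of f] by simp
    qed
    then show ?thesis using True by simp
  next
    case False
    then have g: "sqn g > 0" using sqn_nonneg[of g] by simp
    have "0 \<le> sqn f - 2 * (1 / sqn g) * (cmod ?z)\<^sup>2 + (1 / sqn g)\<^sup>2 * (cmod ?z)\<^sup>2 * sqn g" by (rule ineq)
    also have "\<dots> = sqn f - (cmod ?z)\<^sup>2 / sqn g" using g by (simp add: power2_eq_square field_simps)
    finally show ?thesis using g by (simp add: field_simps)
  qed
  then have "sqrt ((cmod ?z)\<^sup>2) \<le> sqrt (sqn f * sqn g)" by (rule real_sqrt_le_mono)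
  then show ?thesis by (simp add: l2_norm_sqn real_sqrt_mult)
qed

lemma l2_inner_tendsto:
  assumes "\<And>n. z n \<in> L2" "h \<in> L2" "g \<in> L2" "(\<lambda>n. sqn (\<lambda>j x. z n j x - h j x)) \<longlonglongrightarrow> 0"
  shows "(\<lambda>n. l2_inner (z n) g) \<longlonglongrightarrow> l2_inner h g"
proof -
  have "(\<lambda>n. l2_norm (\<lambda>j x. z n j x - h j x) * l2_norm g) \<longlonglongrightarrow> 0"
    using assms(4) unfolding l2_norm_tendsto_0_iff[symmetric] by (rule tendsto_mult_left_zero)
  moreover have "\<forall>n. norm (l2_inner (z n) g - l2_inner h g) \<le> l2_norm (\<lambda>j x. z n j x - h j x) * l2_norm g"
  proof
    fix n
    show "norm (l2_inner (z n) g - l2_inner h g) \<le> l2_norm (\<lambda>j x. z n j x - h j x) * l2_norm g"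
      unfolding l2_inner_diff_left[OF assms(1-3), symmetric]
      by (rule l2_Cauchy_Schwarz[OF L2_diff[OF assms(1,2)] assms(3)])
  qed
  ultimately have "(\<lambda>n. l2_inner (z n) g - l2_inner h g) \<longlonglongrightarrow> 0"
    by (rule Lim_null_comparison[OF always_eventually, rotated])
  then show ?thesis by (rule Lim_null[THEN iffD2])
qed

text \<open>Riesz-Fischer for sequences with a geometric rate. The rate 1/16 leaves room: weighted
  by 2^n, the squared increments still have summable integrals, of order (1/8)^n. So the weighted
  series converges almost everywhere, and with it the sequence.\<close>

lemma L2_half_complete:
  fixes z :: "nat \<Rightarrow> real \<Rightarrow> complex"
  assumes z: "\<And>n. z n \<in> L2_half"
    and C: "\<And>n m. n \<le> m \<Longrightarrow> (\<integral>x. (cmod (z m x - z n x))\<^sup>2 \<partial>half_line) \<le> C * (1/16) ^ n"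
  shows "\<exists>h\<in>L2_half. \<forall>n. (\<integral>x. (cmod (z n x - h x))\<^sup>2 \<partial>half_line) \<le> C * (1/16) ^ n"
proof -
  have zm[measurable]: "z n \<in> borel_measurable half_line" for n using z by (rule L2_half_measurable)
  have int: "integrable half_line (\<lambda>x. (cmod (z m x - z n x))\<^sup>2)" for m n
    using L2_half_lincomb[OF z z, of 1 m "-1" n] by (simp add: L2_half_def)
  have C0: "C \<ge> 0"
    using C[of 0 0] by simp
  define d where "d n x = z (Suc n) x - z n x" for n x
  have dm[measurable]: "d n \<in> borel_measurable half_line" for n unfolding d_def by measurable
  have nnC: "(\<integral>\<^sup>+x. ennreal ((cmod (z m x - z n x))\<^sup>2) \<partial>half_line) \<le> ennreal (C * (1/16)^n)"
    if "n \<le> m" for n m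
    using C[OF that] by (subst nn_integral_eq_integral[OF int]) (auto intro: ennreal_leI)
  have "(\<integral>\<^sup>+x. (\<Sum>n. ennreal (2^n * (cmod (d n x))\<^sup>2)) \<partial>half_line)
      = (\<Sum>n. \<integral>\<^sup>+x. ennreal (2^n * (cmod (d n x))\<^sup>2) \<partial>half_line)"
    by (rule nn_integral_suminf) measurable
  also have "\<dots> = (\<Sum>n. ennreal (2^n) * (\<integral>\<^sup>+x. ennreal ((cmod (d n x))\<^sup>2) \<partial>half_line))"
    by (subst nn_integral_cmult[symmetric]) (auto simp: ennreal_mult)
  also have "\<dots> \<le> (\<Sum>n. ennreal (C * (1/8) ^ n))"
  proof (intro suminf_le summableI)
    fix n
    have "ennreal (2^n) * (\<integral>\<^sup>+x. ennreal ((cmod (d n x))\<^sup>2) \<partial>half_line) \<le> ennreal (2^n) * ennreal (C * (1/16)^n)"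
      unfolding d_def by (intro mult_left_mono nnC) auto
    also have "\<dots> = ennreal (C * (1/8)^n)"
      using C0 by (simp add: power_divide flip: ennreal_mult) (simp add: field_simps flip: power_mult_distrib)
    finally show "ennreal (2^n) * (\<integral>\<^sup>+x. ennreal ((cmod (d n x))\<^sup>2) \<partial>half_line) \<le> ennreal (C * (1/8)^n)" .
  qed
  also have "\<dots> < \<infinity>"
  proof -
    have "summable (\<lambda>n. C * (1/8::real) ^ n)" by (intro summable_mult summable_geometric) simp
    then show ?thesis using C0 by (subst suminf_ennreal2) simp_all
  qed
  finally have "AE x in half_line. (\<Sum>n. ennreal (2^n * (cmod (d n x))\<^sup>2)) \<noteq> \<infinity>"
    by (intro nn_integral_PInf_AE) auto
  then have conv: "AE x in half_line. convergent (\<lambda>n. z n x)"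
  proof eventually_elim
    case (elim x)
    then have s: "summable (\<lambda>n. 2^n * (cmod (d n x))\<^sup>2)"
      by (intro summable_suminf_not_top) (auto simp: top_ennreal_def[symmetric])
    have "summable (\<lambda>n. cmod (d n x))"
    proof (rule summable_comparison_test')
      show "summable (\<lambda>n. (1/2)^n + 2^n * (cmod (d n x))\<^sup>2)"
        by (intro summable_add s summable_geometric) auto
      fix n :: nat
      \<comment> \<open>The square trades the increment for its weighted square: |d| is at most
        2^(-n) + 2^n |d|^2, and both terms are summable.\<close>
      have "0 \<le> ((1/2)^n - cmod (d n x))\<^sup>2 * 2^n" by simp
      also have "\<dots> = (1/2)^n - 2 * cmod (d n x) + 2^n * (cmod (d n x))\<^sup>2"
        by (simp add: power2_diff field_simps power_divide) (simp add: power2_eq_square algebra_simps)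
      finally show "norm (cmod (d n x)) \<le> (1/2)^n + 2^n * (cmod (d n x))\<^sup>2"
        by (smt (verit) norm_ge_zero real_norm_def)
    qed
    then have "summable (\<lambda>n. d n x)" by (rule summable_norm_cancel)
    then have "convergent (\<lambda>n. \<Sum>i<n. d i x)" by (simp add: summable_iff_convergent)
    moreover have "(\<Sum>i<n. d i x) = z n x - z 0 x" for n unfolding d_def by (rule sum_lessThan_telescope)
    ultimately have "convergent (\<lambda>n. z n x - z 0 x)" by simp
    from convergent_add[OF this convergent_const[of "z 0 x"]] show ?case by simp
  qed
  define h where "h x = lim (\<lambda>n. z n x)" for x
  have hm[measurable]: "h \<in> borel_measurable half_line" unfolding h_def by measurable
  \<comment> \<open>Fatou's lemma in the second index m transfers the Cauchy estimate to the limit h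
    with the same constant.\<close>
  have nn: "(\<integral>\<^sup>+x. ennreal ((cmod (z n x - h x))\<^sup>2) \<partial>half_line) \<le> ennreal (C * (1/16)^n)" for n
  proof -
    have "AE x in half_line. ennreal ((cmod (z n x - h x))\<^sup>2) = liminf (\<lambda>m. ennreal ((cmod (z m x - z n x))\<^sup>2))"
      using conv
    proof eventually_elim
      case (elim x)
      then have "(\<lambda>m. z m x) \<longlonglongrightarrow> h x" by (simp add: h_def convergent_LIMSEQ_iff)
      then have "(\<lambda>m. ennreal ((cmod (z m x - z n x))\<^sup>2)) \<longlonglongrightarrow> ennreal ((cmod (h x - z n x))\<^sup>2)"
        by (intro tendsto_intros)
      from lim_imp_Liminf[OF _ this] show ?case by (simp add: norm_minus_commute)
    qed
    then have "(\<integral>\<^sup>+x. ennreal ((cmod (z n x - h x))\<^sup>2) \<partial>half_line)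
       = (\<integral>\<^sup>+x. liminf (\<lambda>m. ennreal ((cmod (z m x - z n x))\<^sup>2)) \<partial>half_line)"
      by (rule nn_integral_cong_AE)
    also have "\<dots> \<le> liminf (\<lambda>m. \<integral>\<^sup>+x. ennreal ((cmod (z m x - z n x))\<^sup>2) \<partial>half_line)"
      by (rule nn_integral_liminf) measurable
    also have "\<dots> \<le> ennreal (C * (1/16)^n)"
    proof -
      have "liminf (\<lambda>m. \<integral>\<^sup>+x. ennreal ((cmod (z m x - z n x))\<^sup>2) \<partial>half_line) \<le> liminf (\<lambda>m::nat. ennreal (C * (1/16)^n))"
        by (intro Liminf_mono eventually_sequentiallyI[of n] nnC)
      then show ?thesis by (simp add: Liminf_const)
    qed
    finally show ?thesis .
  qed
  have hi: "integrable half_line (\<lambda>x. (cmod (z n x - h x))\<^sup>2)" for n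
    by (rule integrableI_bounded) (use nn[of n] in \<open>auto simp: less_top top_unique intro: le_less_trans\<close>)
  have "(\<lambda>x. z 0 x - h x) \<in> L2_half" using hi[of 0] by (simp add: L2_half_def)
  from L2_half_lincomb[OF z[of 0] this, of 1 "-1"] have "h \<in> L2_half" by simp
  moreover have "(\<integral>x. (cmod (z n x - h x))\<^sup>2 \<partial>half_line) \<le> C * (1/16)^n" for n
    using nn[of n] C0 by (subst (asm) nn_integral_eq_integral[OF hi]) auto
  ultimately show ?thesis by blast
qed

lemma L2_complete:
  fixes z :: "nat \<Rightarrow> ('n::finite) wavefun"
  assumes z: "\<And>n. z n \<in> L2"
    and C: "\<And>n m. n \<le> m \<Longrightarrow> sqn (\<lambda>j x. z m j x - z n j x) \<le> C * (1/16) ^ n"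
  shows "\<exists>h\<in>L2. (\<lambda>n. sqn (\<lambda>j x. z n j x - h j x)) \<longlonglongrightarrow> 0"
proof -
  have "\<exists>h\<in>L2_half. \<forall>n. (\<integral>x. (cmod (z n j x - h x))\<^sup>2 \<partial>half_line) \<le> C * (1/16) ^ n" for j
  proof (rule L2_half_complete)
    show "z n j \<in> L2_half" for n using z by (simp add: L2_def)
    fix n m :: nat assume "n \<le> m"
    have "(\<integral>x. (cmod (z m j x - z n j x))\<^sup>2 \<partial>half_line) \<le> sqn (\<lambda>j x. z m j x - z n j x)"
      unfolding sqn_eq by (rule member_le_sum[of j UNIV "\<lambda>j. \<integral>x. (cmod (z m j x - z n j x))\<^sup>2 \<partial>half_line"]) auto
    then show "(\<integral>x. (cmod (z m j x - z n j x))\<^sup>2 \<partial>half_line) \<le> C * (1/16)^n"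
      using C[OF \<open>n \<le> m\<close>] by simp
  qed
  then obtain h where h: "\<And>j. h j \<in> L2_half"
    "\<And>j n. (\<integral>x. (cmod (z n j x - h j x))\<^sup>2 \<partial>half_line) \<le> C * (1/16) ^ n" by metis
  have "sqn (\<lambda>j x. z n j x - h j x) \<le> real CARD('n) * (C * (1/16)^n)" for n
    unfolding sqn_eq using h(2) by (intro sum_bounded_above) auto
  moreover have "(\<lambda>n. real CARD('n) * (C * (1/16)^n)) \<longlonglongrightarrow> real CARD('n) * (C * 0)"
    by (intro tendsto_intros LIMSEQ_power_zero) auto
  ultimately have "(\<lambda>n. sqn (\<lambda>j x. z n j x - h j x)) \<longlonglongrightarrow> 0"
    using tendsto_sandwich[OF always_eventually always_eventually tendsto_const, of 0
        "\<lambda>n. sqn (\<lambda>j x. z n j x - h j x)" "\<lambda>n. real CARD('n) * (C * (1/16)^n)"]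
    by (simp add: sqn_nonneg)
  then show ?thesis using h(1) by (auto simp: L2_def)
qed

section \<open>Bounded functional calculus\<close>

lemma squeeze_zero:
  fixes F G :: "nat \<Rightarrow> 'a::{linorder_topology,zero}"
  assumes "\<And>n. 0 \<le> F n" "\<And>n. F n \<le> G n" "G \<longlonglongrightarrow> 0"
  shows "F \<longlonglongrightarrow> 0"
  by (rule tendsto_sandwich[OF always_eventually always_eventually tendsto_const assms(3)]) (use assms in auto)

definition bounded_borel :: "real \<Rightarrow> (real \<Rightarrow> real) \<Rightarrow> bool" where
  "bounded_borel C \<phi> \<longleftrightarrow> \<phi> \<in> borel_measurable borel \<and> (\<forall>r. \<bar>\<phi> r\<bar> \<le> C)"

text \<open>Rounding down to multiples of 8^(-n) gives uniform approximation by finitely many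
  values. Rounding keeps zeros, so a bounded support survives. The squared error 64^(-n) beats the
  rate 16^(-n) asked for by \<open>L2_complete\<close>.\<close>

lemma bounded_borel_uniform_simple:
  assumes "bounded_borel C \<phi>"
  obtains s :: "nat \<Rightarrow> real \<Rightarrow> real" where
    "\<And>n. simple_function borel (s n)" "\<And>n r. \<bar>s n r - \<phi> r\<bar> \<le> (1/8)^n" "\<And>n r. \<phi> r = 0 \<Longrightarrow> s n r = 0"
    "\<And>n r. \<bar>s n r\<bar> \<le> C + 1"
proof
  define s :: "nat \<Rightarrow> real \<Rightarrow> real" where "s n r = of_int \<lfloor>8^n * \<phi> r\<rfloor> / 8^n" for n r
  have [measurable]: "\<phi> \<in> borel_measurable borel" using assms by (simp add: bounded_borel_def)
  have C: "\<bar>\<phi> r\<bar> \<le> C" for r using assms by (simp add: bounded_borel_def)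
  show e: "\<bar>s n r - \<phi> r\<bar> \<le> (1/8)^n" for n r
  proof -
    have "\<bar>of_int \<lfloor>8^n * \<phi> r\<rfloor> - 8^n * \<phi> r\<bar> \<le> 1" by linarith
    then have "\<bar>of_int \<lfloor>8^n * \<phi> r\<rfloor> - 8^n * \<phi> r\<bar> / 8^n \<le> 1 / 8^n" by (rule divide_right_mono) simp
    moreover have "\<bar>s n r - \<phi> r\<bar> = \<bar>of_int \<lfloor>8^n * \<phi> r\<rfloor> - 8^n * \<phi> r\<bar> / 8^n"
    proof -
      have "s n r - \<phi> r = (of_int \<lfloor>8^n * \<phi> r\<rfloor> - 8^n * \<phi> r) / 8^n"
        by (simp add: s_def diff_divide_distrib)
      then show ?thesis by simp
    qed
    ultimately show ?thesis by (simp add: power_divide)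
  qed
  show "\<phi> r = 0 \<Longrightarrow> s n r = 0" for n r by (simp add: s_def)
  show b: "\<bar>s n r\<bar> \<le> C + 1" for n r
  proof -
    have "(1/8::real)^n \<le> 1" by (simp add: power_le_one)
    then show ?thesis using e[of n r] C[of r] by linarith
  qed
  show "simple_function borel (s n)" for n
  proof -
    have "range (s n) \<subseteq> (\<lambda>k. of_int k / 8^n) ` {- \<lceil>8^n * (C+1)\<rceil> .. \<lceil>8^n * (C+1)\<rceil>}"
    proof safe
      fix r
      have "\<bar>of_int \<lfloor>8^n * \<phi> r\<rfloor>\<bar> \<le> 8^n * (C+1)"
        using b[of n r] by (simp add: s_def field_simps)
      then have "\<lfloor>8^n * \<phi> r\<rfloor> \<in> {- \<lceil>8^n * (C+1)\<rceil> .. \<lceil>8^n * (C+1)\<rceil>}" by (auto; linarith)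
      then show "s n r \<in> (\<lambda>k. of_int k / 8^n) ` {- \<lceil>8^n * (C+1)\<rceil> .. \<lceil>8^n * (C+1)\<rceil>}"
        unfolding s_def by (rule imageI)
    qed
    then have "finite (range (s n))" by (rule finite_subset) simp
    moreover have "s n \<in> borel_measurable borel" unfolding s_def by measurable
    ultimately show ?thesis by (simp add: simple_function_borel_measurable)
  qed
qed

section \<open>Scalar spectral measures and the polarized spectral form\<close>

locale pvm =
  fixes E :: "real set \<Rightarrow> ('n::finite) wavefun \<Rightarrow> 'n wavefun"
  assumes pvm: "projection_valued_measure E"
begin

lemma E_proj: "B \<in> sets borel \<Longrightarrow> orthogonal_projection (E B)"
  using pvm by (simp add: projection_valued_measure_def)

lemma E_L2: "B \<in> sets borel \<Longrightarrow> f \<in> L2 \<Longrightarrow> E B f \<in> L2"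
  using E_proj by (simp add: orthogonal_projection_def)

lemma E_lincomb: "B \<in> sets borel \<Longrightarrow> f \<in> L2 \<Longrightarrow> g \<in> L2 \<Longrightarrow>
    ae_eq (E B (\<lambda>j x. a * f j x + b * g j x)) (\<lambda>j x. a * E B f j x + b * E B g j x)"
  using E_proj by (simp add: orthogonal_projection_def)

lemma E_sym: "B \<in> sets borel \<Longrightarrow> f \<in> L2 \<Longrightarrow> g \<in> L2 \<Longrightarrow> l2_inner (E B f) g = l2_inner f (E B g)"
  using E_proj by (simp add: orthogonal_projection_def)

lemma E_UNIV: "f \<in> L2 \<Longrightarrow> ae_eq (E UNIV f) f"
  using pvm by (simp add: projection_valued_measure_def)

lemma E_Int: "A \<in> sets borel \<Longrightarrow> B \<in> sets borel \<Longrightarrow> f \<in> L2 \<Longrightarrow> ae_eq (E (A \<inter> B) f) (E A (E B f))"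
  using pvm by (simp add: projection_valued_measure_def)

lemma E_union: "f \<in> L2 \<Longrightarrow> range F \<subseteq> sets borel \<Longrightarrow> disjoint_family F \<Longrightarrow>
   (\<lambda>n. l2_norm (\<lambda>j x. E (\<Union>i. F i) f j x - (\<Sum>i<n. E (F i) f j x))) \<longlonglongrightarrow> 0" for F :: "nat \<Rightarrow> real set"
  using pvm by (simp add: projection_valued_measure_def)

lemma inner_E_lincomb:
  assumes "B \<in> sets borel" "f \<in> L2" "g \<in> L2" "h \<in> L2"
  shows "l2_inner (E B (\<lambda>j x. a * f j x + b * g j x)) h = a * l2_inner (E B f) h + b * l2_inner (E B g) h"
  using assms by (simp add: E_sym L2_lincomb E_L2 l2_inner_lincomb_left)

lemma inner_E_E:
  assumes "A \<in> sets borel" "B \<in> sets borel" "f \<in> L2" "g \<in> L2"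
  shows "l2_inner (E A f) (E B g) = l2_inner (E (A \<inter> B) f) g"
proof -
  have "l2_inner (E A f) (E B g) = l2_inner (E B (E A f)) g"
    using assms by (simp add: E_sym E_L2)
  also have "\<dots> = l2_inner (E (B \<inter> A) f) g"
  proof (rule l2_inner_cong)
    show "ae_eq (E B (E A f)) (E (B \<inter> A) f)"
      using E_Int[of B A f] assms by (simp add: ae_eq_def eq_commute)
  qed (use assms in \<open>auto simp: E_L2 ae_eq_def\<close>)
  finally show ?thesis by (simp add: Int_commute)
qed

lemma inner_E_self: "B \<in> sets borel \<Longrightarrow> f \<in> L2 \<Longrightarrow> l2_inner (E B f) f = of_real (sqn (E B f))"
  using inner_E_E[of B B f f] by (simp add: l2_inner_self_sqn)

text \<open>Pythagoras: the squared norm of f - E B f equals \<open>sqn f - sqn (E B f)\<close>,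
  because E B is a symmetric idempotent.\<close>

lemma sqn_E_le:
  assumes "B \<in> sets borel" "f \<in> L2"
  shows "sqn (E B f) \<le> sqn f"
proof -
  have "sqn (\<lambda>j x. f j x + (-1) * E B f j x) = sqn f - sqn (E B f)"
    using sqn_lincomb[OF assms(2) E_L2[OF assms], of "-1"] inner_E_self[OF assms]
    by (simp add: E_sym[OF assms assms(2), symmetric] )
  then show ?thesis using sqn_nonneg[of "\<lambda>j x. f j x + (-1) * E B f j x"] by simp
qed

text \<open>The axioms do not state E {} = 0. It follows from additivity for the constant family {}:
  the vectors (1 - n) E {} f must tend to 0.\<close>

lemma sqn_E_empty:
  assumes "f \<in> L2"
  shows "sqn (E {} f) = 0"
proof -
  have "(\<lambda>n. l2_norm (\<lambda>j x. E {} f j x - (\<Sum>i<n. E {} f j x))) \<longlonglongrightarrow> 0"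
    using E_union[OF assms, of "\<lambda>_. {}"] by (simp add: disjoint_family_on_def)
  then have "(\<lambda>n. sqn (\<lambda>j x. E {} f j x - (\<Sum>i<n. E {} f j x))) \<longlonglongrightarrow> 0"
    by (simp only: l2_norm_tendsto_0_iff)
  moreover have "(\<lambda>j x. E {} f j x - (\<Sum>i<n. E {} f j x)) = (\<lambda>j x. (1 - of_nat n) * E {} f j x)" for n :: nat
    by (simp add: fun_eq_iff algebra_simps)
  ultimately have "(\<lambda>n. (cmod (1 - of_nat n))\<^sup>2 * sqn (E {} f)) \<longlonglongrightarrow> 0"
    by (simp only: sqn_scale)
  \<comment> \<open>After shifting by 2 the factor |1 - n| is at least 1, so the null sequence
    dominates the constant \<open>sqn (E {} f)\<close>.\<close>
  from LIMSEQ_ignore_initial_segment[OF this, of 2]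
  have "(\<lambda>n. (cmod (1 - of_nat (n + 2)))\<^sup>2 * sqn (E {} f)) \<longlonglongrightarrow> 0" .
  moreover have "sqn (E {} f) \<le> (cmod (1 - of_nat (n + 2)))\<^sup>2 * sqn (E {} f)" for n :: nat
  proof -
    have "(1::complex) - of_nat (n+2) = - of_nat (n + 1)" by simp
    then have "cmod (1 - of_nat (n + 2)) = real (n + 1)" by (metis norm_minus_cancel norm_of_nat)
    then have "1 \<le> (cmod (1 - of_nat (n + 2)))\<^sup>2" by simp
    from mult_right_mono[OF this sqn_nonneg[of "E {} f"]] show ?thesis by simp
  qed
  ultimately have "sqn (E {} f) \<le> 0" by (intro LIMSEQ_le_const) auto
  then show ?thesis using sqn_nonneg[of "E {} f"] by simp
qed

text \<open>\<open>measure_of\<close> reproduces the given set function only once it is known to be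
  countably additive. That follows from norm convergence of the partial sums of E and continuity of
  the inner product, together with <E B f, f> = \<open>sqn (E B f)\<close>.\<close>

lemma spectral_emeasure:
  assumes f: "f \<in> L2" and B: "B \<in> sets borel"
  shows "emeasure (spectral_dist E f) B = ennreal (sqn (E B f))"
proof -
  have eq: "spectral_dist E f = measure_of UNIV (sets borel) (\<lambda>B. ennreal (Re (l2_inner (E B f) f)))"
    by (simp add: spectral_dist_def)
  have "emeasure (spectral_dist E f) B = ennreal (Re (l2_inner (E B f) f))"
  proof (rule emeasure_measure_of[OF eq])
    show "B \<in> sets (spectral_dist E f)"
      unfolding spectral_dist_def using B by (simp add: sets.sigma_sets_eq[of borel, simplified])
    show "positive (sets (spectral_dist E f)) (\<lambda>B. ennreal (Re (l2_inner (E B f) f)))"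
      by (simp add: positive_def inner_E_self f sqn_E_empty)
    show "countably_additive (sets (spectral_dist E f)) (\<lambda>B. ennreal (Re (l2_inner (E B f) f)))"
    proof (rule countably_additiveI)
      fix F :: "nat \<Rightarrow> real set"
      assume F: "range F \<subseteq> sets (spectral_dist E f)" and d: "disjoint_family F"
      have F': "range F \<subseteq> sets borel"
        using F unfolding spectral_dist_def by (simp add: sets.sigma_sets_eq[of borel, simplified])
      then have Fi: "F i \<in> sets borel" for i by auto
      then have U: "(\<Union>i. F i) \<in> sets borel" by auto
      have L: "(\<lambda>j x. \<Sum>i<n. 1 * E (F i) f j x) \<in> L2" for n
        by (rule L2_sum) (use E_L2 f Fi in auto)
      have "(\<lambda>n. sqn (\<lambda>j x. (\<Sum>i<n. 1 * E (F i) f j x) - E (\<Union>i. F i) f j x)) \<longlonglongrightarrow> 0"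
        using E_union[OF f F' d] unfolding l2_norm_tendsto_0_iff
        by (simp add: sqn_eq norm_minus_commute)
      from l2_inner_tendsto[OF L E_L2[OF U f] f this]
      have "(\<lambda>n. l2_inner (\<lambda>j x. \<Sum>i<n. 1 * E (F i) f j x) f) \<longlonglongrightarrow> l2_inner (E (\<Union>i. F i) f) f" .
      moreover have "l2_inner (\<lambda>j x. \<Sum>i<n. 1 * E (F i) f j x) f = (\<Sum>i<n. 1 * l2_inner (E (F i) f) f)" for n
        by (rule l2_inner_sum_left) (use E_L2 f Fi in auto)
      ultimately have "(\<lambda>n. \<Sum>i<n. of_real (sqn (E (F i) f))) \<longlonglongrightarrow> complex_of_real (sqn (E (\<Union>i. F i) f))"
        using inner_E_self[OF U f] inner_E_self[OF Fi f] by simp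
      then have "(\<lambda>n. complex_of_real (\<Sum>i<n. sqn (E (F i) f))) \<longlonglongrightarrow> complex_of_real (sqn (E (\<Union>i. F i) f))"
        by simp
      then have "(\<lambda>i. sqn (E (F i) f)) sums sqn (E (\<Union>i. F i) f)"
        unfolding sums_def by (simp only: tendsto_of_real_iff)
      then have "(\<lambda>i. ennreal (sqn (E (F i) f))) sums ennreal (sqn (E (\<Union>i. F i) f))"
        by (simp add: sums_ennreal sqn_nonneg)
      from sums_unique[OF this]
      show "(\<Sum>i. ennreal (Re (l2_inner (E (F i) f) f))) = ennreal (Re (l2_inner (E (\<Union>i. F i) f) f))"
        using inner_E_self[OF U f] inner_E_self[OF Fi f] by simp
    qed
  qed simp
  then show ?thesis by (simp add: inner_E_self f B)
qed

lemma sets_spectral[simp, measurable_cong]: "sets (spectral_dist E f) = sets borel"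
  unfolding spectral_dist_def by (simp add: sets.sigma_sets_eq[of borel, simplified])

lemma space_spectral[simp]: "space (spectral_dist E f) = UNIV"
  unfolding spectral_dist_def by (simp add: space_measure_of)

lemma borel_measurable_spectral[simp]: "borel_measurable (spectral_dist E f) = borel_measurable borel"
  by (rule measurable_cong_sets) simp_all

lemma sqn_E_UNIV: "f \<in> L2 \<Longrightarrow> sqn (E UNIV f) = sqn f"
  by (rule sqn_cong) (auto intro: E_UNIV E_L2)

lemma finite_spectral: "f \<in> L2 \<Longrightarrow> finite_measure (spectral_dist E f)"
  by (rule finite_measureI) (simp add: spectral_emeasure)

lemma spectral_measure:
  "f \<in> L2 \<Longrightarrow> B \<in> sets borel \<Longrightarrow> measure (spectral_dist E f) B = sqn (E B f)"
  by (simp add: measure_def spectral_emeasure sqn_nonneg)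

lemma spectral_measure_UNIV: "f \<in> L2 \<Longrightarrow> measure (spectral_dist E f) UNIV = sqn f"
  by (simp add: spectral_measure sqn_E_UNIV)

lemma integrable_spectral:
  assumes "f \<in> L2" "bounded_borel C \<phi>"
  shows "integrable (spectral_dist E f) \<phi>"
proof -
  interpret finite_measure "spectral_dist E f" using assms(1) by (rule finite_spectral)
  show ?thesis
    by (rule integrable_const_bound[where B=C]) (use assms in \<open>auto simp: bounded_borel_def\<close>)
qed

text \<open>The four vectors of the complex polarization identity. They replace the complex measure
  <E f, g> by four finite positive ones.\<close>

definition pol :: "'n wavefun \<Rightarrow> 'n wavefun \<Rightarrow> nat \<Rightarrow> 'n wavefun" where
  "pol f g k = (\<lambda>j x. f j x + \<i>^k * g j x)"

text \<open>The polarized form \<open>\<integral> \<phi> d\<langle>E f, g\<rangle>\<close>.\<close>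
definition sform :: "(real \<Rightarrow> real) \<Rightarrow> 'n wavefun \<Rightarrow> 'n wavefun \<Rightarrow> complex" where
  "sform \<phi> f g = (\<Sum>k<4. \<i>^k * of_real (\<integral>r. \<phi> r \<partial>spectral_dist E (pol f g k))) / 4"

lemma pol_L2: "f \<in> L2 \<Longrightarrow> g \<in> L2 \<Longrightarrow> pol f g k \<in> L2"
  unfolding pol_def by (rule L2_add_scale)

lemma sum_lt_4: "(\<Sum>k<4. F k) = F 0 + F 1 + F 2 + F (3::nat)" for F :: "nat \<Rightarrow> 'a::comm_monoid_add"
  by (simp add: eval_nat_numeral)

lemma i_cubed: "\<i>^3 = - \<i>"
  by (simp add: eval_nat_numeral)

text \<open>Polarization: multiplying by i^k and summing over k < 4 cancels every term of the
  expanded quadratic form except four copies of <E B f, g>.\<close>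

lemma sform_indicator:
  assumes "B \<in> sets borel" "f \<in> L2" "g \<in> L2"
  shows "sform (indicator B) f g = l2_inner (E B f) g"
proof -
  have q: "of_real (\<integral>r. indicator B r \<partial>spectral_dist E (pol f g k)) =
     l2_inner (E B f) f + cnj (\<i>^k) * l2_inner (E B f) g + \<i>^k * l2_inner (E B g) f
       + \<i>^k * cnj (\<i>^k) * l2_inner (E B g) g" for k
  proof -
    have "of_real (\<integral>r. indicator B r \<partial>spectral_dist E (pol f g k)) = l2_inner (E B (pol f g k)) (pol f g k)"
      using assms by (simp add: spectral_measure pol_L2 inner_E_self)
    also have "\<dots> = l2_inner (E B (\<lambda>j x. 1 * f j x + \<i>^k * g j x)) (\<lambda>j x. 1 * f j x + \<i>^k * g j x)"
      by (simp add: pol_def)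
    also have "\<dots> = 1 * l2_inner (E B f) (\<lambda>j x. 1 * f j x + \<i>^k * g j x) + \<i>^k * l2_inner (E B g) (\<lambda>j x. 1 * f j x + \<i>^k * g j x)"
      using assms by (intro inner_E_lincomb L2_lincomb)
    also have "l2_inner (E B f) (\<lambda>j x. 1 * f j x + \<i>^k * g j x) = cnj 1 * l2_inner (E B f) f + cnj (\<i>^k) * l2_inner (E B f) g"
      using assms by (intro l2_inner_lincomb_right E_L2)
    also have "l2_inner (E B g) (\<lambda>j x. 1 * f j x + \<i>^k * g j x) = cnj 1 * l2_inner (E B g) f + cnj (\<i>^k) * l2_inner (E B g) g"
      using assms by (intro l2_inner_lincomb_right E_L2)
    finally show ?thesis by (simp add: algebra_simps)
  qed
  show ?thesis
    unfolding sform_def sum_lt_4 q by (simp add: i_cubed algebra_simps)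
qed

text \<open>The cross terms carry the powers of i, whose sum over a full period is 0.\<close>

lemma sqn_pol_sum:
  assumes "f \<in> L2" "g \<in> L2"
  shows "(\<Sum>k<4. sqn (pol f g k)) = 4 * (sqn f + sqn g)"
  unfolding pol_def sqn_lincomb[OF assms] sum_lt_4 by (simp add: i_cubed norm_power)

text \<open>Each of the four measures has total mass \<open>sqn (pol f g k)\<close>, and
  \<open>sqn_pol_sum\<close> adds these up. The additive bound replaces the sharper product of
  norms; it serves both the growth condition of the Laplace argument and the smallness argument near
  negative spectral points.\<close>

lemma sform_bound:
  assumes "bounded_borel C \<phi>" "f \<in> L2" "g \<in> L2"
  shows "cmod (sform \<phi> f g) \<le> C * (sqn f + sqn g)"
proof -
  have "cmod (\<i>^k * of_real (\<integral>r. \<phi> r \<partial>spectral_dist E (pol f g k))) \<le> C * sqn (pol f g k)" for k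
  proof -
    interpret finite_measure "spectral_dist E (pol f g k)" using assms by (simp add: finite_spectral pol_L2)
    have "\<bar>\<integral>r. \<phi> r \<partial>spectral_dist E (pol f g k)\<bar> \<le> (\<integral>r. \<bar>\<phi> r\<bar> \<partial>spectral_dist E (pol f g k))"
      by (rule integral_abs_bound)
    also have "\<dots> \<le> (\<integral>r. C \<partial>spectral_dist E (pol f g k))"
      using assms integrable_spectral[OF pol_L2 assms(1)]
      by (intro Bochner_Integration.integral_mono) (auto simp: bounded_borel_def)
    finally show ?thesis using assms by (simp add: norm_mult norm_power spectral_measure_UNIV pol_L2 mult.commute)
  qed
  then have "cmod (\<Sum>k<4. \<i>^k * of_real (\<integral>r. \<phi> r \<partial>spectral_dist E (pol f g k))) \<le> (\<Sum>k<4. C * sqn (pol f g k))"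
    by (rule sum_norm_le)
  also have "\<dots> = 4 * (C * (sqn f + sqn g))"
    using sqn_pol_sum[OF assms(2,3)] by (simp add: sum_distrib_left[symmetric])
  finally show ?thesis by (simp add: sform_def norm_divide)
qed

lemma sform_tendsto:
  assumes "\<And>n. bounded_borel C (s n)" "\<And>r. (\<lambda>n. s n r) \<longlonglongrightarrow> \<phi> r" "\<phi> \<in> borel_measurable borel" "f \<in> L2" "g \<in> L2"
  shows "(\<lambda>n. sform (s n) f g) \<longlonglongrightarrow> sform \<phi> f g"
proof -
  have "(\<lambda>n. \<integral>r. s n r \<partial>spectral_dist E (pol f g k)) \<longlonglongrightarrow> (\<integral>r. \<phi> r \<partial>spectral_dist E (pol f g k))" for k
  proof -
    interpret finite_measure "spectral_dist E (pol f g k)" using assms by (simp add: finite_spectral pol_L2)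
    show ?thesis
      by (rule integral_dominated_convergence[where w="\<lambda>_. C"]) (use assms in \<open>auto simp: bounded_borel_def\<close>)
  qed
  then show ?thesis unfolding sform_def by (intro tendsto_intros) auto
qed

lemma sform_sum:
  assumes "\<And>i. i \<in> I \<Longrightarrow> bounded_borel C (F i)" "f \<in> L2" "g \<in> L2"
  shows "sform (\<lambda>r. \<Sum>i\<in>I. c i * F i r) f g = (\<Sum>i\<in>I. of_real (c i) * sform (F i) f g)"
proof -
  have "(\<integral>r. (\<Sum>i\<in>I. c i * F i r) \<partial>spectral_dist E (pol f g k)) = (\<Sum>i\<in>I. c i * (\<integral>r. F i r \<partial>spectral_dist E (pol f g k)))" for k
    using integrable_spectral[OF pol_L2 assms(1)] assms(2,3)
    by (subst Bochner_Integration.integral_sum) auto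
  then show ?thesis
    unfolding sform_def
    by (simp add: sum_distrib_left sum_divide_distrib) (subst sum.swap, simp add: mult_ac)
qed

lemma simple_finite: "simple_function borel s \<Longrightarrow> finite (range s)" for s :: "real \<Rightarrow> real"
  using simple_functionD(1)[of borel s] by simp

lemma simple_vimage: "simple_function borel s \<Longrightarrow> s -` {c} \<in> sets borel" for s :: "real \<Rightarrow> real"
  using simple_functionD(2)[of borel s "{c}"] by simp

lemma simple_expand:
  fixes s :: "real \<Rightarrow> real"
  assumes "simple_function borel s"
  shows "s r = (\<Sum>c\<in>range s. c * indicator (s -` {c}) r)"
proof -
  have "(\<Sum>c\<in>range s. c * indicator (s -` {c}) r) = (\<Sum>c\<in>range s. if c = s r then c else 0)"
    by (intro sum.cong) (auto simp: indicator_def)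
  then show ?thesis using simple_finite[OF assms] by simp
qed

lemma bounded_borel_indicator: "B \<in> sets borel \<Longrightarrow> bounded_borel 1 (indicator B)"
  by (auto simp: bounded_borel_def indicator_def)

lemma ssi_L2:
  assumes "simple_function borel s" "f \<in> L2"
  shows "simple_spectral_integral E s f \<in> L2"
  unfolding simple_spectral_integral_def
  by (rule L2_sum) (use assms simple_vimage E_L2 in auto)

lemma inner_ssi:
  assumes "simple_function borel s" "f \<in> L2" "g \<in> L2"
  shows "l2_inner (simple_spectral_integral E s f) g = (\<Sum>c\<in>range s. of_real c * l2_inner (E (s -` {c}) f) g)"
  unfolding simple_spectral_integral_def
  by (rule l2_inner_sum_left) (use assms simple_vimage E_L2 in auto)

lemma sform_simple:
  assumes "simple_function borel s" "f \<in> L2" "g \<in> L2"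
  shows "sform s f g = l2_inner (simple_spectral_integral E s f) g"
proof -
  have "s = (\<lambda>r. \<Sum>c\<in>range s. c * indicator (s -` {c}) r)" using simple_expand[OF assms(1)] by (rule ext)
  then have "sform s f g = sform (\<lambda>r. \<Sum>c\<in>range s. c * indicator (s -` {c}) r) f g" by simp
  also have "\<dots> = (\<Sum>c\<in>range s. of_real c * sform (indicator (s -` {c})) f g)"
    using assms by (intro sform_sum[where C=1]) (auto intro: bounded_borel_indicator simple_vimage)
  finally show ?thesis using assms by (simp add: inner_ssi sform_indicator simple_vimage)
qed

text \<open>The isometry property of simple spectral integrals, in bilinear form. It rests on <E A
  f, E B f> = <E (A \<inter> B) f, f>, so mixed level sets contribute the spectral measure of their
  intersection.\<close>

lemma integral_simple_mult:
  assumes "simple_function borel s" "simple_function borel s'" "f \<in> L2"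
  shows "l2_inner (simple_spectral_integral E s f) (simple_spectral_integral E s' f) =
     of_real (\<integral>r. s r * s' r \<partial>spectral_dist E f)"
proof -
  note v = simple_vimage[OF assms(1)] simple_vimage[OF assms(2)]
  interpret finite_measure "spectral_dist E f" using assms by (simp add: finite_spectral)
  have "s r * s' r = (\<Sum>c\<in>range s. \<Sum>d\<in>range s'. c * d * indicator (s -` {c} \<inter> s' -` {d}) r)" for r
    by (subst (1) simple_expand[OF assms(1)], subst (1) simple_expand[OF assms(2)])
       (simp add: sum_product indicator_inter_arith algebra_simps)
  then have "(\<integral>r. s r * s' r \<partial>spectral_dist E f)
     = (\<integral>r. (\<Sum>c\<in>range s. \<Sum>d\<in>range s'. c * d * indicator (s -` {c} \<inter> s' -` {d}) r) \<partial>spectral_dist E f)"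
    by simp
  also have "\<dots> = (\<Sum>c\<in>range s. \<Sum>d\<in>range s'. c * d * sqn (E (s -` {c} \<inter> s' -` {d}) f))"
    using v assms(3) by (simp add: spectral_measure emeasure_eq_measure)
  finally have eq: "of_real (\<integral>r. s r * s' r \<partial>spectral_dist E f)
     = (\<Sum>c\<in>range s. \<Sum>d\<in>range s'. of_real (c * d) * l2_inner (E (s -` {c} \<inter> s' -` {d}) f) f)"
    using v assms(3) by (simp add: inner_E_self)
  have "l2_inner (simple_spectral_integral E s f) (simple_spectral_integral E s' f)
     = (\<Sum>c\<in>range s. of_real c * l2_inner (E (s -` {c}) f) (simple_spectral_integral E s' f))"
    using assms by (simp add: inner_ssi ssi_L2)
  also have "\<dots> = (\<Sum>c\<in>range s. of_real c * cnj (\<Sum>d\<in>range s'. of_real d * l2_inner (E (s' -` {d}) f) (E (s -` {c}) f)))"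
    using assms v by (subst (1) l2_inner_commute) (simp add: inner_ssi E_L2)
  also have "\<dots> = (\<Sum>c\<in>range s. of_real c * (\<Sum>d\<in>range s'. of_real d * l2_inner (E (s -` {c}) f) (E (s' -` {d}) f)))"
    by (simp add: l2_inner_commute[symmetric])
  finally show ?thesis using v assms(3)
    by (simp add: eq inner_E_E sum_distrib_left algebra_simps)
qed

lemma simple_mult_integrable:
  assumes "simple_function borel s" "simple_function borel s'" "f \<in> L2"
  shows "integrable (spectral_dist E f) (\<lambda>r. s r * s' r :: real)"
proof -
  have s: "simple_function borel (\<lambda>r. s r * s' r)" using assms by (intro simple_function_mult)
  then have "bounded_borel (Max ((\<lambda>r. \<bar>s r * s' r\<bar>) ` UNIV)) (\<lambda>r. s r * s' r)"
    unfolding bounded_borel_def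
  proof (intro conjI allI Max_ge borel_measurable_simple_function)
    show "finite (range (\<lambda>r. \<bar>s r * s' r\<bar>))"
      using finite_imageI[OF simple_finite[OF s], of abs] by (simp add: image_image)
  qed auto
  then show ?thesis by (rule integrable_spectral[OF assms(3)])
qed

lemma sqn_ssi_diff:
  assumes "simple_function borel s" "simple_function borel s'" "f \<in> L2"
  shows "sqn (\<lambda>j x. simple_spectral_integral E s f j x - simple_spectral_integral E s' f j x)
     = (\<integral>r. (s r - s' r)\<^sup>2 \<partial>spectral_dist E f)"
proof -
  let ?S = "simple_spectral_integral E s f" and ?S' = "simple_spectral_integral E s' f"
  have L: "?S \<in> L2" "?S' \<in> L2" using assms by (auto intro: ssi_L2)
  have "sqn (\<lambda>j x. ?S j x + (-1) * ?S' j x) = sqn ?S + 2 * Re (cnj (-1) * l2_inner ?S ?S') + (cmod (-1))\<^sup>2 * sqn ?S'"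
    by (rule sqn_lincomb[OF L])
  also have "\<dots> = (\<integral>r. s r * s r \<partial>spectral_dist E f) - 2 * (\<integral>r. s r * s' r \<partial>spectral_dist E f)
     + (\<integral>r. s' r * s' r \<partial>spectral_dist E f)"
    using assms by (simp add: sqn_def integral_simple_mult)
  also have "\<dots> = (\<integral>r. s r * s r - 2 * (s r * s' r) + s' r * s' r \<partial>spectral_dist E f)"
    using simple_mult_integrable[OF assms(1,1,3)] simple_mult_integrable[OF assms(1,2,3)] simple_mult_integrable[OF assms(2,2,3)]
    by simp
  also have "\<dots> = (\<integral>r. (s r - s' r)\<^sup>2 \<partial>spectral_dist E f)"
    by (simp add: power2_eq_square algebra_simps)
  finally show ?thesis by simp
qed

text \<open>The same isometry in extended nonnegative integrals, the form in which
  \<open>has_spectral_integral\<close> measures convergence.\<close>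

lemma sqn_ssi_diff_nn:
  assumes "simple_function borel s" "simple_function borel s'" "f \<in> L2"
  shows "ennreal (sqn (\<lambda>j x. simple_spectral_integral E s f j x - simple_spectral_integral E s' f j x))
     = (\<integral>\<^sup>+r. ennreal ((s r - s' r)\<^sup>2) \<partial>spectral_dist E f)"
proof -
  have d: "simple_function borel (\<lambda>r. s r - s' r)" using assms by (intro simple_function_diff)
  show ?thesis
    unfolding sqn_ssi_diff[OF assms]
    using simple_mult_integrable[OF d d assms(3)]
    by (subst nn_integral_eq_integral) (auto simp: power2_eq_square)
qed

text \<open>The simple functions supplied by the definition converge only in L2 of the spectral
  measure of f, whereas \<open>sform\<close> integrates against the measures of f + i^k g. They are
  therefore exchanged for uniformly convergent ones, for which both the norm limit h and the form
  limit are available.\<close>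

lemma has_spectral_integral_sform:
  assumes h: "has_spectral_integral E \<phi> f h" and b: "bounded_borel C \<phi>" and g: "g \<in> L2"
  shows "l2_inner h g = sform \<phi> f g"
proof -
  have f: "f \<in> L2" and hL: "h \<in> L2" using h by (auto simp: has_spectral_integral_def)
  let ?I = "simple_spectral_integral E"
  obtain s where s: "\<And>n. simple_function borel (s n)"
    and sl: "(\<lambda>n. \<integral>\<^sup>+ r. ennreal ((s n r - \<phi> r)\<^sup>2) \<partial>spectral_dist E f) \<longlonglongrightarrow> 0"
    and sc: "(\<lambda>n. l2_norm (\<lambda>j x. ?I (s n) f j x - h j x)) \<longlonglongrightarrow> 0"
    using h unfolding has_spectral_integral_def by blast
  obtain s' where s': "\<And>n. simple_function borel (s' n)" "\<And>n r. \<bar>s' n r - \<phi> r\<bar> \<le> (1/8)^n"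
    "\<And>n r. \<bar>s' n r\<bar> \<le> C + 1" using bounded_borel_uniform_simple[OF b] by metis
  have [measurable]: "\<phi> \<in> borel_measurable borel" using b by (simp add: bounded_borel_def)
  have [measurable]: "s n \<in> borel_measurable borel" "s' n \<in> borel_measurable borel" for n
    using s s'(1) by (auto intro: borel_measurable_simple_function)
  have p0: "(\<lambda>n. (1/8::real)^n) \<longlonglongrightarrow> 0" by (intro LIMSEQ_power_zero) simp
  \<comment> \<open>By the isometry, the two approximating sequences have the same limit: their
    pointwise distance is controlled through \<phi>, by the given L2 error and by the uniform error
    8^(-n) on a measure of finite mass.\<close>
  have diff: "(\<lambda>n. sqn (\<lambda>j x. ?I (s n) f j x - ?I (s' n) f j x)) \<longlonglongrightarrow> 0"
  proof -
    have le: "ennreal (sqn (\<lambda>j x. ?I (s n) f j x - ?I (s' n) f j x))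
       \<le> 2 * (\<integral>\<^sup>+ r. ennreal ((s n r - \<phi> r)\<^sup>2) \<partial>spectral_dist E f) + ennreal (2 * ((1/8)^n)\<^sup>2 * sqn f)" for n
    proof -
      have pw: "ennreal ((s n r - s' n r)\<^sup>2) \<le> 2 * ennreal ((s n r - \<phi> r)\<^sup>2) + ennreal (2 * ((1/8)^n)\<^sup>2)" for r
      proof -
        have "0 \<le> ((s n r - \<phi> r) - (\<phi> r - s' n r))\<^sup>2" by simp
        then have "(s n r - s' n r)\<^sup>2 \<le> 2 * (s n r - \<phi> r)\<^sup>2 + 2 * (s' n r - \<phi> r)\<^sup>2"
          by (simp add: power2_eq_square algebra_simps)
        moreover have "(s' n r - \<phi> r)\<^sup>2 \<le> ((1/8)^n)\<^sup>2"
          using power_mono[OF s'(2)[where n=n and r=r] abs_ge_zero, of 2] by simp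
        ultimately have "(s n r - s' n r)\<^sup>2 \<le> 2 * (s n r - \<phi> r)\<^sup>2 + 2 * ((1/8)^n)\<^sup>2" by linarith
        then have "ennreal ((s n r - s' n r)\<^sup>2) \<le> ennreal (2 * (s n r - \<phi> r)\<^sup>2 + 2 * ((1/8)^n)\<^sup>2)"
          by (rule ennreal_leI)
        also have "\<dots> = 2 * ennreal ((s n r - \<phi> r)\<^sup>2) + ennreal (2 * ((1/8)^n)\<^sup>2)"
          by (subst ennreal_plus) (auto simp: ennreal_mult)
        finally show ?thesis .
      qed
      have "ennreal (sqn (\<lambda>j x. ?I (s n) f j x - ?I (s' n) f j x)) = (\<integral>\<^sup>+r. ennreal ((s n r - s' n r)\<^sup>2) \<partial>spectral_dist E f)"
        by (rule sqn_ssi_diff_nn[OF s s'(1) f])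
      also have "\<dots> \<le> (\<integral>\<^sup>+r. 2 * ennreal ((s n r - \<phi> r)\<^sup>2) + ennreal (2 * ((1/8)^n)\<^sup>2) \<partial>spectral_dist E f)"
        by (intro nn_integral_mono pw)
      also have "\<dots> = 2 * (\<integral>\<^sup>+ r. ennreal ((s n r - \<phi> r)\<^sup>2) \<partial>spectral_dist E f) + ennreal (2 * ((1/8)^n)\<^sup>2) * emeasure (spectral_dist E f) UNIV"
        by (subst nn_integral_add) (auto simp: nn_integral_cmult)
      also have "ennreal (2 * ((1/8)^n)\<^sup>2) * emeasure (spectral_dist E f) UNIV = ennreal (2 * ((1/8)^n)\<^sup>2 * sqn f)"
        by (simp add: spectral_emeasure f sqn_E_UNIV ennreal_mult sqn_nonneg)
      finally show ?thesis .
    qed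
    have "(\<lambda>n. 2 * ((1/8::real)^n)\<^sup>2 * sqn f) \<longlonglongrightarrow> 2 * 0\<^sup>2 * sqn f"
      by (intro tendsto_intros p0)
    from tendsto_ennrealI[OF this] have "(\<lambda>n. ennreal (2 * ((1/8)^n)\<^sup>2 * sqn f)) \<longlonglongrightarrow> 0" by simp
    moreover have "(\<lambda>n. 2 * (\<integral>\<^sup>+ r. ennreal ((s n r - \<phi> r)\<^sup>2) \<partial>spectral_dist E f)) \<longlonglongrightarrow> 2 * 0"
      by (rule ennreal_tendsto_cmult[OF _ sl]) simp
    ultimately have "(\<lambda>n. 2 * (\<integral>\<^sup>+ r. ennreal ((s n r - \<phi> r)\<^sup>2) \<partial>spectral_dist E f) + ennreal (2 * ((1/8)^n)\<^sup>2 * sqn f)) \<longlonglongrightarrow> 2 * 0 + 0"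
      by (intro tendsto_add)
    then have "(\<lambda>n. 2 * (\<integral>\<^sup>+ r. ennreal ((s n r - \<phi> r)\<^sup>2) \<partial>spectral_dist E f) + ennreal (2 * ((1/8)^n)\<^sup>2 * sqn f)) \<longlonglongrightarrow> 0"
      by simp
    then have "(\<lambda>n. ennreal (sqn (\<lambda>j x. ?I (s n) f j x - ?I (s' n) f j x))) \<longlonglongrightarrow> 0"
      by (rule squeeze_zero[OF zero_le le])
    then have "(\<lambda>n. ennreal (sqn (\<lambda>j x. ?I (s n) f j x - ?I (s' n) f j x))) \<longlonglongrightarrow> ennreal 0" by simp
    then show ?thesis by (subst (asm) tendsto_ennreal_iff) (auto simp: sqn_nonneg)
  qed
  have sL: "?I (s n) f \<in> L2" "?I (s' n) f \<in> L2" for n using s s'(1) f by (auto intro: ssi_L2)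
  have conv: "(\<lambda>n. sqn (\<lambda>j x. ?I (s' n) f j x - h j x)) \<longlonglongrightarrow> 0"
  proof -
    have "(\<lambda>n. 2 * sqn (\<lambda>j x. ?I (s' n) f j x - ?I (s n) f j x) + 2 * sqn (\<lambda>j x. ?I (s n) f j x - h j x)) \<longlonglongrightarrow> 2 * 0 + 2 * 0"
      using diff sc unfolding l2_norm_tendsto_0_iff
      by (intro tendsto_add tendsto_mult tendsto_const) (simp_all add: sqn_eq norm_minus_commute)
    then have "(\<lambda>n. 2 * sqn (\<lambda>j x. ?I (s' n) f j x - ?I (s n) f j x) + 2 * sqn (\<lambda>j x. ?I (s n) f j x - h j x)) \<longlonglongrightarrow> 0" by simp
    from squeeze_zero[OF sqn_nonneg sqn_diff_le[OF sL(2) sL(1) hL] this] show ?thesis .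
  qed
  have "(\<lambda>n. l2_inner (?I (s' n) f) g) \<longlonglongrightarrow> l2_inner h g"
    by (rule l2_inner_tendsto[OF sL(2) hL g conv])
  moreover have "(\<lambda>n. l2_inner (?I (s' n) f) g) \<longlonglongrightarrow> sform \<phi> f g"
  proof -
    have "(\<lambda>n. s' n r) \<longlonglongrightarrow> \<phi> r" for r
    proof -
      have "(\<lambda>n. s' n r - \<phi> r) \<longlonglongrightarrow> 0"
        by (rule Lim_null_comparison[OF always_eventually p0]) (use s'(2) in auto)
      then show ?thesis by (rule Lim_null[THEN iffD2])
    qed
    then have "(\<lambda>n. sform (s' n) f g) \<longlonglongrightarrow> sform \<phi> f g"
      using s'(3) f g by (intro sform_tendsto[where C="C+1"]) (auto simp: bounded_borel_def)
    then show ?thesis by (simp add: sform_simple[OF s'(1) f g])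
  qed
  ultimately show ?thesis by (rule LIMSEQ_unique)
qed

text \<open>Uniform approximation plus the isometry yields a Cauchy sequence, and completeness
  yields the limit. This is what gives meaning to the \<open>SOME\<close> in
  \<open>functional_calculus\<close>.\<close>

lemma has_spectral_integral_exists:
  assumes b: "bounded_borel C \<phi>" and f: "f \<in> L2"
  shows "\<exists>h. has_spectral_integral E \<phi> f h"
proof -
  let ?I = "simple_spectral_integral E"
  obtain s where s: "\<And>n. simple_function borel (s n)" "\<And>n r. \<bar>s n r - \<phi> r\<bar> \<le> (1/8)^n"
    using bounded_borel_uniform_simple[OF b] by metis
  have [measurable]: "\<phi> \<in> borel_measurable borel" using b by (simp add: bounded_borel_def)
  interpret finite_measure "spectral_dist E f" using f by (rule finite_spectral)
  have sL: "?I (s n) f \<in> L2" for n using s f by (auto intro: ssi_L2)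
  have "\<exists>h\<in>L2. (\<lambda>n. sqn (\<lambda>j x. ?I (s n) f j x - h j x)) \<longlonglongrightarrow> 0"
  proof (rule L2_complete[OF sL])
    fix n m :: nat assume nm: "n \<le> m"
    have d: "simple_function borel (\<lambda>r. s m r - s n r)" using s by (intro simple_function_diff)
    \<comment> \<open>Both errors are at most 8^(-n), so the square is at most 4 times 64^(-n),
      which is weakened to the rate 16^(-n) of \<open>L2_complete\<close>.\<close>
    have bd: "(s m r - s n r)\<^sup>2 \<le> 4 * (1/16)^n" for r
    proof -
      have "\<bar>s m r - s n r\<bar> \<le> (1/8)^m + (1/8)^n" using s(2)[of m r] s(2)[of n r] by linarith
      also have "\<dots> \<le> 2 * (1/8)^n" using power_decreasing[OF nm, of "1/8::real"] by simp
      finally have "\<bar>s m r - s n r\<bar>\<^sup>2 \<le> (2 * (1/8)^n)\<^sup>2" by (rule power_mono) simp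
      also have "(2 * (1/8)^n)\<^sup>2 = 4 * ((1/64)^n :: real)"
        by (simp add: power2_eq_square power_mult_distrib[symmetric])
      also have "\<dots> \<le> 4 * (1/16)^n" by (intro mult_left_mono power_mono) auto
      finally show ?thesis by simp
    qed
    have "sqn (\<lambda>j x. ?I (s m) f j x - ?I (s n) f j x) = (\<integral>r. (s m r - s n r)\<^sup>2 \<partial>spectral_dist E f)"
      by (rule sqn_ssi_diff[OF s(1) s(1) f])
    also have "\<dots> \<le> (\<integral>r. 4 * (1/16)^n \<partial>spectral_dist E f)"
      using simple_mult_integrable[OF d d f]
      by (intro Bochner_Integration.integral_mono bd) (simp_all add: power2_eq_square)
    also have "\<dots> = (4 * sqn f) * (1/16)^n" by (simp add: spectral_measure_UNIV f)
    finally show "sqn (\<lambda>j x. ?I (s m) f j x - ?I (s n) f j x) \<le> (4 * sqn f) * (1/16)^n" .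
  qed
  then obtain h where h: "h \<in> L2" "(\<lambda>n. sqn (\<lambda>j x. ?I (s n) f j x - h j x)) \<longlonglongrightarrow> 0" by blast
  have "(\<lambda>n. \<integral>\<^sup>+ r. ennreal ((s n r - \<phi> r)\<^sup>2) \<partial>spectral_dist E f) \<longlonglongrightarrow> 0"
  proof -
    have "(\<integral>\<^sup>+ r. ennreal ((s n r - \<phi> r)\<^sup>2) \<partial>spectral_dist E f) \<le> ennreal (((1/8)^n)\<^sup>2 * sqn f)" for n
    proof -
      have "(s n r - \<phi> r)\<^sup>2 \<le> ((1/8)^n)\<^sup>2" for r
        using power_mono[OF s(2)[where n=n and r=r] abs_ge_zero, of 2] by simp
      then have "(\<integral>\<^sup>+ r. ennreal ((s n r - \<phi> r)\<^sup>2) \<partial>spectral_dist E f) \<le> (\<integral>\<^sup>+ r. ennreal (((1/8)^n)\<^sup>2) \<partial>spectral_dist E f)"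
        by (intro nn_integral_mono ennreal_leI) simp
      also have "\<dots> = ennreal (((1/8)^n)\<^sup>2 * sqn f)"
        by (simp add: spectral_emeasure f sqn_E_UNIV ennreal_mult sqn_nonneg)
      finally show ?thesis .
    qed
    moreover have "(\<lambda>n. ennreal (((1/8)^n)\<^sup>2 * sqn f)) \<longlonglongrightarrow> 0"
    proof -
      have "(\<lambda>n. ((1/8::real)^n)\<^sup>2 * sqn f) \<longlonglongrightarrow> 0\<^sup>2 * sqn f"
        by (intro tendsto_intros LIMSEQ_power_zero) simp
      from tendsto_ennrealI[OF this] show ?thesis by simp
    qed
    ultimately show ?thesis
      by (rule squeeze_zero[rotated]) simp_all
  qed
  then show ?thesis
    using h s(1) f by (auto simp: has_spectral_integral_def l2_norm_tendsto_0_iff)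
qed

text \<open>Applying E B amounts to multiplying the approximating simple functions by the indicator
  of B. This cuts the unbounded function r down to a bounded one, to which the form calculus
  applies.\<close>

lemma has_spectral_integral_restrict:
  assumes h: "has_spectral_integral E \<phi> f h" and B: "B \<in> sets borel" and \<phi>: "\<phi> \<in> borel_measurable borel"
  shows "has_spectral_integral E (\<lambda>r. indicator B r * \<phi> r) f (E B h)"
proof -
  have f: "f \<in> L2" and hL: "h \<in> L2" using h by (auto simp: has_spectral_integral_def)
  let ?I = "simple_spectral_integral E"
  obtain s where s: "\<And>n. simple_function borel (s n)"
    and sl: "(\<lambda>n. \<integral>\<^sup>+ r. ennreal ((s n r - \<phi> r)\<^sup>2) \<partial>spectral_dist E f) \<longlonglongrightarrow> 0"
    and sc: "(\<lambda>n. l2_norm (\<lambda>j x. ?I (s n) f j x - h j x)) \<longlonglongrightarrow> 0"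
    using h unfolding has_spectral_integral_def by blast
  define s' where "s' n r = indicator B r * s n r" for n r
  have s': "simple_function borel (s' n)" for n
    unfolding s'_def using s B by (intro simple_function_mult simple_function_indicator) auto
  have sL: "?I (s n) f \<in> L2" "?I (s' n) f \<in> L2" for n using s s' f by (auto intro: ssi_L2)
  \<comment> \<open>Level sets of the product need not be matched one by one: the value 0 collects
    everything outside B. Comparing the forms of both sides avoids that bookkeeping.\<close>
  have eq: "ae_eq (E B (?I (s n) f)) (?I (s' n) f)" for n
  proof (rule ae_eqI_inner)
    fix g :: "'n wavefun" assume g: "g \<in> L2"
    have "l2_inner (E B (?I (s n) f)) g = l2_inner (?I (s n) f) (E B g)"
      using B sL g by (simp add: E_sym)
    also have "\<dots> = (\<Sum>c\<in>range (s n). of_real c * l2_inner (E (s n -` {c} \<inter> B) f) g)"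
      using s f g B by (simp add: inner_ssi E_L2 inner_E_E simple_vimage)
    also have "\<dots> = (\<Sum>c\<in>range (s n). of_real c * sform (indicator (s n -` {c} \<inter> B)) f g)"
      by (simp only: sform_indicator[OF sets.Int[OF simple_vimage[OF s] B] f g])
    also have "\<dots> = sform (\<lambda>r. \<Sum>c\<in>range (s n). c * indicator (s n -` {c} \<inter> B) r) f g"
      by (rule sform_sum[where C=1, symmetric]) (use s f g B in \<open>auto intro!: bounded_borel_indicator simple_vimage\<close>)
    also have "(\<lambda>r. \<Sum>c\<in>range (s n). c * indicator (s n -` {c} \<inter> B) r) = s' n"
    proof
      fix r
      show "(\<Sum>c\<in>range (s n). c * indicator (s n -` {c} \<inter> B) r) = s' n r"
        unfolding s'_def simple_expand[OF s, of n r] by (simp add: sum_distrib_left indicator_inter_arith mult_ac)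
    qed
    also have "sform (s' n) f g = l2_inner (?I (s' n) f) g" by (rule sform_simple[OF s' f g])
    finally show "l2_inner (E B (?I (s n) f)) g = l2_inner (?I (s' n) f) g" .
  qed (use sL B E_L2 in auto)
  \<comment> \<open>E B is a contraction, so the restricted approximants converge at least as fast
    as the given ones.\<close>
  have le: "sqn (\<lambda>j x. ?I (s' n) f j x - E B h j x) \<le> sqn (\<lambda>j x. ?I (s n) f j x - h j x)" for n
  proof -
    have "ae_eq (\<lambda>j x. ?I (s' n) f j x - E B h j x) (E B (\<lambda>j x. ?I (s n) f j x - h j x))"
      using eq[of n] E_lincomb[OF B sL(1)[of n] hL, of 1 "-1"] unfolding ae_eq_def
    proof (intro allI)
      fix j
      assume "\<forall>j. AE x in half_line. E B (?I (s n) f) j x = ?I (s' n) f j x"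
        "\<forall>j. AE x in half_line. E B (\<lambda>j x. 1 * ?I (s n) f j x + - 1 * h j x) j x = 1 * E B (?I (s n) f) j x + - 1 * E B h j x"
      then have "AE x in half_line. E B (?I (s n) f) j x = ?I (s' n) f j x"
        "AE x in half_line. E B (\<lambda>j x. ?I (s n) f j x - h j x) j x = E B (?I (s n) f) j x - E B h j x" by auto
      then show "AE x in half_line. ?I (s' n) f j x - E B h j x = E B (\<lambda>j x. ?I (s n) f j x - h j x) j x"
        by eventually_elim simp
    qed
    then have "sqn (\<lambda>j x. ?I (s' n) f j x - E B h j x) = sqn (E B (\<lambda>j x. ?I (s n) f j x - h j x))"
      by (rule sqn_cong) (use sL hL B in \<open>auto intro!: L2_diff E_L2\<close>)
    also have "\<dots> \<le> sqn (\<lambda>j x. ?I (s n) f j x - h j x)"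
      by (rule sqn_E_le[OF B L2_diff[OF sL(1) hL]])
    finally show ?thesis .
  qed
  have "(\<lambda>n. sqn (\<lambda>j x. ?I (s' n) f j x - E B h j x)) \<longlonglongrightarrow> 0"
    by (rule squeeze_zero[OF sqn_nonneg le sc[unfolded l2_norm_tendsto_0_iff]])
  moreover have "(\<lambda>n. \<integral>\<^sup>+ r. ennreal ((s' n r - indicator B r * \<phi> r)\<^sup>2) \<partial>spectral_dist E f) \<longlonglongrightarrow> 0"
  proof (rule squeeze_zero[OF _ _ sl])
    show "(\<integral>\<^sup>+ r. ennreal ((s' n r - indicator B r * \<phi> r)\<^sup>2) \<partial>spectral_dist E f)
        \<le> (\<integral>\<^sup>+ r. ennreal ((s n r - \<phi> r)\<^sup>2) \<partial>spectral_dist E f)" for n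
      by (intro nn_integral_mono ennreal_leI) (auto simp: s'_def indicator_def)
  qed simp
  ultimately show ?thesis
    using f E_L2[OF B hL] s' by (auto simp: has_spectral_integral_def l2_norm_tendsto_0_iff)
qed

end

section \<open>Resolvents and the cosine transform of spectral measures\<close>

lemma laplace_cos_has_integral:
  fixes p w X :: real
  assumes "p > 0" "X \<ge> 0"
  shows "((\<lambda>t. exp (- p * t) * cos (t * w)) has_integral
     (p + exp (- p * X) * (w * sin (X * w) - p * cos (X * w))) / (p\<^sup>2 + w\<^sup>2)) {0..X}"
proof -
  have pw: "p\<^sup>2 + w\<^sup>2 > 0" using assms(1) by (simp add: add_pos_nonneg)
  have "((\<lambda>t. exp (- p * t) * cos (t * w)) has_integral
     exp (- p * X) * (w * sin (X * w) - p * cos (X * w)) / (p\<^sup>2 + w\<^sup>2)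
      - exp (- p * 0) * (w * sin (0 * w) - p * cos (0 * w)) / (p\<^sup>2 + w\<^sup>2)) {0..X}"
  proof (rule fundamental_theorem_of_calculus[OF assms(2)])
    fix t
    have "((\<lambda>t. exp (- p * t) * (w * sin (t * w) - p * cos (t * w)) / (p\<^sup>2 + w\<^sup>2)) has_real_derivative
       ((exp (- p * t) * (- p)) * (w * sin (t * w) - p * cos (t * w)) + (w * (cos (t * w) * w) - p * (- sin (t * w) * w)) * exp (- p * t)) / (p\<^sup>2 + w\<^sup>2)) (at t within {0..X})"
      using assms(1) by (auto intro!: derivative_eq_intros)
    moreover have "((exp (- p * t) * (- p)) * (w * sin (t * w) - p * cos (t * w)) + (w * (cos (t * w) * w) - p * (- sin (t * w) * w)) * exp (- p * t))
        = exp (- p * t) * cos (t * w) * (p\<^sup>2 + w\<^sup>2)"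
      by (simp add: algebra_simps power2_eq_square)
    ultimately show "((\<lambda>t. exp (- p * t) * (w * sin (t * w) - p * cos (t * w)) / (p\<^sup>2 + w\<^sup>2)) has_vector_derivative
       exp (- p * t) * cos (t * w)) (at t within {0..X})"
      using assms(1) by (simp add: has_real_derivative_iff_has_vector_derivative)
  qed
  then show ?thesis by (simp add: add_divide_distrib add.commute)
qed

lemma sin_cos_comb_bound:
  fixes p w :: real
  assumes "p > 0"
  shows "\<bar>w * sin s - p * cos s\<bar> \<le> \<bar>w\<bar> + p"
proof -
  have "\<bar>w * sin s\<bar> \<le> \<bar>w\<bar>" "\<bar>p * cos s\<bar> \<le> p"
    using mult_left_mono[OF abs_sin_le_one abs_ge_zero[of w]] mult_left_mono[OF abs_cos_le_one, of p] assms
    by (auto simp: abs_mult)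
  then show ?thesis by linarith
qed

text \<open>The bound is uniform in w and X, which makes it the dominating constant when X tends to
  infinity under the spectral integral. The constant 3/p comes from 2 p |w| \<le> p^2 + w^2.\<close>

lemma laplace_cos_bound:
  fixes p w X :: real
  assumes "p > 0" "X \<ge> 0"
  shows "\<bar>(p + exp (- p * X) * (w * sin (X * w) - p * cos (X * w))) / (p\<^sup>2 + w\<^sup>2)\<bar> \<le> 3 / p"
proof -
  have pw: "p\<^sup>2 + w\<^sup>2 > 0" using assms(1) by (simp add: add_pos_nonneg)
  have "\<bar>w * sin (X * w) - p * cos (X * w)\<bar> \<le> \<bar>w\<bar> + p" by (rule sin_cos_comb_bound[OF assms(1)])
  moreover have "exp (- p * X) \<le> 1" using assms by simp
  ultimately have "exp (- p * X) * \<bar>w * sin (X * w) - p * cos (X * w)\<bar> \<le> 1 * (\<bar>w\<bar> + p)"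
    by (intro mult_mono) auto
  then have "\<bar>p + exp (- p * X) * (w * sin (X * w) - p * cos (X * w))\<bar> \<le> \<bar>w\<bar> + 2 * p"
    using assms(1) abs_triangle_ineq[of p "exp (- p * X) * (w * sin (X * w) - p * cos (X * w))"]
    by (simp add: abs_mult)
  also have "\<dots> \<le> 3 / p * (p\<^sup>2 + w\<^sup>2)"
  proof -
    have "2 * (p * \<bar>w\<bar>) \<le> p\<^sup>2 + w\<^sup>2" using sum_squares_bound[of p "\<bar>w\<bar>"] by simp
    then have "p * (\<bar>w\<bar> + 2 * p) \<le> 3 * (p\<^sup>2 + w\<^sup>2)"
      by (simp add: power2_eq_square algebra_simps) (use zero_le_square[of p] zero_le_square[of w] in linarith)
    then show ?thesis using assms(1) by (simp add: field_simps)
  qed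
  finally show ?thesis using pw by (simp add: abs_divide divide_le_eq)
qed

lemma laplace_cos_limit:
  fixes p w :: real
  assumes "p > 0"
  shows "(\<lambda>n. (p + exp (- p * real n) * (w * sin (real n * w) - p * cos (real n * w))) / (p\<^sup>2 + w\<^sup>2)) \<longlonglongrightarrow> p / (p\<^sup>2 + w\<^sup>2)"
proof -
  have e: "(\<lambda>n. exp (- p * real n)) \<longlonglongrightarrow> 0"
  proof -
    have "(\<lambda>n. (exp (- p)) ^ n) \<longlonglongrightarrow> 0" by (rule LIMSEQ_power_zero) (use assms in simp)
    then show ?thesis by (simp add: exp_of_nat_mult[symmetric] mult.commute)
  qed
  have "(\<lambda>n. exp (- p * real n) * (w * sin (real n * w) - p * cos (real n * w))) \<longlonglongrightarrow> 0"
  proof (rule Lim_null_comparison[OF always_eventually])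
    show "\<forall>n. norm (exp (- p * real n) * (w * sin (real n * w) - p * cos (real n * w))) \<le> exp (- p * real n) * (\<bar>w\<bar> + p)"
      using sin_cos_comb_bound[OF assms] by (simp add: abs_mult)
    show "(\<lambda>n. exp (- p * real n) * (\<bar>w\<bar> + p)) \<longlonglongrightarrow> 0" using e by (rule tendsto_mult_left_zero)
  qed
  from tendsto_divide[OF tendsto_add[OF tendsto_const this] tendsto_const[of "p\<^sup>2 + w\<^sup>2"], of p]
  show ?thesis using assms by (simp add: add_pos_nonneg less_imp_neq[symmetric])
qed

lemma cos_transform_continuous:
  assumes "finite_measure M" "sets M = sets (borel :: real measure)"
  shows "continuous_on UNIV (\<lambda>t. \<integral>r. cos (t * sqrt r) \<partial>M)"
proof -
  interpret finite_measure M by fact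
  have [measurable_cong]: "sets M = sets borel" by fact
  show ?thesis
  proof (rule continuous_at_imp_continuous_on, rule ballI, unfold continuous_at_sequentially, intro allI impI)
    fix t and x :: "nat \<Rightarrow> real" assume x: "x \<longlonglongrightarrow> t"
    show "((\<lambda>t. \<integral>r. cos (t * sqrt r) \<partial>M) \<circ> x) \<longlonglongrightarrow> (\<integral>r. cos (t * sqrt r) \<partial>M)"
      unfolding o_def
    proof (rule integral_dominated_convergence[where w="\<lambda>_. 1"])
      show "AE r in M. (\<lambda>n. cos (x n * sqrt r)) \<longlonglongrightarrow> cos (t * sqrt r)"
        by (intro AE_I2 tendsto_cos tendsto_mult x tendsto_const)
    qed (auto intro: integrable_const)
  qed
qed

text \<open>Fubini on the finite interval {0..X} turns the transform of the spectral integral into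
  the spectral integral of an explicit function of r; dominated convergence then lets X tend to
  infinity.\<close>

lemma laplace_cos_transform:
  assumes M: "finite_measure M" "sets M = sets (borel :: real measure)" and p: "p > 0"
  shows "(\<lambda>n. integral {0..real n} (\<lambda>t. exp (- p * t) * (\<integral>r. cos (t * sqrt r) \<partial>M))) \<longlonglongrightarrow> p * (\<integral>r. 1 / (p\<^sup>2 + \<bar>r\<bar>) \<partial>M)"
proof -
  interpret M: finite_measure M by fact
  have [measurable_cong]: "sets M = sets borel" by fact
  define J where "J X r = (p + exp (- p * X) * (sqrt r * sin (X * sqrt r) - p * cos (X * sqrt r))) / (p\<^sup>2 + \<bar>r\<bar>)" for X r
  \<comment> \<open>\<open>sqrt\<close> is extended oddly to negative reals, so its square is the
    absolute value on the whole line. This lets the identity hold before the spectrum is known to be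
    nonnegative.\<close>
  have sq: "(sqrt r)\<^sup>2 = \<bar>r\<bar>" for r by (simp add: power2_eq_square)
  have Jint: "((\<lambda>t. exp (- p * t) * cos (t * sqrt r)) has_integral J X r) {0..X}" if "X \<ge> 0" for X r
    using laplace_cos_has_integral[OF p that, of "sqrt r"] unfolding J_def sq .
  have Jb: "\<bar>J X r\<bar> \<le> 3 / p" if "X \<ge> 0" for X r
    using laplace_cos_bound[OF p that, of "sqrt r"] unfolding J_def sq .
  have Jl: "(\<lambda>n. J (real n) r) \<longlonglongrightarrow> p / (p\<^sup>2 + \<bar>r\<bar>)" for r
    using laplace_cos_limit[OF p, of "sqrt r"] unfolding J_def sq .
  have [measurable]: "J X \<in> borel_measurable borel" for X unfolding J_def by measurable
  \<comment> \<open>Joint integrability holds because the integrand is bounded by the indicator of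
    {0..X} and M is finite.\<close>
  have swap: "integral {0..X} (\<lambda>t. exp (- p * t) * (\<integral>r. cos (t * sqrt r) \<partial>M)) = (\<integral>r. J X r \<partial>M)" if X: "X \<ge> 0" for X
  proof -
    interpret P: pair_sigma_finite lborel M ..
    define F where "F t r = indicator {0..X} t * (exp (- p * t) * cos (t * sqrt r))" for t r
    have Fm[measurable]: "(\<lambda>(t, r). F t r) \<in> borel_measurable (lborel \<Otimes>\<^sub>M M)" unfolding F_def by measurable
    have Fb: "norm (F t r) \<le> indicator {0..X} t" for t r
      using p X mult_mono[of "exp (- p * t)" 1 "\<bar>cos (t * sqrt r)\<bar>" 1]
      by (auto simp: F_def indicator_def abs_mult)
    have Fi: "integrable (lborel \<Otimes>\<^sub>M M) (\<lambda>(t, r). F t r)"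
    proof (rule P.Fubini_integrable[OF Fm])
      have "integrable lborel (\<lambda>t. indicator {0..X} t * measure M (space M))"
        by (intro integrable_mult_left integrable_real_indicator) (simp_all add: X)
      then show "integrable lborel (\<lambda>x. \<integral>y. norm (case (x, y) of (t, r) \<Rightarrow> F t r) \<partial>M)"
      proof (rule Bochner_Integration.integrable_bound)
        show "AE x in lborel. norm (\<integral>y. norm (case (x, y) of (t, r) \<Rightarrow> F t r) \<partial>M) \<le> norm (indicator {0..X} x * measure M (space M))"
        proof (rule AE_I2)
          fix x
          have "(\<integral>y. norm (F x y) \<partial>M) \<le> (\<integral>y. indicator {0..X} x \<partial>M)"
          proof (rule Bochner_Integration.integral_mono')
            show "\<And>y. y \<in> space M \<Longrightarrow> norm (F x y) \<le> indicator {0..X} x" by (rule Fb)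
          qed auto
          then show "norm (\<integral>y. norm (case (x, y) of (t, r) \<Rightarrow> F t r) \<partial>M) \<le> norm (indicator {0..X} x * measure M (space M))"
            by (simp add: mult.commute)
        qed
      qed measurable
      show "AE x in lborel. integrable M (\<lambda>y. case (x, y) of (t, r) \<Rightarrow> F t r)"
      proof (rule AE_I2)
        fix x
        show "integrable M (\<lambda>y. case (x, y) of (t, r) \<Rightarrow> F t r)"
          unfolding split using Fb[of x]
          by (intro M.integrable_const_bound[where B="indicator {0..X} x"]) (auto simp: F_def)
      qed
    qed
    have "(\<integral>r. (\<integral>t. F t r \<partial>lborel) \<partial>M) = (\<integral>t. (\<integral>r. F t r \<partial>M) \<partial>lborel)"
      by (rule P.Fubini_integral[OF Fi])
    moreover have "(\<integral>t. F t r \<partial>lborel) = J X r" for r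
    proof -
      have "set_integrable lborel {0..X} (\<lambda>t. exp (- p * t) * cos (t * sqrt r))"
        by (intro borel_integrable_atLeastAtMost' continuous_intros)
      from set_borel_integral_eq_integral(2)[OF this] show ?thesis
        using integral_unique[OF Jint[OF X]] by (simp add: F_def set_lebesgue_integral_def)
    qed
    moreover have "(\<integral>t. (\<integral>r. F t r \<partial>M) \<partial>lborel) = integral {0..X} (\<lambda>t. exp (- p * t) * (\<integral>r. cos (t * sqrt r) \<partial>M))"
    proof -
      have "set_integrable lborel {0..X} (\<lambda>t. exp (- p * t) * (\<integral>r. cos (t * sqrt r) \<partial>M))"
        by (intro borel_integrable_atLeastAtMost' continuous_intros continuous_on_subset[OF cos_transform_continuous[OF M]]) auto
      from set_borel_integral_eq_integral(2)[OF this] show ?thesis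
        by (simp add: F_def set_lebesgue_integral_def)
    qed
    ultimately show ?thesis by simp
  qed
  have "(\<lambda>n. \<integral>r. J (real n) r \<partial>M) \<longlonglongrightarrow> (\<integral>r. p / (p\<^sup>2 + \<bar>r\<bar>) \<partial>M)"
    by (rule integral_dominated_convergence[where w="\<lambda>_. 3 / p"]) (use Jb Jl in auto)
  moreover have "(\<integral>r. p / (p\<^sup>2 + \<bar>r\<bar>) \<partial>M) = p * (\<integral>r. 1 / (p\<^sup>2 + \<bar>r\<bar>) \<partial>M)"
    by (subst integral_mult_right_zero[symmetric]) simp
  ultimately show ?thesis by (simp only: swap[OF of_nat_0_le_iff])
qed

lemma abs_shift_le: "r \<in> {-n..n} \<Longrightarrow> \<bar>r + p\<^sup>2\<bar> \<le> \<bar>n\<bar> + p\<^sup>2" for r n p :: real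
  using zero_le_power2[of p] by (simp only: atLeastAtMost_iff) linarith

lemma bounded_borel_shift_indicator:
  assumes "B \<in> sets borel" "B \<subseteq> {-n..n}"
  shows "bounded_borel (\<bar>n\<bar> + p\<^sup>2) (\<lambda>r. (r + p\<^sup>2) * indicator B r)"
  unfolding bounded_borel_def
proof (intro conjI allI)
  show "\<bar>(r + p\<^sup>2) * indicator B r\<bar> \<le> \<bar>n\<bar> + p\<^sup>2" for r
    using abs_shift_le[OF subsetD[OF assms(2)], of r p] by (cases "r \<in> B") auto
qed (use assms(1) in measurable)

section \<open>Resolvents seen through the spectral form, and nonnegativity of the spectrum\<close>

context pvm begin

lemma sform_lincomb:
  assumes "bounded_borel C \<phi>" "bounded_borel D \<psi>" "f \<in> L2" "g \<in> L2"
  shows "sform (\<lambda>r. a * \<phi> r + b * \<psi> r) f g = of_real a * sform \<phi> f g + of_real b * sform \<psi> f g"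
  using integrable_spectral[OF pol_L2 assms(1)] integrable_spectral[OF pol_L2 assms(2)] assms(3,4)
  unfolding sform_def by (simp add: sum.distrib sum_distrib_left algebra_simps add_divide_distrib)

text \<open>\<open>resolvent_pair p f u\<close> means \<open>u = (A + p\<^sup>2)\<^sup>-\<^sup>1 f\<close> for \<open>A = \<integral> r dE(r)\<close>.\<close>
definition resolvent_pair :: "real \<Rightarrow> 'n wavefun \<Rightarrow> 'n wavefun \<Rightarrow> bool" where
  "resolvent_pair p f u \<longleftrightarrow> f \<in> L2 \<and> has_spectral_integral E (\<lambda>r. r) u (\<lambda>j x. f j x - of_real (p\<^sup>2) * u j x)"

lemma resolvent_pair_L2: "resolvent_pair p f u \<Longrightarrow> f \<in> L2" "resolvent_pair p f u \<Longrightarrow> u \<in> L2"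
  by (auto simp: resolvent_pair_def has_spectral_integral_def)

text \<open>Since f = (A + p^2) u, applying E B gives the function r + p^2 cut to B acting on u. On
  a bounded B this function is bounded, so the unbounded operator has disappeared from the
  statement.\<close>

lemma resolvent_indicator:
  assumes "resolvent_pair p f u" "B \<in> sets borel" "B \<subseteq> {-n..n}" "g \<in> L2"
  shows "l2_inner (E B f) g = sform (\<lambda>r. (r + p\<^sup>2) * indicator B r) u g"
proof -
  let ?v = "\<lambda>j x. f j x - of_real (p\<^sup>2) * u j x"
  have h: "has_spectral_integral E (\<lambda>r. r) u ?v" and f: "f \<in> L2"
    using assms(1) by (auto simp: resolvent_pair_def)
  have u: "u \<in> L2" and v: "?v \<in> L2" using h by (auto simp: has_spectral_integral_def)
  have "\<bar>r\<bar> \<le> \<bar>n\<bar>" if "r \<in> B" for r using subsetD[OF assms(3) that] by auto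
  then have b: "bounded_borel (\<bar>n\<bar>) (\<lambda>r. indicator B r * r)"
    using assms(2) by (auto simp: bounded_borel_def indicator_def)
  have "l2_inner (E B ?v) g = sform (\<lambda>r. indicator B r * r) u g"
    by (rule has_spectral_integral_sform[OF has_spectral_integral_restrict[OF h assms(2)] b assms(4)]) simp
  moreover have "l2_inner (E B (\<lambda>j x. 1 * ?v j x + of_real (p\<^sup>2) * u j x)) g
      = 1 * l2_inner (E B ?v) g + of_real (p\<^sup>2) * l2_inner (E B u) g"
    by (rule inner_E_lincomb[OF assms(2) v u assms(4)])
  moreover have "sform (\<lambda>r. 1 * (indicator B r * r) + p\<^sup>2 * indicator B r) u g
     = of_real 1 * sform (\<lambda>r. indicator B r * r) u g + of_real (p\<^sup>2) * sform (indicator B) u g"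
    by (rule sform_lincomb[OF b bounded_borel_indicator[OF assms(2)] u assms(4)])
  moreover have "(\<lambda>r. 1 * (indicator B r * r) + p\<^sup>2 * indicator B r) = (\<lambda>r. (r + p\<^sup>2) * indicator B r)"
    by (simp add: fun_eq_iff algebra_simps)
  ultimately show ?thesis using sform_indicator[OF assms(2) u assms(4)] by simp
qed

text \<open>Extends the indicator case by linearity to simple functions and by uniform approximation
  to bounded functions. The bounded support keeps the products with r + p^2 uniformly
  bounded.\<close>

lemma resolvent_bounded_supp:
  assumes R: "resolvent_pair p f u" and b: "bounded_borel C \<phi>" and supp: "\<And>r. r \<notin> {-n..n} \<Longrightarrow> \<phi> r = 0"
    and g: "g \<in> L2"
  shows "sform \<phi> f g = sform (\<lambda>r. (r + p\<^sup>2) * \<phi> r) u g"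
proof -
  note fu = resolvent_pair_L2[OF R]
  obtain s where s: "\<And>m. simple_function borel (s m)" "\<And>m r. \<bar>s m r - \<phi> r\<bar> \<le> (1/8)^m"
    "\<And>m r. \<phi> r = 0 \<Longrightarrow> s m r = 0" "\<And>m r. \<bar>s m r\<bar> \<le> C + 1" using bounded_borel_uniform_simple[OF b] by metis
  have [measurable]: "\<phi> \<in> borel_measurable borel" using b by (simp add: bounded_borel_def)
  have [measurable]: "s m \<in> borel_measurable borel" for m
    using s by (auto intro: borel_measurable_simple_function)
  have C: "C + 1 \<ge> 0" using s(4)[of 0 0] abs_ge_zero[of "s 0 0"] by linarith
  have lim: "(\<lambda>m. s m r) \<longlonglongrightarrow> \<phi> r" for r
  proof -
    have "(\<lambda>m. s m r - \<phi> r) \<longlonglongrightarrow> 0"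
      by (rule Lim_null_comparison[OF always_eventually, where g="\<lambda>m. (1/8)^m"]) (use s(2) in \<open>auto intro: LIMSEQ_power_zero\<close>)
    then show ?thesis by (rule Lim_null[THEN iffD2])
  qed
  have 1: "(\<lambda>m. sform (s m) f g) \<longlonglongrightarrow> sform \<phi> f g"
    using lim s(4) fu g by (intro sform_tendsto[where C="C+1"]) (auto simp: bounded_borel_def)
  define K where "K = (\<bar>n\<bar> + p\<^sup>2) * (C + 1)"
  have Kb: "bounded_borel K (\<lambda>r. (r + p\<^sup>2) * s m r)" for m
    unfolding bounded_borel_def
  proof (intro conjI allI)
    fix r
    show "\<bar>(r + p\<^sup>2) * s m r\<bar> \<le> K"
    proof (cases "r \<in> {-n..n}")
      case True
      then have "\<bar>r + p\<^sup>2\<bar> \<le> \<bar>n\<bar> + p\<^sup>2" by (rule abs_shift_le)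
      then show ?thesis using s(4)[of m r] C unfolding K_def abs_mult by (intro mult_mono) auto
    next
      case False
      then show ?thesis using s(3)[OF supp[OF False]] C by (simp add: K_def)
    qed
  qed measurable
  have 2: "(\<lambda>m. sform (\<lambda>r. (r + p\<^sup>2) * s m r) u g) \<longlonglongrightarrow> sform (\<lambda>r. (r + p\<^sup>2) * \<phi> r) u g"
    using lim fu g by (intro sform_tendsto[OF Kb] tendsto_mult tendsto_const) auto
  have "sform (s m) f g = sform (\<lambda>r. (r + p\<^sup>2) * s m r) u g" for m
  proof -
    \<comment> \<open>The value 0 is left out because its level set contains everything outside
      {-n..n}; all remaining level sets lie in that interval.\<close>
    define R where "R = range (s m) - {0}"
    have finR: "finite R" unfolding R_def using simple_finite[OF s(1)] by auto
    have sub: "s m -` {c} \<subseteq> {-n..n}" if "c \<in> R" for c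
    proof
      fix x assume x: "x \<in> s m -` {c}"
      show "x \<in> {-n..n}"
      proof (rule ccontr)
        assume "x \<notin> {-n..n}"
        from s(3)[OF supp[OF this]] show False using x that by (auto simp: R_def)
      qed
    qed
    have Bs: "s m -` {c} \<in> sets borel" for c by (rule simple_vimage[OF s(1)])
    have ex: "s m r = (\<Sum>c\<in>R. c * indicator (s m -` {c}) r)" for r
      unfolding R_def using simple_finite[OF s(1)] by (subst simple_expand[OF s(1)]) (auto intro!: sum.mono_neutral_right)
    have "s m = (\<lambda>r. \<Sum>c\<in>R. c * indicator (s m -` {c}) r)" using ex by (rule ext)
    then have "sform (s m) f g = sform (\<lambda>r. \<Sum>c\<in>R. c * indicator (s m -` {c}) r) f g" by simp
    also have "\<dots> = (\<Sum>c\<in>R. of_real c * sform (indicator (s m -` {c})) f g)"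
      by (rule sform_sum[where C=1]) (use Bs fu g in \<open>auto intro: bounded_borel_indicator\<close>)
    also have "\<dots> = (\<Sum>c\<in>R. of_real c * sform (\<lambda>r. (r + p\<^sup>2) * indicator (s m -` {c}) r) u g)"
      by (intro sum.cong refl)
         (simp only: sform_indicator[OF Bs fu(1) g] resolvent_indicator[OF R Bs sub g])
    also have "\<dots> = sform (\<lambda>r. \<Sum>c\<in>R. c * ((r + p\<^sup>2) * indicator (s m -` {c}) r)) u g"
    proof (rule sform_sum[where C="\<bar>n\<bar> + p\<^sup>2", symmetric])
      fix c assume "c \<in> R"
      show "bounded_borel (\<bar>n\<bar> + p\<^sup>2) (\<lambda>r. (r + p\<^sup>2) * indicator (s m -` {c}) r)"
        by (rule bounded_borel_shift_indicator[OF Bs sub[OF \<open>c \<in> R\<close>]])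
    qed (use fu g in auto)
    also have "(\<lambda>r. \<Sum>c\<in>R. c * ((r + p\<^sup>2) * indicator (s m -` {c}) r)) = (\<lambda>r. (r + p\<^sup>2) * s m r)"
    proof
      fix r
      show "(\<Sum>c\<in>R. c * ((r + p\<^sup>2) * indicator (s m -` {c}) r)) = (r + p\<^sup>2) * s m r"
        unfolding ex[of r] by (simp add: sum_distrib_left mult_ac)
    qed
    finally show ?thesis .
  qed
  then have "(\<lambda>m. sform (s m) f g) \<longlonglongrightarrow> sform (\<lambda>r. (r + p\<^sup>2) * \<phi> r) u g" using 2 by (simp only:)
  with 1 show ?thesis by (rule LIMSEQ_unique)
qed

text \<open>On the range of E over a window of radius e around -p^2, the operator A + p^2 has size
  at most e, while its inverse is bounded by hypothesis. For small e only the zero vector is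
  compatible with both.\<close>

lemma null_near_resolvent_point:
  assumes R: "\<And>f. f \<in> L2 \<Longrightarrow> \<exists>u. resolvent_pair p f u \<and> sqn u \<le> C * sqn f" and f: "f \<in> L2"
  shows "\<exists>e>0. emeasure (spectral_dist E f) {-p\<^sup>2-e<..<-p\<^sup>2+e} = 0"
proof -
  \<comment> \<open>The form bound gives \<open>sqn h \<le> e * (sqn u + sqn h) \<le> e *
    (\<bar>C\<bar> + 1) * sqn h\<close>; this e makes the factor 1/2.\<close>
  define e where "e = 1 / (2 * (\<bar>C\<bar> + 1))"
  have e: "e > 0" "e * (\<bar>C\<bar> + 1) = 1/2" by (auto simp: e_def field_simps add_pos_nonneg)
  let ?B = "{-p\<^sup>2-e<..<-p\<^sup>2+e}"
  have B: "?B \<in> sets borel" by simp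
  define h where "h = E ?B f"
  have h: "h \<in> L2" unfolding h_def by (rule E_L2[OF B f])
  obtain u where u: "resolvent_pair p h u" "sqn u \<le> C * sqn h" using R[OF h] by blast
  note uL = resolvent_pair_L2(2)[OF u(1)]
  have hh: "l2_inner (E ?B h) h = of_real (sqn h)"
  proof -
    have "ae_eq (E ?B h) h"
      using E_Int[OF B B f] unfolding Int_absorb h_def[symmetric] by (simp add: ae_eq_def eq_commute)
    then have "l2_inner (E ?B h) h = l2_inner h h"
      by (rule l2_inner_cong) (use h E_L2[OF B h] in \<open>auto simp: ae_eq_def\<close>)
    then show ?thesis by (simp add: l2_inner_self_sqn)
  qed
  have "0 \<le> p\<^sup>2" by simp
  then have "?B \<subseteq> {- (p\<^sup>2 + e) .. p\<^sup>2 + e}"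
    using e(1) by (intro subsetI) (simp only: greaterThanLessThan_iff atLeastAtMost_iff, linarith)
  from resolvent_indicator[OF u(1) B this h]
  have "of_real (sqn h) = sform (\<lambda>r. (r + p\<^sup>2) * indicator ?B r) u h" using hh by simp
  moreover have "cmod (sform (\<lambda>r. (r + p\<^sup>2) * indicator ?B r) u h) \<le> e * (sqn u + sqn h)"
  proof (rule sform_bound[OF _ uL h])
    show "bounded_borel e (\<lambda>r. (r + p\<^sup>2) * indicator ?B r)"
      using e(1) by (auto simp: bounded_borel_def indicator_def abs_if)
  qed
  ultimately have "sqn h \<le> e * (sqn u + sqn h)" using sqn_nonneg[of h] by (metis abs_of_nonneg norm_of_real)
  also have "\<dots> \<le> e * ((\<bar>C\<bar> + 1) * sqn h)"
  proof (rule mult_left_mono)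
    have "C * sqn h \<le> \<bar>C\<bar> * sqn h" by (intro mult_right_mono sqn_nonneg) simp
    then show "sqn u + sqn h \<le> (\<bar>C\<bar> + 1) * sqn h" using u(2) by (simp add: algebra_simps)
  qed (use e in simp)
  also have "\<dots> = 1/2 * sqn h" by (simp only: mult.assoc[symmetric] e(2))
  finally have "sqn h = 0" using sqn_nonneg[of h] by simp
  then have "emeasure (spectral_dist E f) ?B = 0" by (simp add: spectral_emeasure f h_def)
  then show ?thesis using e(1) by blast
qed

text \<open>Every negative r is -p^2 with p = sqrt (-r), so the null windows cover the negative
  axis. Their radii vary with p, and the Lindelof property reduces the cover to countably many null
  sets.\<close>

lemma spectral_nonneg:
  assumes R: "\<And>p. p > 0 \<Longrightarrow> \<exists>C. \<forall>f\<in>L2. \<exists>u. resolvent_pair p f u \<and> sqn u \<le> C * sqn f" and f: "f \<in> L2"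
  shows "AE r in spectral_dist E f. r \<ge> 0"
proof -
  have "\<exists>e>0. emeasure (spectral_dist E f) {-p\<^sup>2-e<..<-p\<^sup>2+e} = 0" if "p > 0" for p
    using null_near_resolvent_point[OF _ f] R[OF that] by metis
  then obtain e where e: "\<And>p. p > 0 \<Longrightarrow> e p > 0"
    "\<And>p. p > 0 \<Longrightarrow> emeasure (spectral_dist E f) {-p\<^sup>2-e p<..<-p\<^sup>2+e p} = 0" by metis
  let ?F = "(\<lambda>p. {-p\<^sup>2-e p<..<-p\<^sup>2+e p}) ` {0<..}"
  obtain F' where F': "F' \<subseteq> ?F" "countable F'" "\<Union>F' = \<Union>?F"
  proof (rule Lindelof[of ?F])
    show "open S" if "S \<in> ?F" for S using that by auto
  qed (rule that)
  have "\<Union>F' \<in> null_sets (spectral_dist E f)"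
  proof (rule null_sets_UN'[where N="\<lambda>x. x" and I=F', simplified])
    show "countable F'" by fact
    show "x \<in> null_sets (spectral_dist E f)" if "x \<in> F'" for x
      using that F'(1) e(2) by (auto simp: null_sets_def)
  qed
  moreover have "{..<0} \<subseteq> \<Union>F'"
  proof
    fix r :: real assume "r \<in> {..<0}"
    then have "r < 0" by simp
    then have "r \<in> {-(sqrt (-r))\<^sup>2-e (sqrt (-r))<..<-(sqrt (-r))\<^sup>2+e (sqrt (-r))}" "sqrt (-r) \<in> {0<..}"
      using e(1)[of "sqrt (-r)"] by auto
    then show "r \<in> \<Union>F'" unfolding F'(3) by blast
  qed
  ultimately show ?thesis by (intro AE_I'[of "\<Union>F'"]) auto
qed

lemma sform_cong_nonneg:
  assumes R: "\<And>f. f \<in> L2 \<Longrightarrow> AE r in spectral_dist E f. r \<ge> 0"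
    and "\<phi> \<in> borel_measurable borel" "\<psi> \<in> borel_measurable borel" "\<And>r. r \<ge> 0 \<Longrightarrow> \<phi> r = \<psi> r" "f \<in> L2" "g \<in> L2"
  shows "sform \<phi> f g = sform \<psi> f g"
proof -
  have "(\<integral>r. \<phi> r \<partial>spectral_dist E (pol f g k)) = (\<integral>r. \<psi> r \<partial>spectral_dist E (pol f g k))" for k
  proof (rule integral_cong_AE)
    show "AE r in spectral_dist E (pol f g k). \<phi> r = \<psi> r"
      using R[OF pol_L2[OF assms(5,6)], of k] by eventually_elim (rule assms(4))
  qed (use assms in auto)
  then show ?thesis by (simp add: sform_def)
qed

text \<open>On {0..n} the product of r + p^2 and 1 / (p^2 + |r|) is 1, so the truncated form of f
  becomes the form of an indicator at u. Letting n grow and using that the negative axis is null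
  leaves <E UNIV u, g> = <u, g>.\<close>

lemma resolvent_sform:
  assumes R: "\<And>f. f \<in> L2 \<Longrightarrow> AE r in spectral_dist E f. r \<ge> 0"
    and r: "resolvent_pair p f u" and p: "p > 0" and g: "g \<in> L2"
  shows "sform (\<lambda>r. 1 / (p\<^sup>2 + \<bar>r\<bar>)) f g = l2_inner u g"
proof -
  note fu = resolvent_pair_L2[OF r]
  define \<psi> where "\<psi> r = 1 / (p\<^sup>2 + \<bar>r\<bar>)" for r :: real
  have [measurable]: "\<psi> \<in> borel_measurable borel" unfolding \<psi>_def by measurable
  have pp: "p\<^sup>2 > 0" using p by simp
  have \<psi>b: "\<bar>\<psi> r\<bar> \<le> 1 / p\<^sup>2" for r
    unfolding \<psi>_def using pp by (auto intro!: divide_left_mono simp: add_pos_nonneg)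
  have eq: "sform (\<lambda>r. indicator {0..real n} r * \<psi> r) f g = sform (indicator {0..real n}) u g" for n
  proof -
    have "sform (\<lambda>r. indicator {0..real n} r * \<psi> r) f g = sform (\<lambda>r. (r + p\<^sup>2) * (indicator {0..real n} r * \<psi> r)) u g"
    proof (rule resolvent_bounded_supp[OF r _ _ g, where C="1 / p\<^sup>2" and n="real n"])
      show "bounded_borel (1 / p\<^sup>2) (\<lambda>r. indicator {0..real n} r * \<psi> r)"
        using \<psi>b pp by (auto simp: bounded_borel_def indicator_def)
    qed (auto simp: indicator_def)
    also have "(\<lambda>r. (r + p\<^sup>2) * (indicator {0..real n} r * \<psi> r)) = indicator {0..real n}"
    proof
      fix r
      show "(r + p\<^sup>2) * (indicator {0..real n} r * \<psi> r) = indicator {0..real n} r"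
        using pp by (auto simp: indicator_def \<psi>_def field_simps add_nonneg_eq_0_iff)
    qed
    finally show ?thesis .
  qed
  have ind: "(\<lambda>n. indicator {0..real n} r) \<longlonglongrightarrow> (indicator {0..} r :: real)" for r
  proof (rule tendsto_eventually, rule eventually_sequentiallyI[of "nat \<lceil>r\<rceil>"])
    fix n assume "nat \<lceil>r\<rceil> \<le> n"
    then have "r \<le> real n" by linarith
    then show "indicator {0..real n} r = (indicator {0..} r :: real)" by (auto simp: indicator_def)
  qed
  have "(\<lambda>n. sform (indicator {0..real n}) u g) \<longlonglongrightarrow> sform (indicator {0..}) u g"
    by (rule sform_tendsto[where C=1]) (use fu g ind in \<open>auto intro: bounded_borel_indicator\<close>)
  moreover have "(\<lambda>n. sform (\<lambda>r. indicator {0..real n} r * \<psi> r) f g) \<longlonglongrightarrow> sform (\<lambda>r. indicator {0..} r * \<psi> r) f g"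
  proof (rule sform_tendsto[where C="1 / p\<^sup>2"])
    show "bounded_borel (1 / p\<^sup>2) (\<lambda>r. indicator {0..real n} r * \<psi> r)" for n
      using \<psi>b pp by (auto simp: bounded_borel_def indicator_def)
  qed (use fu g ind in \<open>auto intro: tendsto_mult\<close>)
  ultimately have "sform (\<lambda>r. indicator {0..} r * \<psi> r) f g = sform (indicator {0..}) u g"
    unfolding eq by (rule LIMSEQ_unique[rotated])
  moreover have "sform (\<lambda>r. indicator {0..} r * \<psi> r) f g = sform \<psi> f g"
    by (rule sform_cong_nonneg[OF R]) (use fu g in auto)
  moreover have "sform (indicator {0..}) u g = sform (indicator UNIV) u g"
    by (rule sform_cong_nonneg[OF R]) (use fu g in auto)
  moreover have "sform (indicator UNIV) u g = l2_inner (E UNIV u) g"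
    by (rule sform_indicator) (use fu g in auto)
  moreover have "l2_inner (E UNIV u) g = l2_inner u g"
    by (rule l2_inner_cong[OF E_UNIV]) (use fu g E_L2 in \<open>auto simp: ae_eq_def\<close>)
  ultimately show ?thesis unfolding \<psi>_def by simp
qed

lemma bounded_borel_cos: "bounded_borel 1 (\<lambda>r. cos (t * sqrt r))"
  by (auto simp: bounded_borel_def)

lemma sform_cos_continuous:
  assumes "f \<in> L2" "g \<in> L2"
  shows "continuous_on UNIV (\<lambda>t. sform (\<lambda>r. cos (t * sqrt r)) f g)"
  unfolding sform_def
  by (intro continuous_intros cos_transform_continuous finite_spectral pol_L2 assms sets_spectral) auto

lemma sform_cos_laplace:
  assumes "f \<in> L2" "g \<in> L2" "p > 0"
  shows "(\<lambda>n. integral {0..real n} (\<lambda>t. of_real (exp (- p * t)) * sform (\<lambda>r. cos (t * sqrt r)) f g))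
     \<longlonglongrightarrow> of_real p * sform (\<lambda>r. 1 / (p\<^sup>2 + \<bar>r\<bar>)) f g"
proof -
  let ?c = "\<lambda>k t. \<integral>r. cos (t * sqrt r) \<partial>spectral_dist E (pol f g k)"
  have cont: "continuous_on UNIV (?c k)" for k
    by (intro cos_transform_continuous finite_spectral pol_L2 assms sets_spectral)
  have int: "((\<lambda>t. exp (- p * t) * ?c k t) has_integral integral {0..X} (\<lambda>t. exp (- p * t) * ?c k t)) {0..X}" for k X
    by (intro integrable_integral integrable_continuous_interval continuous_intros continuous_on_subset[OF cont]) auto
  have eq: "integral {0..X} (\<lambda>t. of_real (exp (- p * t)) * sform (\<lambda>r. cos (t * sqrt r)) f g)
      = (\<Sum>k<4. \<i>^k * of_real (integral {0..X} (\<lambda>t. exp (- p * t) * ?c k t))) / 4" for X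
  proof (rule integral_unique)
    have "((\<lambda>t. (\<Sum>k<4. \<i>^k * of_real (exp (- p * t) * ?c k t)) / 4) has_integral
        (\<Sum>k<4. \<i>^k * of_real (integral {0..X} (\<lambda>t. exp (- p * t) * ?c k t))) / 4) {0..X}"
      by (intro has_integral_divide has_integral_sum has_integral_mult_right has_integral_of_real int) auto
    then show "((\<lambda>t. of_real (exp (- p * t)) * sform (\<lambda>r. cos (t * sqrt r)) f g) has_integral
        (\<Sum>k<4. \<i>^k * of_real (integral {0..X} (\<lambda>t. exp (- p * t) * ?c k t))) / 4) {0..X}"
      by (rule has_integral_eq[rotated]) (simp add: sform_def sum_distrib_left mult_ac)
  qed
  have "(\<lambda>n. (\<Sum>k<4. \<i>^k * of_real (integral {0..real n} (\<lambda>t. exp (- p * t) * ?c k t))) / 4)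
     \<longlonglongrightarrow> (\<Sum>k<4. \<i>^k * of_real (p * (\<integral>r. 1 / (p\<^sup>2 + \<bar>r\<bar>) \<partial>spectral_dist E (pol f g k)))) / 4"
    by (intro tendsto_intros laplace_cos_transform finite_spectral pol_L2 assms sets_spectral) auto
  then show ?thesis
    unfolding eq by (simp add: sform_def sum_distrib_left mult_ac)
qed

end

section \<open>Primitives and Laplace transforms on the half-line\<close>

text \<open>The positive and the negative part of h are densities of two measures that agree and are
  finite on all rays, hence agree everywhere; uniqueness of densities makes the two parts equal, so
  both vanish.\<close>

lemma AE_zero_if_integrals_zero_real:
  fixes h :: "real \<Rightarrow> real"
  assumes h: "integrable lebesgue h" and z: "\<And>x. (\<integral>y. indicator {x<..} y * h y \<partial>lebesgue) = 0"
  shows "AE x in lebesgue. h x = 0"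
proof -
  \<comment> \<open>The uniqueness theorems work with Borel densities on \<open>lborel\<close>, so h
    is first replaced by a Borel representative.\<close>
  obtain h' where h'[measurable]: "h' \<in> borel_measurable lborel" and ae: "AE x in lborel. h x = h' x"
    using completion_ex_borel_measurable_real[OF borel_measurable_integrable[OF h]] by auto
  have h'L: "h' \<in> borel_measurable lebesgue" using h' by (rule measurable_completion)
  have "integrable lebesgue h'"
    using integrable_cong_AE[OF borel_measurable_integrable[OF h] h'L AE_completion[OF ae]] h by (rule iffD1)
  then have ih: "integrable lborel h'" by (simp add: integrable_completion)
  have z': "(\<integral>y. indicator {x<..} y * h' y \<partial>lborel) = 0" for x
  proof -
    have "(\<integral>y. indicator {x<..} y * h' y \<partial>lborel) = (\<integral>y. indicator {x<..} y * h' y \<partial>lebesgue)"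
      by (rule integral_completion[symmetric]) measurable
    also have "\<dots> = (\<integral>y. indicator {x<..} y * h y \<partial>lebesgue)"
    proof (rule integral_cong_AE)
      show "AE y in lebesgue. indicator {x<..} y * h' y = indicator {x<..} y * h y"
        using AE_completion[OF ae] by eventually_elim simp
      show "(\<lambda>y. indicator {x<..} y * h' y) \<in> borel_measurable lebesgue"
        by (rule measurable_completion) measurable
      have "(\<lambda>y. indicator {x<..} y :: real) \<in> borel_measurable lebesgue"
        by (rule measurable_completion) measurable
      then show "(\<lambda>y. indicator {x<..} y * h y) \<in> borel_measurable lebesgue"
        using borel_measurable_integrable[OF h] by (rule borel_measurable_times)
    qed
    finally show ?thesis using z by simp
  qed
  \<comment> \<open>\<open>ennreal\<close> sends negative reals to 0, so these two densities are
    exactly the positive and the negative part of h'.\<close>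
  have eq: "emeasure (density lborel (\<lambda>x. ennreal (h' x))) {x<..} = emeasure (density lborel (\<lambda>x. ennreal (- h' x))) {x<..}"
    "emeasure (density lborel (\<lambda>x. ennreal (h' x))) {x<..} < \<infinity>" for x
  proof -
    have i: "integrable lborel (\<lambda>y. indicator {x<..} y * h' y)"
      using integrable_mult_indicator[OF _ ih, of "{x<..}"] by simp
    have e: "emeasure (density lborel (\<lambda>x. ennreal (h' x))) {x<..} = (\<integral>\<^sup>+y. ennreal (indicator {x<..} y * h' y) \<partial>lborel)"
      "emeasure (density lborel (\<lambda>x. ennreal (- h' x))) {x<..} = (\<integral>\<^sup>+y. ennreal (- (indicator {x<..} y * h' y)) \<partial>lborel)"
      by (auto simp: emeasure_density intro!: nn_integral_cong split: split_indicator)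
    have fin: "(\<integral>\<^sup>+y. ennreal (indicator {x<..} y * h' y) \<partial>lborel) \<noteq> \<infinity>" "(\<integral>\<^sup>+y. ennreal (- (indicator {x<..} y * h' y)) \<partial>lborel) \<noteq> \<infinity>"
      using i unfolding real_integrable_def by simp_all
    have "enn2real (\<integral>\<^sup>+y. ennreal (indicator {x<..} y * h' y) \<partial>lborel) = enn2real (\<integral>\<^sup>+y. ennreal (- (indicator {x<..} y * h' y)) \<partial>lborel)"
      using z'[of x] unfolding real_lebesgue_integral_def[OF i] by (rule right_minus_eq[THEN iffD1])
    moreover have "a = b" if "enn2real a = enn2real b" "a \<noteq> \<infinity>" "b \<noteq> \<infinity>" for a b :: ennreal
      using that by (cases a; cases b) auto
    ultimately have "(\<integral>\<^sup>+y. ennreal (indicator {x<..} y * h' y) \<partial>lborel) = (\<integral>\<^sup>+y. ennreal (- (indicator {x<..} y * h' y)) \<partial>lborel)"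
      using fin by blast
    then show "emeasure (density lborel (\<lambda>x. ennreal (h' x))) {x<..} = emeasure (density lborel (\<lambda>x. ennreal (- h' x))) {x<..}"
      "emeasure (density lborel (\<lambda>x. ennreal (h' x))) {x<..} < \<infinity>"
      using e fin by (auto simp: less_top)
  qed
  have "density lborel (\<lambda>x. ennreal (h' x)) = density lborel (\<lambda>x. ennreal (- h' x))"
    by (rule measure_eqI_lessThan) (use eq in auto)
  then have "AE x in lborel. ennreal (h' x) = ennreal (- h' x)"
    by (intro sigma_finite_measure.density_unique[OF sigma_finite_lborel]) auto
  then have "AE x in lborel. h x = 0"
    using ae
  proof eventually_elim
    case (elim x)
    then show ?case by (cases "h' x \<ge> 0") (auto simp: ennreal_neg ennreal_eq_0_iff not_le)
  qed
  then show ?thesis by (rule AE_completion)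
qed

lemma integral_indicator_greaterThan:
  fixes h :: "real \<Rightarrow> real"
  assumes h: "h absolutely_integrable_on {0..b}" and b: "0 \<le> b"
    and z: "\<And>x. 0 \<le> x \<Longrightarrow> x \<le> b \<Longrightarrow> integral {0..x} h = 0"
  shows "(\<integral>y. indicator {x<..} y * (indicator {0..b} y * h y) \<partial>lebesgue) = 0"
proof -
  have int: "h integrable_on {0..b}" using h by (rule set_lebesgue_integral_eq_integral)
  show ?thesis
  proof (cases "x < 0")
    case True
    have "(\<integral>y. indicator {x<..} y * (indicator {0..b} y * h y) \<partial>lebesgue) = (LINT y:{0..b}|lebesgue. h y)"
      unfolding set_lebesgue_integral_def
      by (intro Bochner_Integration.integral_cong) (use True in \<open>auto simp: indicator_def\<close>)
    also have "\<dots> = 0" using set_lebesgue_integral_eq_integral(2)[OF h] z[of b] b by simp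
    finally show ?thesis .
  next
    case False
    show ?thesis
    proof (cases "x \<le> b")
      case True
      have s: "h absolutely_integrable_on {x<..b}"
        by (rule set_integrable_subset[OF h]) (use False in auto)
      have s': "h absolutely_integrable_on {x..b}"
        by (rule set_integrable_subset[OF h]) (use False in auto)
      have "(\<integral>y. indicator {x<..} y * (indicator {0..b} y * h y) \<partial>lebesgue) = (LINT y:{x<..b}|lebesgue. h y)"
        unfolding set_lebesgue_integral_def
        by (intro Bochner_Integration.integral_cong) (use False True in \<open>auto simp: indicator_def\<close>)
      also have "\<dots> = integral {x<..b} h" using set_lebesgue_integral_eq_integral(2)[OF s] .
      also have "\<dots> = integral {x..b} h"
        by (rule integral_subset_negligible) (auto intro!: negligible_subset[OF negligible_sing[of x]])
      also have "\<dots> = integral {0..b} h - integral {0..x} h"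
        using Henstock_Kurzweil_Integration.integral_combine[of 0 x b h] False True int by simp
      also have "\<dots> = 0" using z[of b] z[of x] False True by simp
      finally show ?thesis .
    next
      case F: False
      then have "(\<lambda>y. indicator {x<..} y * (indicator {0..b} y * h y)) = (\<lambda>y. 0)"
        using False by (auto simp: indicator_def fun_eq_iff)
      then show ?thesis by simp
    qed
  qed
qed

lemma AE_half_line_if_intervals:
  assumes "\<And>n::nat. AE x in lebesgue. x \<in> {0..real n} \<longrightarrow> P x"
  shows "AE x in half_line. P x"
proof -
  have "AE x in lebesgue. \<forall>n::nat. x \<in> {0..real n} \<longrightarrow> P x"
    using assms by (simp only: AE_all_countable) simp
  then have "AE x in lebesgue. x \<in> {0<..} \<longrightarrow> P x"
  proof eventually_elim
    case (elim x)
    obtain n :: nat where "x \<le> real n" using real_arch_simple by blast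
    then show ?case using elim by auto
  qed
  then show ?thesis by (subst AE_restrict_space_iff) auto
qed

lemma AE_half_line_zero:
  fixes h :: "real \<Rightarrow> complex"
  assumes h: "\<And>b. h absolutely_integrable_on {0..b}" and z: "\<And>x. 0 < x \<Longrightarrow> integral {0..x} h = 0"
  shows "AE x in half_line. h x = 0"
proof (rule AE_half_line_if_intervals)
  fix n :: nat
  have aux: "AE x in lebesgue. x \<in> {0..real n} \<longrightarrow> g x = 0"
    if g: "\<And>b. g absolutely_integrable_on {0..b}" "\<And>x. 0 \<le> x \<Longrightarrow> integral {0..x} g = 0" for g :: "real \<Rightarrow> real"
  proof -
    have "AE x in lebesgue. indicator {0..real n} x * g x = 0"
    proof (rule AE_zero_if_integrals_zero_real)
      show "integrable lebesgue (\<lambda>x. indicator {0..real n} x * g x)"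
        using g(1)[of "real n"] by (simp add: set_integrable_def)
      show "(\<integral>y. indicator {x<..} y * (indicator {0..real n} y * g y) \<partial>lebesgue) = 0" for x
        by (rule integral_indicator_greaterThan[OF g(1)]) (use g(2) in auto)
    qed
    then show ?thesis by eventually_elim (auto simp: indicator_def split: if_splits)
  qed
  have hi: "h integrable_on {0..x}" for x using h by (rule set_lebesgue_integral_eq_integral)
  have z0: "integral {0..x} h = 0" if "0 \<le> x" for x
    using z[of x] that by (cases "x = 0") auto
  have "AE x in lebesgue. x \<in> {0..real n} \<longrightarrow> Re (h x) = 0"
  proof (rule aux)
    show "(\<lambda>x. Re (h x)) absolutely_integrable_on {0..b}" for b
      using integrable_Re[OF h[of b, unfolded set_integrable_def]] by (simp add: set_integrable_def)
    show "integral {0..x} (\<lambda>x. Re (h x)) = 0" if "0 \<le> x" for x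
      using z0[OF that] integral_linear[OF hi bounded_linear_Re, of x] by (simp add: o_def)
  qed
  moreover have "AE x in lebesgue. x \<in> {0..real n} \<longrightarrow> Im (h x) = 0"
  proof (rule aux)
    show "(\<lambda>x. Im (h x)) absolutely_integrable_on {0..b}" for b
      using integrable_Im[OF h[of b, unfolded set_integrable_def]] by (simp add: set_integrable_def)
    show "integral {0..x} (\<lambda>x. Im (h x)) = 0" if "0 \<le> x" for x
      using z0[OF that] integral_linear[OF hi bounded_linear_Im, of x] by (simp add: o_def)
  qed
  ultimately show "AE x in lebesgue. x \<in> {0..real n} \<longrightarrow> h x = 0"
    by eventually_elim (auto simp: complex_eq_iff)
qed

text \<open>The increments of the difference of both sides are \<open>O(mesh)\<close> times increments of
  \<open>\<integral> |h|\<close>, so they telescope to zero; no pointwise derivative of the primitive is needed.\<close>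
lemma primitive_integration_by_parts:
  fixes h :: "real \<Rightarrow> complex" and \<psi> \<psi>' :: "real \<Rightarrow> real"
  assumes h: "h absolutely_integrable_on {0..X}" and X: "0 \<le> X"
    and der: "\<And>y. y \<in> {0..X} \<Longrightarrow> (\<psi> has_real_derivative \<psi>' y) (at y within {0..X})"
    and cont: "continuous_on {0..X} \<psi>'"
  shows "((\<lambda>y. integral {0..y} h * of_real (\<psi>' y)) has_integral
      (integral {0..X} h * of_real (\<psi> X) - integral {0..X} (\<lambda>y. h y * of_real (\<psi> y)))) {0..X}"
proof -
  define H where "H y = integral {0..y} h" for y
  define A where "A y = integral {0..y} (\<lambda>s. norm (h s))" for y
  have c\<psi>: "continuous_on {0..X} \<psi>"
    by (auto simp: continuous_on_eq_continuous_within intro!: DERIV_continuous[OF der])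
  obtain B where B: "\<And>y. y \<in> {0..X} \<Longrightarrow> \<bar>\<psi>' y\<bar> \<le> B" "B \<ge> 0"
  proof -
    have "bounded (\<psi>' ` {0..X})" by (intro compact_imp_bounded compact_continuous_image cont) auto
    then obtain B where "\<forall>y\<in>{0..X}. \<bar>\<psi>' y\<bar> \<le> B" by (auto simp: bounded_iff)
    then show ?thesis using that[of "max B 0"] by (meson max.cobounded1 max.cobounded2 order_trans)
  qed
  have hi: "h integrable_on {0..X}" and nhi: "(\<lambda>s. norm (h s)) integrable_on {0..X}"
    using h by (auto simp: absolutely_integrable_on_def)
  have cH: "continuous_on {0..X} H" unfolding H_def by (rule indefinite_integral_continuous_1[OF hi])
  have h\<psi>: "(\<lambda>s. h s * of_real (\<psi> s)) integrable_on {0..X}"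
  proof -
    have "bounded ((\<lambda>s. complex_of_real (\<psi> s)) ` {0..X})"
      by (intro compact_imp_bounded compact_continuous_image continuous_intros c\<psi>) auto
    moreover have "(\<lambda>s. complex_of_real (\<psi> s)) \<in> borel_measurable (lebesgue_on {0..X})"
      by (intro continuous_imp_measurable_on_sets_lebesgue continuous_intros c\<psi>) auto
    ultimately have "(\<lambda>s. of_real (\<psi> s) * h s) absolutely_integrable_on {0..X}"
      by (intro absolutely_integrable_bounded_measurable_product[OF bilinear_times] h) auto
    then show ?thesis by (simp add: absolutely_integrable_on_def mult.commute)
  qed
  have H\<psi>: "(\<lambda>s. H s * of_real (\<psi>' s)) integrable_on {0..X}"
    by (intro integrable_continuous_interval continuous_intros cH cont)
  define D where "D y = H y * of_real (\<psi> y) - integral {0..y} (\<lambda>s. h s * of_real (\<psi> s)) - integral {0..y} (\<lambda>s. H s * of_real (\<psi>' s))" for y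
  have incr: "norm (D y - D z) \<le> 2 * B * (y - z) * (A y - A z)" if zy: "0 \<le> z" "z \<le> y" "y \<le> X" for y z
  proof -
    have sub: "{z..y} \<subseteq> {0..X}" "{0..y} \<subseteq> {0..X}" using zy by auto
    have I: "integral {0..y} g - integral {0..z} g = integral {z..y} g" if "g integrable_on {0..X}" for g :: "real \<Rightarrow> 'a::banach"
      using Henstock_Kurzweil_Integration.integral_combine[OF zy(1,2) integrable_on_subinterval[OF that sub(2)]] by (simp add: algebra_simps)
    have on: "g integrable_on {z..y}" if "g integrable_on {0..X}" for g :: "real \<Rightarrow> 'a::banach"
      by (rule integrable_on_subinterval[OF that sub(1)])
    have Hd: "norm (H s - H z) \<le> A y - A z" if s: "z \<le> s" "s \<le> y" for s
    proof -
      have sX: "{0..s} \<subseteq> {0..X}" "{z..s} \<subseteq> {0..X}" using s zy by auto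
      have "H s - H z = integral {z..s} h"
        using Henstock_Kurzweil_Integration.integral_combine[OF zy(1) s(1) integrable_on_subinterval[OF hi sX(1)]] by (simp add: H_def algebra_simps)
      also have "norm \<dots> \<le> integral {z..s} (\<lambda>s. norm (h s))"
        by (rule integral_norm_bound_integral) (auto intro: integrable_on_subinterval[OF hi sX(2)] integrable_on_subinterval[OF nhi sX(2)])
      also have "\<dots> \<le> integral {z..y} (\<lambda>s. norm (h s))"
        by (rule integral_subset_le) (use s in \<open>auto intro: integrable_on_subinterval[OF nhi sX(2)] on[OF nhi]\<close>)
      also have "\<dots> = A y - A z" using I[OF nhi] by (simp add: A_def)
      finally show ?thesis .
    qed
    have \<psi>d: "\<bar>\<psi> y - \<psi> s\<bar> \<le> B * (y - z)" if s: "z \<le> s" "s \<le> y" for s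
    proof -
      have "norm (\<psi> y - \<psi> s) \<le> B * norm (y - s)"
        by (rule field_differentiable_bound[of "{0..X}" \<psi> \<psi>']) (use der B zy s in auto)
      also have "\<dots> \<le> B * (y - z)" using s B by (intro mult_left_mono) auto
      finally show ?thesis by simp
    qed
    have fc: "(\<psi>' has_integral (\<psi> y - \<psi> z)) {z..y}"
    proof (rule fundamental_theorem_of_calculus[OF zy(2)])
      fix s assume "s \<in> {z..y}"
      then show "(\<psi> has_vector_derivative \<psi>' s) (at s within {z..y})"
        using der[of s] sub by (auto simp: has_real_derivative_iff_has_vector_derivative intro: has_vector_derivative_within_subset)
    qed
    have 1: "((\<lambda>s. h s * of_real (\<psi> y) - h s * of_real (\<psi> s)) has_integral
       ((H y - H z) * of_real (\<psi> y) - integral {z..y} (\<lambda>s. h s * of_real (\<psi> s)))) {z..y}"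
      using I[OF hi] by (intro has_integral_diff has_integral_mult_left integrable_integral on[OF h\<psi>]) (simp add: H_def integrable_integral on[OF hi])
    have 2: "((\<lambda>s. H s * of_real (\<psi>' s) - H z * of_real (\<psi>' s)) has_integral
       (integral {z..y} (\<lambda>s. H s * of_real (\<psi>' s)) - H z * of_real (\<psi> y - \<psi> z))) {z..y}"
      by (intro has_integral_diff has_integral_mult_right integrable_integral on[OF H\<psi>] has_integral_of_real fc)
    \<comment> \<open>The increment splits into two errors: one from freezing \<psi> at the right
      end y, one from freezing the primitive H at the left end z. Each is a product of two small
      quantities.\<close>
    have Deq: "D y - D z = ((H y - H z) * of_real (\<psi> y) - integral {z..y} (\<lambda>s. h s * of_real (\<psi> s)))
        - (integral {z..y} (\<lambda>s. H s * of_real (\<psi>' s)) - H z * of_real (\<psi> y - \<psi> z))"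
      unfolding D_def I[OF h\<psi>, symmetric] I[OF H\<psi>, symmetric] by (simp add: algebra_simps)
    have b1: "norm ((H y - H z) * of_real (\<psi> y) - integral {z..y} (\<lambda>s. h s * of_real (\<psi> s))) \<le> (A y - A z) * (B * (y - z))"
    proof -
      have "norm (integral {z..y} (\<lambda>s. h s * of_real (\<psi> y) - h s * of_real (\<psi> s))) \<le> integral {z..y} (\<lambda>s. norm (h s) * (B * (y - z)))"
      proof (rule integral_norm_bound_integral)
        show "(\<lambda>s. h s * of_real (\<psi> y) - h s * of_real (\<psi> s)) integrable_on {z..y}" using 1 by blast
        show "(\<lambda>s. norm (h s) * (B * (y - z))) integrable_on {z..y}" by (intro integrable_on_mult_left on[OF nhi])
        fix s assume "s \<in> {z..y}"
        then show "norm (h s * of_real (\<psi> y) - h s * of_real (\<psi> s)) \<le> norm (h s) * (B * (y - z))"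
          using \<psi>d[of s] by (simp add: right_diff_distrib[symmetric] of_real_diff[symmetric] norm_mult mult_left_mono del: of_real_diff)
      qed
      also have "\<dots> = (A y - A z) * (B * (y - z))" using I[OF nhi] by (simp add: A_def)
      finally show ?thesis using integral_unique[OF 1] by simp
    qed
    have b2: "norm (integral {z..y} (\<lambda>s. H s * of_real (\<psi>' s)) - H z * of_real (\<psi> y - \<psi> z)) \<le> ((A y - A z) * B) * (y - z)"
    proof -
      have "norm (integral {z..y} (\<lambda>s. H s * of_real (\<psi>' s) - H z * of_real (\<psi>' s))) \<le> integral {z..y} (\<lambda>s. (A y - A z) * B)"
      proof (rule integral_norm_bound_integral)
        show "(\<lambda>s. H s * of_real (\<psi>' s) - H z * of_real (\<psi>' s)) integrable_on {z..y}" using 2 by blast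
        fix s assume s: "s \<in> {z..y}"
        then have "0 \<le> A y - A z" using order_trans[OF norm_ge_zero Hd[of s]] by simp
        then have "norm (H s - H z) * \<bar>\<psi>' s\<bar> \<le> (A y - A z) * B"
          using s sub Hd[of s] by (intro mult_mono B(1)) auto
        then show "norm (H s * of_real (\<psi>' s) - H z * of_real (\<psi>' s)) \<le> (A y - A z) * B"
          by (simp add: left_diff_distrib[symmetric] norm_mult)
      qed auto
      also have "\<dots> = ((A y - A z) * B) * (y - z)" using zy by simp
      finally show ?thesis using integral_unique[OF 2] by simp
    qed
    have "norm (D y - D z) \<le> (A y - A z) * (B * (y - z)) + ((A y - A z) * B) * (y - z)"
      unfolding Deq by (rule order_trans[OF norm_triangle_ineq4 add_mono[OF b1 b2]])
    then show ?thesis by (simp add: algebra_simps)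
  qed
  have "norm (D X - D 0) \<le> 2 * B * X * A X / real (Suc n)" for n
  proof -
    define p where "p i = X * real i / real (Suc n)" for i
    have p: "p 0 = 0" "p (Suc n) = X" by (auto simp: p_def)
    have step: "p (Suc i) - p i = X / real (Suc n)" for i
    proof -
      have "X * real (Suc i) - X * real i = X" by (simp add: algebra_simps)
      then show ?thesis unfolding p_def by (simp only: diff_divide_distrib[symmetric])
    qed
    have "D X - D 0 = (\<Sum>i<Suc n. D (p (Suc i)) - D (p i))"
      unfolding sum_lessThan_telescope[of "\<lambda>i. D (p i)" "Suc n"] p ..
    also have "norm \<dots> \<le> (\<Sum>i<Suc n. 2 * B * (p (Suc i) - p i) * (A (p (Suc i)) - A (p i)))"
    proof (rule sum_norm_le)
      fix i assume "i \<in> {..<Suc n}"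
      then have "real (Suc i) \<le> real (Suc n)" by simp
      then have "p (Suc i) \<le> p (Suc n)" unfolding p_def using X by (intro divide_right_mono mult_left_mono) auto
      then show "norm (D (p (Suc i)) - D (p i)) \<le> 2 * B * (p (Suc i) - p i) * (A (p (Suc i)) - A (p i))"
        using X step[of i] p by (intro incr) (auto simp: p_def divide_right_mono mult_left_mono)
    qed
    also have "\<dots> = 2 * B * (X / real (Suc n)) * (\<Sum>i<Suc n. A (p (Suc i)) - A (p i))"
      unfolding step sum_distrib_left ..
    also have "\<dots> = 2 * B * X * A X / real (Suc n)"
      unfolding sum_lessThan_telescope[of "\<lambda>i. A (p i)" "Suc n"] p by (simp add: A_def)
    finally show ?thesis .
  qed
  moreover have "(\<lambda>n. 2 * B * X * A X / real (Suc n)) \<longlonglongrightarrow> 0"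
    by (rule LIMSEQ_Suc[OF lim_const_over_n])
  ultimately have "norm (D X - D 0) \<le> 0"
    by (intro LIMSEQ_le_const[where X="\<lambda>n. 2 * B * X * A X / real (Suc n)"]) auto
  then have "D X = 0" by (simp add: D_def H_def)
  then have "integral {0..X} (\<lambda>s. H s * of_real (\<psi>' s)) = H X * of_real (\<psi> X) - integral {0..X} (\<lambda>s. h s * of_real (\<psi> s))"
    by (simp add: D_def)
  then show ?thesis using integrable_integral[OF H\<psi>] unfolding H_def by simp
qed

text \<open>Substituting \<open>s = e\<^sup>-\<^sup>t\<close> turns the hypothesis into orthogonality of
  \<open>k(s) = s h(- ln s)\<close> to all polynomials on \<open>[0,1]\<close>, and Weierstrass approximation applies.\<close>

lemma laplace_injective_real:
  fixes h :: "real \<Rightarrow> real"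
  assumes cont: "continuous_on {0..} h" and bd: "\<And>t. t \<ge> 0 \<Longrightarrow> \<bar>h t\<bar> \<le> C * (1 + t)"
    and z: "\<And>m::nat. m \<ge> 2 \<Longrightarrow> (\<lambda>n. integral {0..real n} (\<lambda>t. exp (- real m * t) * h t)) \<longlonglongrightarrow> 0"
    and t: "t \<ge> 0"
  shows "h t = 0"
proof -
  define k where "k s = (if s \<le> 0 then 0 else s * h (- ln s))" for s
  have C: "C \<ge> 0" using bd[of 0] by simp
  have ke: "k (exp (- t)) = exp (- t) * h t" for t by (simp add: k_def)
  \<comment> \<open>Continuity at s = 0 is the only delicate point of the substitution. Linear
    growth of h becomes logarithmic growth in s, and the inequality for ln at 1 / sqrt s shows that
    the factor s absorbs it.\<close>
  have kb: "\<bar>k s\<bar> \<le> 2 * C * sqrt s" if s: "0 \<le> s" "s \<le> 1" for s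
  proof (cases "s = 0")
    case False
    then have s0: "s > 0" using s by simp
    have "ln (1 / sqrt s) \<le> 1 / sqrt s - 1" by (rule ln_le_minus_one) (use s0 in simp)
    then have "- ln s \<le> 2 / sqrt s - 2" using s0 by (simp add: ln_div ln_sqrt)
    then have "1 + (- ln s) \<le> 2 / sqrt s" by simp
    then have "s * (C * (1 + (- ln s))) \<le> s * (C * (2 / sqrt s))"
      using s0 C by (intro mult_left_mono) auto
    also have "\<dots> = 2 * C * (s / sqrt s)" by simp
    also have "s / sqrt s = sqrt s" using s0 by (simp add: real_div_sqrt)
    finally have "s * (C * (1 + (- ln s))) \<le> 2 * C * sqrt s" .
    moreover have "\<bar>s * h (- ln s)\<bar> \<le> s * (C * (1 + (- ln s)))"
      using bd[of "- ln s"] s s0 by (simp add: abs_mult)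
    ultimately show ?thesis using s0 by (simp add: k_def)
  qed (simp add: k_def)
  have ck: "continuous_on {0..1} k"
    unfolding continuous_on_eq_continuous_within
  proof
    fix s :: real assume s: "s \<in> {0..1}"
    show "continuous (at s within {0..1}) k"
    proof (cases "s = 0")
      case True
      have "((\<lambda>s. 2 * C * sqrt s) \<longlongrightarrow> 2 * C * sqrt 0) (at 0 within {0..1})"
        by (intro tendsto_intros)
      then have "((\<lambda>s. 2 * C * sqrt s) \<longlongrightarrow> 0) (at 0 within {0..1})" by simp
      then have "(k \<longlongrightarrow> 0) (at 0 within {0..1})"
        by (rule Lim_null_comparison[rotated]) (use kb in \<open>auto simp: eventually_at_filter\<close>)
      then show ?thesis using True by (simp add: continuous_within k_def)
    next
      case False
      then have s0: "s > 0" using s by simp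
      have "continuous_on {s/2..1} (\<lambda>s. s * h (- ln s))"
        by (intro continuous_intros continuous_on_compose2[OF cont]) (use s0 in auto)
      then have "continuous_on {s/2..1} k"
        by (rule continuous_on_eq) (use s0 in \<open>auto simp: k_def\<close>)
      then have "continuous (at s within {s/2..1}) k"
        using s s0 by (simp add: continuous_on_eq_continuous_within)
      moreover have "at s within {0..1} = at s within {s/2..1}"
        by (rule at_within_nhd[of s "{s/2<..}"]) (use s0 in auto)
      ultimately show ?thesis by simp
    qed
  qed
  \<comment> \<open>The integral of \<phi> over t is, after substitution, the integral of k^2 over
    s; staying in the variable t avoids a change of variables.\<close>
  define \<phi> where "\<phi> t = exp (- t) * (exp (- t) * h t)\<^sup>2" for t
  have c\<phi>: "continuous_on {0..X} \<phi>" for X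
    unfolding \<phi>_def by (intro continuous_intros continuous_on_subset[OF cont]) auto
  have hi: "(\<lambda>t. exp (- r * t) * h t) integrable_on {0..X}" for r X
    by (intro integrable_continuous_interval continuous_intros continuous_on_subset[OF cont]) auto
  have small: "integral {0..X} \<phi> \<le> e * (2 * C)" if X: "X \<ge> 0" and e: "e > 0" for X e
  proof -
    obtain q where q: "real_polynomial_function q" "\<And>s. s \<in> {0..1} \<Longrightarrow> \<bar>k s - q s\<bar> < e"
      using Stone_Weierstrass_real_polynomial_function[OF compact_Icc ck e] by metis
    then obtain a N where qs: "q = (\<lambda>x. \<Sum>i\<le>N. a i * x ^ i)"
      by (auto simp: real_polynomial_function_iff_sum)
    \<comment> \<open>Write k^2 = k q + k (k - q) with q the approximating polynomial. The factor
      \<open>exp (- t)\<close> from the substitution and the one inside k raise every exponent by 2,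
      which is why only transforms at m \<ge> 2 occur. The error is at most e times the bound 2 C of
      k.\<close>
    have pw: "\<phi> t \<le> (\<Sum>i\<le>N. a i * (exp (- real (i+2) * t) * h t)) + exp (- t) * (e * (2 * C))" if t: "t \<ge> 0" for t
    proof -
      let ?s = "exp (- t)"
      have s: "?s \<in> {0..1}" using t by simp
      have "sqrt ?s \<le> 1" using s by simp
      then have "2 * C * sqrt ?s \<le> 2 * C * 1" by (intro mult_left_mono) (use C in auto)
      then have K: "\<bar>k ?s\<bar> \<le> 2 * C" using kb[of ?s] s by simp
      have "k ?s * (k ?s - q ?s) \<le> \<bar>k ?s\<bar> * \<bar>k ?s - q ?s\<bar>" by (metis abs_ge_self abs_mult)
      also have "\<dots> \<le> (2 * C) * e" by (intro mult_mono K less_imp_le[OF q(2)[OF s]]) (use C in auto)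
      finally have "(k ?s)\<^sup>2 \<le> k ?s * q ?s + e * (2 * C)" by (simp add: power2_eq_square algebra_simps)
      then have "?s * (k ?s)\<^sup>2 \<le> ?s * (k ?s * q ?s + e * (2 * C))" by (intro mult_left_mono) auto
      moreover have "?s * (k ?s * q ?s) = (\<Sum>i\<le>N. a i * (exp (- real (i+2) * t) * h t))"
      proof -
        have "exp (- real (i+2) * t) = ?s * ?s * ?s ^ i" for i
          by (simp add: exp_of_nat_mult[symmetric] exp_add[symmetric] algebra_simps)
        then show ?thesis unfolding ke qs by (simp add: sum_distrib_left mult_ac)
      qed
      ultimately show ?thesis unfolding \<phi>_def ke by (simp add: algebra_simps)
    qed
    have exp_int: "((\<lambda>t. exp (- t) * (e * (2 * C))) has_integral (1 - exp (- real n)) * (e * (2 * C))) {0..real n}" for n :: nat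
    proof -
      have "((\<lambda>t. exp (- t)) has_integral (- exp (- real n) - - exp (- 0))) {0..real n}"
        by (rule fundamental_theorem_of_calculus)
           (auto intro!: derivative_eq_intros simp: has_real_derivative_iff_has_vector_derivative[symmetric])
      from has_integral_mult_left[OF this, of "e * (2 * C)"] show ?thesis by simp
    qed
    have le: "integral {0..X} \<phi> \<le> (\<Sum>i\<le>N. a i * integral {0..real n} (\<lambda>t. exp (- real (i+2) * t) * h t)) + e * (2 * C)"
      if n: "X \<le> real n" for n :: nat
    proof -
      have "integral {0..X} \<phi> \<le> integral {0..real n} \<phi>"
        by (rule integral_subset_le) (use n integrable_continuous_interval[OF c\<phi>] in \<open>auto simp: \<phi>_def\<close>)
      also have "\<dots> \<le> (\<Sum>i\<le>N. a i * integral {0..real n} (\<lambda>t. exp (- real (i+2) * t) * h t)) + (1 - exp (- real n)) * (e * (2 * C))"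
      proof (rule has_integral_le[OF integrable_integral[OF integrable_continuous_interval[OF c\<phi>]]])
        show "((\<lambda>t. (\<Sum>i\<le>N. a i * (exp (- real (i+2) * t) * h t)) + exp (- t) * (e * (2 * C))) has_integral
          (\<Sum>i\<le>N. a i * integral {0..real n} (\<lambda>t. exp (- real (i+2) * t) * h t)) + (1 - exp (- real n)) * (e * (2 * C))) {0..real n}"
          by (intro has_integral_add has_integral_sum has_integral_mult_right integrable_integral hi exp_int) auto
      qed (use pw in auto)
      also have "(1 - exp (- real n)) * (e * (2 * C)) \<le> 1 * (e * (2 * C))"
        by (intro mult_right_mono) (use e C in auto)
      finally show ?thesis by simp
    qed
    have "(\<lambda>n. (\<Sum>i\<le>N. a i * integral {0..real n} (\<lambda>t. exp (- real (i+2) * t) * h t)) + e * (2 * C)) \<longlonglongrightarrow> (\<Sum>i\<le>N. a i * 0) + e * (2 * C)"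
      by (intro tendsto_intros z) auto
    then have "integral {0..X} \<phi> \<le> (\<Sum>i\<le>N. a i * 0) + e * (2 * C)"
    proof (rule LIMSEQ_le_const)
      show "\<exists>M. \<forall>n\<ge>M. integral {0..X} \<phi> \<le> (\<Sum>i\<le>N. a i * integral {0..real n} (\<lambda>t. exp (- real (i+2) * t) * h t)) + e * (2 * C)"
      proof (intro exI[of _ "nat \<lceil>X\<rceil>"] allI impI le)
        fix n assume "nat \<lceil>X\<rceil> \<le> n"
        then show "X \<le> real n" by linarith
      qed
    qed
    then show ?thesis by simp
  qed
  have "integral {0..t+1} \<phi> \<le> 0"
  proof (rule field_le_epsilon)
    fix e :: real assume e: "e > 0"
    have "integral {0..t+1} \<phi> \<le> e / (2 * C + 1) * (2 * C)" using t e C by (intro small) auto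
    also have "\<dots> = e * (2 * C / (2 * C + 1))" by simp
    also have "\<dots> \<le> e * 1" using e C by (intro mult_left_mono) auto
    finally show "integral {0..t+1} \<phi> \<le> 0 + e" by simp
  qed
  moreover have "0 \<le> integral {0..t+1} \<phi>"
    by (rule integral_nonneg[OF integrable_continuous_interval[OF c\<phi>]]) (simp add: \<phi>_def)
  ultimately have "integral {0..t+1} \<phi> = 0" by simp
  then have "\<forall>s\<in>{0..t+1}. \<phi> s = 0"
    by (subst (asm) integral_eq_0_iff[OF c\<phi>]) (use t in \<open>auto simp: \<phi>_def\<close>)
  then have "\<phi> t = 0" using t by simp
  then show ?thesis by (simp add: \<phi>_def)
qed

lemma laplace_injective:
  fixes h :: "real \<Rightarrow> complex"
  assumes cont: "continuous_on {0..} h" and bd: "\<And>t. t \<ge> 0 \<Longrightarrow> cmod (h t) \<le> C * (1 + t)"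
    and z: "\<And>m::nat. m \<ge> 2 \<Longrightarrow> (\<lambda>n. integral {0..real n} (\<lambda>t. of_real (exp (- real m * t)) * h t)) \<longlonglongrightarrow> 0"
    and t: "t \<ge> 0"
  shows "h t = 0"
proof -
  have hi: "(\<lambda>t. of_real (exp (- r * t)) * h t) integrable_on {0..X}" for r X
    by (intro integrable_continuous_interval continuous_intros continuous_on_subset[OF cont]) auto
  have "Re (h t) = 0"
  proof (rule laplace_injective_real[where C=C and h="\<lambda>t. Re (h t)"])
    show "continuous_on {0..} (\<lambda>t. Re (h t))" by (intro continuous_intros cont)
    show "\<bar>Re (h t)\<bar> \<le> C * (1 + t)" if "t \<ge> 0" for t using bd[OF that] abs_Re_le_cmod[of "h t"] by linarith
    fix m :: nat assume m: "m \<ge> 2"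
    show "(\<lambda>n. integral {0..real n} (\<lambda>t. exp (- real m * t) * Re (h t))) \<longlonglongrightarrow> 0"
      using tendsto_Re[OF z[OF m]] integral_linear[OF hi bounded_linear_Re] by (simp add: o_def)
  qed fact
  moreover have "Im (h t) = 0"
  proof (rule laplace_injective_real[where C=C and h="\<lambda>t. Im (h t)"])
    show "continuous_on {0..} (\<lambda>t. Im (h t))" by (intro continuous_intros cont)
    show "\<bar>Im (h t)\<bar> \<le> C * (1 + t)" if "t \<ge> 0" for t using bd[OF that] abs_Im_le_cmod[of "h t"] by linarith
    fix m :: nat assume m: "m \<ge> 2"
    show "(\<lambda>n. integral {0..real n} (\<lambda>t. exp (- real m * t) * Im (h t))) \<longlonglongrightarrow> 0"
      using tendsto_Im[OF z[OF m]] integral_linear[OF hi bounded_linear_Im] by (simp add: o_def)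
  qed fact
  ultimately show ?thesis by (simp add: complex_eq_iff)
qed

section \<open>Exponential convolutions on the half-line\<close>

lemma abs_integrable_mult_continuous:
  fixes h \<phi> :: "real \<Rightarrow> complex"
  assumes "h absolutely_integrable_on {a..b}" "continuous_on {a..b} \<phi>"
  shows "(\<lambda>s. \<phi> s * h s) absolutely_integrable_on {a..b}"
proof -
  have "bounded (\<phi> ` {a..b})" by (intro compact_imp_bounded compact_continuous_image assms) auto
  moreover have "\<phi> \<in> borel_measurable (lebesgue_on {a..b})"
    by (intro continuous_imp_measurable_on_sets_lebesgue assms) auto
  ultimately show ?thesis
    by (intro absolutely_integrable_bounded_measurable_product[OF bilinear_times] assms(1)) auto
qed

text \<open>The bridge between the Lebesgue integral of the definitions and the gauge integral on a
  compact interval, where the fundamental theorem and integration by parts live. The two domains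
  differ by the point 0 and by a region where g vanishes.\<close>

lemma half_line_integral_bounded_support:
  fixes g :: "real \<Rightarrow> complex"
  assumes g: "g absolutely_integrable_on {0..b}" and z: "\<And>x. x > b \<Longrightarrow> g x = 0" and b: "0 \<le> b"
  shows "integrable half_line g" "(\<integral>x. g x \<partial>half_line) = integral {0..b} g"
proof -
  have n1: "negligible {x \<in> {0..b} - {0<..}. g x \<noteq> 0}" by (rule negligible_subset[OF negligible_sing[of 0]]) auto
  have e2: "{x \<in> {0<..} - {0..b}. g x \<noteq> 0} = {}" using z by (auto simp: not_le intro: leI)
  have n2: "negligible {x \<in> {0<..} - {0..b}. g x \<noteq> 0}" unfolding e2 by simp
  have s: "g absolutely_integrable_on {0<..}"
    by (rule absolutely_integrable_spike_set[OF g n1 n2])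
  then show i: "integrable half_line g" by (rule absolutely_integrable_imp_integrable) simp
  have "(\<integral>x. g x \<partial>half_line) = integral {0<..} g"
    by (rule lebesgue_integral_eq_integral[OF i]) simp
  also have "\<dots> = integral {0..b} g" by (rule integral_spike_set[OF n2 n1])
  finally show "(\<integral>x. g x \<partial>half_line) = integral {0..b} g" .
qed

text \<open>Square integrable functions are locally integrable, from |z| \<le> 1 + |z|^2 on a set of
  finite measure. The value of f at 0 is unconstrained but sits on a null set.\<close>

lemma L2_half_abs_integrable:
  assumes "f \<in> L2_half"
  shows "f absolutely_integrable_on {0..b}"
proof -
  have [measurable]: "f \<in> borel_measurable half_line" using assms by (rule L2_half_measurable)
  have m: "(\<lambda>x. indicator {0<..b} x :: real) \<in> borel_measurable half_line"
    by (rule measurable_restrict_space1, rule measurable_completion) measurable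
  have i1: "integrable half_line (indicator {0<..b} :: real \<Rightarrow> real)"
  proof (rule integrable_real_indicator)
    show "{0<..b} \<in> sets half_line" by (auto simp: sets_restrict_space)
    have "emeasure half_line {0<..b} = emeasure lebesgue {0<..b}"
      by (rule emeasure_restrict_space) auto
    also have "\<dots> \<le> emeasure lebesgue {0..b}" by (rule emeasure_mono) auto
    also have "\<dots> < \<infinity>" using emeasure_compact_finite[of "{0..b}"] by simp
    finally show "emeasure half_line {0<..b} < \<infinity>" .
  qed
  have "integrable half_line (\<lambda>x. indicator {0<..b} x *\<^sub>R f x)"
  proof (rule Bochner_Integration.integrable_bound)
    show "integrable half_line (\<lambda>x. indicator {0<..b} x + (cmod (f x))\<^sup>2)"
      by (intro Bochner_Integration.integrable_add i1 L2_half_integrable_sq assms)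
    show "(\<lambda>x. indicator {0<..b} x *\<^sub>R f x) \<in> borel_measurable half_line"
      using m by measurable
    have "cmod z \<le> 1 + (cmod z)\<^sup>2" for z
    proof -
      have "0 \<le> (cmod z - 1)\<^sup>2" by simp
      then have "2 * cmod z \<le> 1 + (cmod z)\<^sup>2" by (simp add: power2_diff)
      then show ?thesis using norm_ge_zero[of z] by linarith
    qed
    then show "AE x in half_line. norm (indicator {0<..b} x *\<^sub>R f x) \<le> norm (indicator {0<..b} x + (cmod (f x))\<^sup>2)"
      by (intro AE_I2) (simp add: indicator_def)
  qed
  then have "integrable lebesgue (\<lambda>x. indicator {0<..} x *\<^sub>R (indicator {0<..b} x *\<^sub>R f x))"
    by (subst (asm) integrable_restrict_space) auto
  moreover have "(\<lambda>x. indicator {0<..} x *\<^sub>R (indicator {0<..b} x *\<^sub>R f x)) = (\<lambda>x. indicator {0<..b} x *\<^sub>R f x)"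
    by (auto simp: indicator_def fun_eq_iff)
  ultimately have s: "f absolutely_integrable_on {0<..b}" unfolding set_integrable_def by simp
  show ?thesis
  proof (rule absolutely_integrable_spike_set[OF s])
    have e: "{x \<in> {0<..b} - {0..b}. f x \<noteq> 0} = {}" by auto
    show "negligible {x \<in> {0<..b} - {0..b}. f x \<noteq> 0}" unfolding e by simp
    show "negligible {x \<in> {0..b} - {0<..b}. f x \<noteq> 0}" by (rule negligible_subset[OF negligible_sing[of 0]]) auto
  qed
qed

text \<open>Integration by parts without boundary terms: a test function vanishes at 0 because its
  support starts at some a > 0, and at the right end X because X lies beyond the support. The
  constant u(0) integrates against the derivative to zero.\<close>

lemma weak_deriv_of_primitive:
  assumes h: "\<And>b. h absolutely_integrable_on {0..b}"
    and u: "\<And>x. 0 \<le> x \<Longrightarrow> (h has_integral (u x - u 0)) {0..x}"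
  shows "has_weak_deriv u h"
  unfolding has_weak_deriv_def
proof (intro allI impI)
  fix \<phi> assume "test_function \<phi>"
  then obtain a b where d: "\<And>k x. (deriv ^^ k) \<phi> differentiable (at x)"
    and a: "0 < a" and supp: "\<And>x. \<phi> x \<noteq> 0 \<Longrightarrow> x \<in> {a..b}"
    unfolding test_function_def by blast
  have der: "(\<phi> has_real_derivative deriv \<phi> x) (at x)" for x
    using d[of 0 x] by (simp add: DERIV_deriv_iff_real_differentiable)
  have c1: "continuous_on S (deriv \<phi>)" for S
    using d[of 1] by (intro continuous_at_imp_continuous_on ballI differentiable_imp_continuous_within) simp
  have c0: "continuous_on S \<phi>" for S
    using der by (intro continuous_at_imp_continuous_on ballI DERIV_isCont) auto
  define X where "X = max b 0 + 1"
  have X: "X > b" "X > 0" by (auto simp: X_def)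
  have \<phi>0: "\<phi> 0 = 0" "\<phi> X = 0" "\<And>x. x > X \<Longrightarrow> \<phi> x = 0" using supp a X by force+
  have d0: "deriv \<phi> x = 0" if "x > X" for x
  proof -
    have "(\<phi> has_real_derivative 0) (at x)"
      by (rule has_field_derivative_transform_within_open[OF DERIV_const[of 0], of "{X<..}"])
         (use that \<phi>0(3) in auto)
    then show ?thesis by (rule DERIV_imp_deriv)
  qed
  have uc: "continuous_on {0..X} u"
  proof -
    have "continuous_on {0..X} (\<lambda>x. integral {0..x} h + u 0)"
      using h[of X] by (intro continuous_intros indefinite_integral_continuous_1 set_lebesgue_integral_eq_integral)
    moreover have "integral {0..x} h + u 0 = u x" if "x \<in> {0..X}" for x
      using integral_unique[OF u[of x]] that by simp
    ultimately show ?thesis by (rule continuous_on_eq)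
  qed
  have "((\<lambda>y. integral {0..y} h * of_real (deriv \<phi> y)) has_integral
      (integral {0..X} h * of_real (\<phi> X) - integral {0..X} (\<lambda>y. h y * of_real (\<phi> y)))) {0..X}"
    by (rule primitive_integration_by_parts[OF h]) (use X der c1 in \<open>auto intro: has_field_derivative_at_within\<close>)
  then have "((\<lambda>y. (u y - u 0) * of_real (deriv \<phi> y)) has_integral
      (integral {0..X} h * of_real (\<phi> X) - integral {0..X} (\<lambda>y. h y * of_real (\<phi> y)))) {0..X}"
    by (rule has_integral_eq[rotated]) (use integral_unique[OF u] in simp)
  moreover have "((\<lambda>y. u 0 * of_real (deriv \<phi> y)) has_integral u 0 * of_real (\<phi> X - \<phi> 0)) {0..X}"
  proof (intro has_integral_mult_right has_integral_of_real fundamental_theorem_of_calculus)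
    show "(\<phi> has_vector_derivative deriv \<phi> x) (at x within {0..X})" for x
      using der[of x] by (simp add: has_real_derivative_iff_has_vector_derivative has_vector_derivative_at_within)
  qed (use X in simp)
  ultimately have "((\<lambda>y. (u y - u 0) * of_real (deriv \<phi> y) + u 0 * of_real (deriv \<phi> y)) has_integral
      (integral {0..X} h * of_real (\<phi> X) - integral {0..X} (\<lambda>y. h y * of_real (\<phi> y))) + u 0 * of_real (\<phi> X - \<phi> 0)) {0..X}"
    by (rule has_integral_add)
  then have A: "((\<lambda>y. u y * of_real (deriv \<phi> y)) has_integral - integral {0..X} (\<lambda>y. h y * of_real (\<phi> y))) {0..X}"
    by (simp add: \<phi>0 algebra_simps)
  have "(\<integral>x. u x * of_real (deriv \<phi> x) \<partial>half_line) = integral {0..X} (\<lambda>y. u y * of_real (deriv \<phi> y))"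
    by (rule half_line_integral_bounded_support)
       (use X d0 in \<open>auto intro!: absolutely_integrable_continuous_real continuous_intros uc c1\<close>)
  also have "\<dots> = - integral {0..X} (\<lambda>y. h y * of_real (\<phi> y))" by (rule integral_unique[OF A])
  also have "integral {0..X} (\<lambda>y. h y * of_real (\<phi> y)) = (\<integral>x. h x * of_real (\<phi> x) \<partial>half_line)"
  proof (rule half_line_integral_bounded_support(2)[symmetric])
    show "(\<lambda>x. h x * of_real (\<phi> x)) absolutely_integrable_on {0..X}"
      using abs_integrable_mult_continuous[OF h[of X], of "\<lambda>x. of_real (\<phi> x)"] c0
      by (simp add: mult.commute continuous_on_of_real)
  qed (use X \<phi>0 in auto)
  finally show "(\<integral>x. u x * of_real (deriv \<phi> x) \<partial>half_line) = - (\<integral>x. h x * of_real (\<phi> x) \<partial>half_line)" .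
qed

text \<open>The convolution of f with \<open>e^(-q x)\<close> on (0,x). With the exponential pulled
  out, it is a smooth function times an indefinite integral. The parameter takes several roles: q =
  0 gives the primitive, q = p and q = -p enter the resolvent, q = \<alpha>/N gives the memory term
  of the solution.\<close>

definition conv_left :: "real \<Rightarrow> (real \<Rightarrow> complex) \<Rightarrow> real \<Rightarrow> complex" where
  "conv_left q f x = of_real (exp (- q * x)) * integral {0..x} (\<lambda>y. of_real (exp (q * y)) * f y)"

definition lap :: "real \<Rightarrow> (real \<Rightarrow> complex) \<Rightarrow> complex" where
  "lap p f = (\<integral>y. of_real (exp (- p * y)) * f y \<partial>half_line)"

text \<open>\<open>conv_right p f x = \<integral>\<^sub>x\<^sup>\<infinity> e\<^sup>-\<^sup>p\<^sup>(\<^sup>y\<^sup>-\<^sup>x\<^sup>) f(y) dy\<close>, written so that it is manifestly absolutely continuous.\<close>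
definition conv_right :: "real \<Rightarrow> (real \<Rightarrow> complex) \<Rightarrow> real \<Rightarrow> complex" where
  "conv_right p f x = of_real (exp (p * x)) * lap p f - conv_left (- p) f x"

lemma conv_left_0 [simp]: "conv_left q f 0 = 0"
  by (simp add: conv_left_def)

lemma conv_right_0 [simp]: "conv_right p f 0 = lap p f"
  by (simp add: conv_right_def)

lemma exp_mult_abs_integrable:
  assumes "\<And>b. f absolutely_integrable_on {0..b}"
  shows "(\<lambda>y. of_real (exp (q * y)) * f y :: complex) absolutely_integrable_on {0..b}"
  by (intro abs_integrable_mult_continuous assms continuous_intros)

lemma conv_left_continuous:
  assumes "\<And>b. f absolutely_integrable_on {0..b}"
  shows "continuous_on {0..X} (conv_left q f)"
  unfolding conv_left_def
  by (intro continuous_intros indefinite_integral_continuous_1 set_lebesgue_integral_eq_integral(1)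
      exp_mult_abs_integrable assms)

lemma continuous_on_atLeast_0:
  fixes f :: "real \<Rightarrow> 'a::topological_space"
  assumes "\<And>X. continuous_on {0..X} f"
  shows "continuous_on {0..} f"
  unfolding continuous_on_eq_continuous_within
proof
  fix x :: real assume x: "x \<in> {0..}"
  have "continuous (at x within {0..x+1}) f"
    using assms[of "x+1"] x by (simp add: continuous_on_eq_continuous_within)
  moreover have "at x within {0..} = at x within {0..x+1}"
    by (rule at_within_nhd[of x "{..<x+1}"]) auto
  ultimately show "continuous (at x within {0..}) f" by simp
qed

text \<open>The integrated form of w' = f - q w. It is integration by parts with \<psi> =
  \<open>e^(-q y)\<close>, in which the two exponentials cancel and leave f.\<close>

lemma conv_left_primitive:
  assumes f: "\<And>b. f absolutely_integrable_on {0..b}" and x: "0 \<le> x"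
  shows "((\<lambda>y. of_real q * conv_left q f y) has_integral (integral {0..x} f - conv_left q f x)) {0..x}"
proof -
  have eq: "(\<lambda>y. of_real (exp (q * y)) * f y * of_real (exp (- q * y))) = f"
  proof
    fix y
    have "exp (q * y) * exp (- q * y) = 1" by (simp add: exp_add[symmetric])
    then have "complex_of_real (exp (q * y)) * of_real (exp (- q * y)) = 1"
      unfolding of_real_mult[symmetric] by simp
    then show "of_real (exp (q * y)) * f y * of_real (exp (- q * y)) = f y" by (simp only: mult.commute mult.left_commute mult_1_left)
  qed
  have "((\<lambda>y. integral {0..y} (\<lambda>y. of_real (exp (q * y)) * f y) * of_real (- q * exp (- q * y))) has_integral
      (integral {0..x} (\<lambda>y. of_real (exp (q * y)) * f y) * of_real (exp (- q * x))
       - integral {0..x} (\<lambda>y. of_real (exp (q * y)) * f y * of_real (exp (- q * y))))) {0..x}"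
    by (rule primitive_integration_by_parts[OF exp_mult_abs_integrable[OF f] x])
       (auto intro!: derivative_eq_intros continuous_intros)
  from this[unfolded eq] have "((\<lambda>y. - (of_real q * conv_left q f y)) has_integral (conv_left q f x - integral {0..x} f)) {0..x}"
    by (simp add: conv_left_def mult_ac)
  from has_integral_neg[OF this] show ?thesis by simp
qed

lemma conv_right_continuous:
  assumes "\<And>b. f absolutely_integrable_on {0..b}"
  shows "continuous_on {0..X} (conv_right p f)"
  unfolding conv_right_def by (intro continuous_intros conv_left_continuous assms)

text \<open>The integrated form of w' = p w - f, obtained from \<open>conv_left\<close> with
  parameter -p plus the growing exponential.\<close>

lemma conv_right_primitive:
  assumes f: "\<And>b. f absolutely_integrable_on {0..b}" and x: "0 \<le> x"
  shows "((\<lambda>y. of_real p * conv_right p f y) has_integral (conv_right p f x - lap p f + integral {0..x} f)) {0..x}"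
proof -
  have "((\<lambda>y. p * exp (p * y)) has_integral (exp (p * x) - exp (p * 0))) {0..x}"
    by (rule fundamental_theorem_of_calculus[OF x])
       (auto intro!: derivative_eq_intros simp: has_real_derivative_iff_has_vector_derivative[symmetric])
  then have "((\<lambda>y. of_real (p * exp (p * y)) * lap p f) has_integral of_real (exp (p * x) - exp (p * 0)) * lap p f) {0..x}"
    by (intro has_integral_mult_left has_integral_of_real)
  from has_integral_add[OF this conv_left_primitive[OF f x, of "- p"]]
  show ?thesis by (simp add: conv_right_def algebra_simps)
qed

section \<open>Boundedness of the exponential convolutions on the half-line\<close>

lemma nn_integral_exp_abs:
  fixes p :: real
  assumes p: "p > 0"
  shows "(\<integral>\<^sup>+z. ennreal (exp (- p * \<bar>z\<bar>)) \<partial>lborel) \<le> ennreal (2 / p)"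
proof -
  have half: "(\<integral>\<^sup>+z. ennreal (exp (- p * z)) * indicator {0..} z \<partial>lborel) = ennreal (1 / p)"
  proof -
    have "(\<integral>\<^sup>+z. ennreal (exp (- p * z)) * indicator {0..} z \<partial>lborel) = ennreal (0 - (- exp (- p * 0) / p))"
    proof (rule nn_integral_FTC_atLeast)
      show "((\<lambda>x. - exp (- p * x) / p) has_real_derivative exp (- p * x)) (at x)" for x
        using p by (auto intro!: derivative_eq_intros)
      have "((\<lambda>x. exp (- (p * x))) \<longlongrightarrow> 0) at_top"
        using p by (intro filterlim_compose[OF exp_at_bot] filterlim_compose[OF filterlim_uminus_at_bot_at_top]
              filterlim_tendsto_pos_mult_at_top[OF tendsto_const p filterlim_ident])
      from tendsto_divide[OF tendsto_minus[OF this] tendsto_const[of p]] p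
      show "((\<lambda>x. - exp (- p * x) / p) \<longlongrightarrow> 0) at_top" by simp
    qed (use p in auto)
    then show ?thesis by simp
  qed
  have refl: "(\<integral>\<^sup>+z. ennreal (exp (p * z)) * indicator {..0} z \<partial>lborel) = ennreal (1 / p)"
    using half by (subst nn_integral_real_affine[where c="-1" and t=0]) (auto simp: indicator_def)
  have "(\<integral>\<^sup>+z. ennreal (exp (- p * \<bar>z\<bar>)) \<partial>lborel)
     \<le> (\<integral>\<^sup>+z. ennreal (exp (- p * z)) * indicator {0..} z + ennreal (exp (p * z)) * indicator {..0} z \<partial>lborel)"
    by (intro nn_integral_mono) (auto simp: indicator_def abs_if)
  also have "\<dots> = ennreal (1 / p) + ennreal (1 / p)"
    by (subst nn_integral_add) (auto simp: half[simplified] refl)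
  also have "\<dots> = ennreal (2 / p)" using p by (subst ennreal_plus[symmetric]) auto
  finally show ?thesis .
qed

lemma half_line_id_measurable: "(\<lambda>x. x) \<in> borel_measurable half_line"
  by (rule measurable_restrict_space1, rule measurable_completion) simp

lemma half_line_nn_integral_le:
  assumes [measurable]: "f \<in> borel_measurable borel"
  shows "(\<integral>\<^sup>+x. f x \<partial>half_line) \<le> (\<integral>\<^sup>+x. f x \<partial>lborel)"
proof -
  have "(\<integral>\<^sup>+x. f x \<partial>half_line) = (\<integral>\<^sup>+x. f x * indicator {0<..} x \<partial>lebesgue)"
    by (rule nn_integral_restrict_space) simp
  also have "\<dots> \<le> (\<integral>\<^sup>+x. f x \<partial>lebesgue)" by (intro nn_integral_mono) (auto simp: indicator_def)
  finally show ?thesis by (simp add: nn_integral_completion)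
qed

lemma half_line_nn_integral_kernel:
  assumes p: "p > 0"
  shows "(\<integral>\<^sup>+y. ennreal (exp (- p * \<bar>x - y\<bar>)) \<partial>half_line) \<le> ennreal (2 / p)"
proof -
  have "(\<integral>\<^sup>+y. ennreal (exp (- p * \<bar>x - y\<bar>)) \<partial>half_line) \<le> (\<integral>\<^sup>+y. ennreal (exp (- p * \<bar>x - y\<bar>)) \<partial>lborel)"
    by (rule half_line_nn_integral_le) measurable
  also have "\<dots> = (\<integral>\<^sup>+z. ennreal (exp (- p * \<bar>z\<bar>)) \<partial>lborel)"
    by (subst nn_integral_real_affine[where c=1 and t=x]) auto
  also have "\<dots> \<le> ennreal (2 / p)" by (rule nn_integral_exp_abs[OF p])
  finally show ?thesis .
qed

lemma sigma_finite_half_line: "sigma_finite_measure half_line"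
proof (rule sigma_finite_measure_restrict_space)
  obtain A where A: "countable A" "A \<subseteq> sets (lborel :: real measure)" "\<Union>A = space (lborel :: real measure)"
    "\<forall>a\<in>A. emeasure (lborel :: real measure) a \<noteq> \<infinity>"
    using lborel.sigma_finite_countable by blast
  show "sigma_finite_measure (lebesgue :: real measure)"
  proof
    show "\<exists>A. countable A \<and> A \<subseteq> sets (lebesgue :: real measure) \<and> \<Union>A = space lebesgue \<and> (\<forall>a\<in>A. emeasure lebesgue a \<noteq> \<infinity>)"
      using A by (intro exI[of _ A]) (auto simp: subset_iff)
  qed
qed simp

text \<open>A common majorant of \<open>conv_left\<close> and \<open>conv_right\<close>. Being an
  extended nonnegative integral, it can be estimated before any integrability is known.\<close>

definition exp_conv :: "real \<Rightarrow> (real \<Rightarrow> complex) \<Rightarrow> real \<Rightarrow> ennreal" where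
  "exp_conv p f x = (\<integral>\<^sup>+y. ennreal (exp (- p * \<bar>x - y\<bar>) * cmod (f y)) \<partial>half_line)"

abbreviation nsq :: "(real \<Rightarrow> complex) \<Rightarrow> real" where
  "nsq f \<equiv> (\<integral>x. (cmod (f x))\<^sup>2 \<partial>half_line)"

lemma nn_nsq: "f \<in> L2_half \<Longrightarrow> (\<integral>\<^sup>+x. ennreal ((cmod (f x))\<^sup>2) \<partial>half_line) = ennreal (nsq f)"
  by (rule nn_integral_eq_integral) (auto intro: L2_half_integrable_sq)

text \<open>The Schur test: the kernel is split into two square roots before applying
  Cauchy-Schwarz, so that one factor is the total mass of the kernel, at most 2/p.\<close>

lemma exp_conv_sq:
  assumes f: "f \<in> L2_half" and p: "p > 0"
  shows "(exp_conv p f x)\<^sup>2 \<le> ennreal (2 / p) * (\<integral>\<^sup>+y. ennreal (exp (- p * \<bar>x - y\<bar>) * (cmod (f y))\<^sup>2) \<partial>half_line)"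
proof -
  note [measurable] = half_line_id_measurable L2_half_measurable[OF f]
  let ?r = "\<lambda>y. sqrt (exp (- p * \<bar>x - y\<bar>))"
  have "exp_conv p f x = (\<integral>\<^sup>+y. ennreal (?r y) * ennreal (?r y * cmod (f y)) \<partial>half_line)"
    unfolding exp_conv_def by (intro nn_integral_cong) (simp add: ennreal_mult[symmetric] mult.assoc[symmetric])
  then have "(exp_conv p f x)\<^sup>2 = (\<integral>\<^sup>+y. ennreal (?r y) * ennreal (?r y * cmod (f y)) \<partial>half_line)\<^sup>2" by simp
  also have "\<dots> \<le> (\<integral>\<^sup>+y. (ennreal (?r y))\<^sup>2 \<partial>half_line) * (\<integral>\<^sup>+y. (ennreal (?r y * cmod (f y)))\<^sup>2 \<partial>half_line)"
    by (rule Cauchy_Schwarz_nn_integral) measurable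
  also have "(\<integral>\<^sup>+y. (ennreal (?r y))\<^sup>2 \<partial>half_line) = (\<integral>\<^sup>+y. ennreal (exp (- p * \<bar>x - y\<bar>)) \<partial>half_line)"
    by (intro nn_integral_cong) (simp add: ennreal_power)
  also have "(\<integral>\<^sup>+y. (ennreal (?r y * cmod (f y)))\<^sup>2 \<partial>half_line) = (\<integral>\<^sup>+y. ennreal (exp (- p * \<bar>x - y\<bar>) * (cmod (f y))\<^sup>2) \<partial>half_line)"
    by (intro nn_integral_cong) (simp add: ennreal_power power_mult_distrib)
  also have "(\<integral>\<^sup>+y. ennreal (exp (- p * \<bar>x - y\<bar>)) \<partial>half_line) * (\<integral>\<^sup>+y. ennreal (exp (- p * \<bar>x - y\<bar>) * (cmod (f y))\<^sup>2) \<partial>half_line)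
     \<le> ennreal (2 / p) * (\<integral>\<^sup>+y. ennreal (exp (- p * \<bar>x - y\<bar>) * (cmod (f y))\<^sup>2) \<partial>half_line)"
    by (intro mult_right_mono half_line_nn_integral_kernel[OF p]) simp
  finally show ?thesis .
qed

lemma exp_conv_sq_pointwise:
  assumes f: "f \<in> L2_half" and p: "p > 0"
  shows "(exp_conv p f x)\<^sup>2 \<le> ennreal (2 / p * nsq f)"
proof -
  have "(exp_conv p f x)\<^sup>2 \<le> ennreal (2 / p) * (\<integral>\<^sup>+y. ennreal (exp (- p * \<bar>x - y\<bar>) * (cmod (f y))\<^sup>2) \<partial>half_line)"
    by (rule exp_conv_sq[OF f p])
  also have "\<dots> \<le> ennreal (2 / p) * (\<integral>\<^sup>+y. ennreal ((cmod (f y))\<^sup>2) \<partial>half_line)"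
  proof (intro mult_left_mono nn_integral_mono ennreal_leI)
    show "exp (- p * \<bar>x - y\<bar>) * (cmod (f y))\<^sup>2 \<le> (cmod (f y))\<^sup>2" for y
      using p mult_right_mono[of "exp (- p * \<bar>x - y\<bar>)" 1 "(cmod (f y))\<^sup>2"] by simp
  qed simp
  also have "\<dots> = ennreal (2 / p * nsq f)"
    unfolding nn_nsq[OF f] by (rule ennreal_mult[symmetric]) (use p in auto)
  finally show ?thesis .
qed

text \<open>Second half of the Schur test. Tonelli exchanges the integrals, and the symmetric kernel
  contributes another factor 2/p.\<close>

lemma exp_conv_L2:
  assumes f: "f \<in> L2_half" and p: "p > 0"
  shows "(\<integral>\<^sup>+x. (exp_conv p f x)\<^sup>2 \<partial>half_line) \<le> ennreal ((2 / p)\<^sup>2 * nsq f)"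
proof -
  interpret H: sigma_finite_measure half_line by (rule sigma_finite_half_line)
  interpret P: pair_sigma_finite half_line half_line ..
  have a: "(\<lambda>z. fst z) \<in> borel_measurable (half_line \<Otimes>\<^sub>M half_line)"
    by (rule measurable_compose[OF measurable_fst half_line_id_measurable])
  have b: "(\<lambda>z. snd z) \<in> borel_measurable (half_line \<Otimes>\<^sub>M half_line)"
    by (rule measurable_compose[OF measurable_snd half_line_id_measurable])
  have c: "(\<lambda>z. f (snd z)) \<in> borel_measurable (half_line \<Otimes>\<^sub>M half_line)"
    by (rule measurable_compose[OF measurable_snd L2_half_measurable[OF f]])
  have m: "(\<lambda>z. ennreal (exp (- p * \<bar>fst z - snd z\<bar>) * (cmod (f (snd z)))\<^sup>2)) \<in> borel_measurable (half_line \<Otimes>\<^sub>M half_line)"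
    using a b c by measurable
  have "(\<integral>\<^sup>+x. (exp_conv p f x)\<^sup>2 \<partial>half_line)
     \<le> (\<integral>\<^sup>+x. ennreal (2 / p) * (\<integral>\<^sup>+y. ennreal (exp (- p * \<bar>x - y\<bar>) * (cmod (f y))\<^sup>2) \<partial>half_line) \<partial>half_line)"
    by (intro nn_integral_mono exp_conv_sq f p)
  also have "\<dots> = ennreal (2 / p) * (\<integral>\<^sup>+x. \<integral>\<^sup>+y. ennreal (exp (- p * \<bar>x - y\<bar>) * (cmod (f y))\<^sup>2) \<partial>half_line \<partial>half_line)"
    using H.borel_measurable_nn_integral_fst[OF m] by (intro nn_integral_cmult) simp
  also have "(\<integral>\<^sup>+x. \<integral>\<^sup>+y. ennreal (exp (- p * \<bar>x - y\<bar>) * (cmod (f y))\<^sup>2) \<partial>half_line \<partial>half_line)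
      = (\<integral>\<^sup>+y. \<integral>\<^sup>+x. ennreal (exp (- p * \<bar>x - y\<bar>) * (cmod (f y))\<^sup>2) \<partial>half_line \<partial>half_line)"
    using P.Fubini[OF m] by simp
  also have "\<dots> \<le> (\<integral>\<^sup>+y. ennreal (2 / p) * ennreal ((cmod (f y))\<^sup>2) \<partial>half_line)"
  proof (rule nn_integral_mono)
    fix y
    note [measurable] = half_line_id_measurable
    have "(\<integral>\<^sup>+x. ennreal (exp (- p * \<bar>x - y\<bar>) * (cmod (f y))\<^sup>2) \<partial>half_line)
       = (\<integral>\<^sup>+x. ennreal (exp (- p * \<bar>y - x\<bar>)) * ennreal ((cmod (f y))\<^sup>2) \<partial>half_line)"
      by (intro nn_integral_cong) (simp add: ennreal_mult abs_minus_commute)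
    also have "\<dots> = (\<integral>\<^sup>+x. ennreal (exp (- p * \<bar>y - x\<bar>)) \<partial>half_line) * ennreal ((cmod (f y))\<^sup>2)"
      by (rule nn_integral_multc) measurable
    also have "\<dots> \<le> ennreal (2 / p) * ennreal ((cmod (f y))\<^sup>2)"
      by (intro mult_right_mono half_line_nn_integral_kernel[OF p]) simp
    finally show "(\<integral>\<^sup>+x. ennreal (exp (- p * \<bar>x - y\<bar>) * (cmod (f y))\<^sup>2) \<partial>half_line) \<le> ennreal (2 / p) * ennreal ((cmod (f y))\<^sup>2)" .
  qed
  also have "(\<integral>\<^sup>+y. ennreal (2 / p) * ennreal ((cmod (f y))\<^sup>2) \<partial>half_line) = ennreal (2 / p * nsq f)"
  proof -
    note [measurable] = L2_half_measurable[OF f]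
    have "(\<integral>\<^sup>+y. ennreal (2 / p) * ennreal ((cmod (f y))\<^sup>2) \<partial>half_line) = ennreal (2 / p) * ennreal (nsq f)"
      by (subst nn_integral_cmult) (simp_all add: nn_nsq[OF f])
    also have "\<dots> = ennreal (2 / p * nsq f)" by (rule ennreal_mult[symmetric]) (use p in auto)
    finally show ?thesis .
  qed
  also have "ennreal (2 / p) * ennreal (2 / p * nsq f) = ennreal ((2 / p)\<^sup>2 * nsq f)"
    using p by (simp add: ennreal_mult[symmetric] power2_eq_square mult.assoc)
  finally show ?thesis by (simp add: mult_left_mono)
qed

lemma L2_half_from_exp_conv:
  assumes f: "f \<in> L2_half" and p: "p > 0" and m: "g \<in> borel_measurable half_line"
    and le: "\<And>x. x > 0 \<Longrightarrow> ennreal (cmod (g x)) \<le> exp_conv p f x"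
  shows "g \<in> L2_half" "nsq g \<le> (2 / p)\<^sup>2 * nsq f"
proof -
  have "(\<integral>\<^sup>+x. ennreal ((cmod (g x))\<^sup>2) \<partial>half_line) \<le> (\<integral>\<^sup>+x. (exp_conv p f x)\<^sup>2 \<partial>half_line)"
  proof (rule nn_integral_mono)
    fix x assume "x \<in> space half_line"
    then have "(ennreal (cmod (g x)))\<^sup>2 \<le> (exp_conv p f x)\<^sup>2" using le[of x] by (intro power_mono) auto
    then show "ennreal ((cmod (g x))\<^sup>2) \<le> (exp_conv p f x)\<^sup>2" by (simp add: ennreal_power)
  qed
  also have "\<dots> \<le> ennreal ((2 / p)\<^sup>2 * nsq f)" by (rule exp_conv_L2[OF f p])
  finally have b: "(\<integral>\<^sup>+x. ennreal ((cmod (g x))\<^sup>2) \<partial>half_line) \<le> ennreal ((2 / p)\<^sup>2 * nsq f)" .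
  have "(\<lambda>x. (cmod (g x))\<^sup>2) \<in> borel_measurable half_line" using m by measurable
  then have "integrable half_line (\<lambda>x. (cmod (g x))\<^sup>2)"
    by (rule integrableI_bounded) (use le_less_trans[OF b ennreal_less_top] in simp)
  then show g: "g \<in> L2_half" using m by (simp add: L2_half_def)
  show "nsq g \<le> (2 / p)\<^sup>2 * nsq f"
    using b unfolding nn_nsq[OF g] by (simp add: ennreal_le_iff)
qed

lemma exp_L2_half:
  assumes p: "p > 0"
  shows "(\<lambda>x. of_real (exp (- p * x))) \<in> L2_half"
proof -
  note [measurable] = half_line_id_measurable
  have e: "(cmod (of_real (exp (- p * x))))\<^sup>2 = exp (- (2 * p) * x)" for x :: real
    by (simp add: power2_eq_square exp_add[symmetric])
  have "(\<integral>\<^sup>+x. ennreal (exp (- (2 * p) * x)) \<partial>half_line) = (\<integral>\<^sup>+x. ennreal (exp (- (2 * p) * \<bar>0 - x\<bar>)) \<partial>half_line)"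
    by (intro nn_integral_cong) simp
  also have "\<dots> \<le> ennreal (2 / (2 * p))" by (rule half_line_nn_integral_kernel) (use p in simp)
  finally have b: "(\<integral>\<^sup>+x. ennreal (exp (- (2 * p) * x)) \<partial>half_line) \<le> ennreal (2 / (2 * p))" .
  have "(\<lambda>x. exp (- (2 * p) * x)) \<in> borel_measurable half_line" by measurable
  then have "integrable half_line (\<lambda>x. exp (- (2 * p) * x))"
    by (rule integrableI_bounded) (use le_less_trans[OF b ennreal_less_top] in simp)
  then show ?thesis unfolding L2_half_def mem_Collect_eq e by simp
qed

lemma lap_integrable:
  assumes f: "f \<in> L2_half" and p: "p > 0"
  shows "integrable half_line (\<lambda>y. of_real (exp (- p * y)) * f y)"
  using L2_half_integrable_mult[OF f exp_L2_half[OF p]] by (simp add: mult.commute)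

lemma conv_left_eq_integral:
  assumes f: "f \<in> L2_half" and x: "0 \<le> x"
  shows "integrable half_line (\<lambda>y. indicator {0..x} y *\<^sub>R (of_real (exp (q * y)) * f y))"
    "conv_left q f x = of_real (exp (- q * x)) * (\<integral>y. indicator {0..x} y *\<^sub>R (of_real (exp (q * y)) * f y) \<partial>half_line)"
proof -
  let ?g = "\<lambda>y. indicator {0..x} y *\<^sub>R (of_real (exp (q * y)) * f y)"
  have a: "(\<lambda>y. of_real (exp (q * y)) * f y) absolutely_integrable_on {0..x}"
    by (rule exp_mult_abs_integrable[OF L2_half_abs_integrable[OF f]])
  have e: "?g y = of_real (exp (q * y)) * f y" if "y \<in> {0..x}" for y using that by simp
  have g: "?g absolutely_integrable_on {0..x}"
    by (rule absolutely_integrable_spike[OF a, of "{}"]) (use e in auto)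
  show "integrable half_line ?g" by (rule half_line_integral_bounded_support(1)[OF g]) (use x in auto)
  have "(\<integral>y. ?g y \<partial>half_line) = integral {0..x} ?g"
    by (rule half_line_integral_bounded_support(2)[OF g]) (use x in auto)
  also have "\<dots> = integral {0..x} (\<lambda>y. of_real (exp (q * y)) * f y)"
    by (rule integral_cong) (rule e)
  finally show "conv_left q f x = of_real (exp (- q * x)) * (\<integral>y. ?g y \<partial>half_line)" by (simp add: conv_left_def)
qed

lemma conv_left_le_exp_conv:
  assumes f: "f \<in> L2_half" and x: "0 \<le> x"
  shows "ennreal (cmod (conv_left p f x)) \<le> exp_conv p f x"
proof -
  let ?g = "\<lambda>y. of_real (exp (- p * x)) * (indicator {0..x} y *\<^sub>R (of_real (exp (p * y)) * f y))"
  have "conv_left p f x = (\<integral>y. ?g y \<partial>half_line)"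
    unfolding conv_left_eq_integral(2)[OF f x] by (rule integral_mult_right_zero[symmetric])
  then have "ennreal (cmod (conv_left p f x)) = ennreal (norm (\<integral>y. ?g y \<partial>half_line))" by simp
  also have "\<dots> \<le> (\<integral>\<^sup>+y. ennreal (norm (?g y)) \<partial>half_line)"
    by (intro integral_norm_bound_ennreal integrable_mult_right conv_left_eq_integral(1)[OF f x])
  also have "\<dots> \<le> exp_conv p f x"
    unfolding exp_conv_def
  proof (intro nn_integral_mono ennreal_leI)
    show "norm (?g y) \<le> exp (- p * \<bar>x - y\<bar>) * cmod (f y)" for y
    proof (cases "y \<in> {0..x}")
      case True
      have "exp (- p * x) * exp (p * y) = exp (- p * \<bar>x - y\<bar>)"
        using True by (simp add: exp_add[symmetric] algebra_simps)
      moreover have "norm (?g y) = exp (- p * x) * exp (p * y) * cmod (f y)"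
        using True by (simp add: norm_mult)
      ultimately show ?thesis by simp
    qed (auto simp: indicator_def)
  qed
  finally show ?thesis .
qed

lemma conv_right_le_exp_conv:
  assumes f: "f \<in> L2_half" and p: "p > 0" and x: "0 \<le> x"
  shows "ennreal (cmod (conv_right p f x)) \<le> exp_conv p f x"
proof -
  let ?h = "\<lambda>y. of_real (exp (- p * y)) * f y"
  let ?g = "\<lambda>y. of_real (exp (p * x)) * (?h y - indicator {0..x} y *\<^sub>R ?h y)"
  note i = lap_integrable[OF f p] and j = conv_left_eq_integral(1)[OF f x, of "- p"]
  have "conv_right p f x = of_real (exp (p * x)) * (lap p f - (\<integral>y. indicator {0..x} y *\<^sub>R ?h y \<partial>half_line))"
    unfolding conv_right_def conv_left_eq_integral(2)[OF f x, of "- p"] by (simp add: algebra_simps)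
  also have "\<dots> = (\<integral>y. ?g y \<partial>half_line)"
    using Bochner_Integration.integral_diff[OF i j] unfolding lap_def by simp
  finally have "ennreal (cmod (conv_right p f x)) = ennreal (norm (\<integral>y. ?g y \<partial>half_line))" by simp
  also have "\<dots> \<le> (\<integral>\<^sup>+y. ennreal (norm (?g y)) \<partial>half_line)"
    by (intro integral_norm_bound_ennreal integrable_mult_right Bochner_Integration.integrable_diff i j)
  also have "\<dots> \<le> exp_conv p f x"
    unfolding exp_conv_def
  proof (intro nn_integral_mono ennreal_leI)
    fix y assume y: "y \<in> space half_line"
    show "norm (?g y) \<le> exp (- p * \<bar>x - y\<bar>) * cmod (f y)"
    proof (cases "y \<le> x")
      case False
      have "exp (p * x) * exp (- p * y) = exp (- p * \<bar>x - y\<bar>)"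
        using False by (simp add: exp_add[symmetric] algebra_simps)
      moreover have "norm (?g y) = exp (p * x) * exp (- p * y) * cmod (f y)"
        using False by (simp add: norm_mult)
      ultimately show ?thesis by simp
    qed (use y in \<open>auto simp: indicator_def\<close>)
  qed
  finally show ?thesis .
qed

lemma conv_measurable:
  assumes f: "f \<in> L2_half"
  shows "conv_left q f \<in> borel_measurable half_line" "conv_right q f \<in> borel_measurable half_line"
proof -
  note c = continuous_on_atLeast_0[OF conv_left_continuous[OF L2_half_abs_integrable[OF f]]]
    continuous_on_atLeast_0[OF conv_right_continuous[OF L2_half_abs_integrable[OF f]]]
  show "conv_left q f \<in> borel_measurable half_line"
    by (rule continuous_imp_measurable_on_sets_lebesgue[OF continuous_on_subset[OF c(1)]]) auto
  show "conv_right q f \<in> borel_measurable half_line"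
    by (rule continuous_imp_measurable_on_sets_lebesgue[OF continuous_on_subset[OF c(2)]]) auto
qed

lemma conv_L2:
  assumes f: "f \<in> L2_half" and p: "p > 0"
  shows "conv_left p f \<in> L2_half" "nsq (conv_left p f) \<le> (2 / p)\<^sup>2 * nsq f"
    "conv_right p f \<in> L2_half" "nsq (conv_right p f) \<le> (2 / p)\<^sup>2 * nsq f"
  by (rule L2_half_from_exp_conv[OF f p] conv_measurable[OF f] conv_left_le_exp_conv[OF f] conv_right_le_exp_conv[OF f p] | simp)+

text \<open>The transform is the value of \<open>conv_right\<close> at 0, so the pointwise bound of
  the majorant applies.\<close>

lemma lap_bound:
  assumes f: "f \<in> L2_half" and p: "p > 0"
  shows "(cmod (lap p f))\<^sup>2 \<le> 2 / p * nsq f"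
proof -
  have "ennreal ((cmod (lap p f))\<^sup>2) = (ennreal (cmod (conv_right p f 0)))\<^sup>2" by (simp add: ennreal_power)
  also have "\<dots> \<le> (exp_conv p f 0)\<^sup>2" by (intro power_mono conv_right_le_exp_conv[OF f p]) auto
  also have "\<dots> \<le> ennreal (2 / p * nsq f)" by (rule exp_conv_sq_pointwise[OF f p])
  finally show ?thesis using p by (subst (asm) ennreal_le_iff) auto
qed

lemma nsq_lincomb:
  assumes f: "f \<in> L2_half" and g: "g \<in> L2_half"
  shows "nsq (\<lambda>x. a * f x + b * g x) \<le> 2 * (cmod a)\<^sup>2 * nsq f + 2 * (cmod b)\<^sup>2 * nsq g"
proof -
  have i: "integrable half_line (\<lambda>x. 2 * (cmod a)\<^sup>2 * (cmod (f x))\<^sup>2)" "integrable half_line (\<lambda>x. 2 * (cmod b)\<^sup>2 * (cmod (g x))\<^sup>2)"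
    using f g by (auto intro: L2_half_integrable_sq)
  have "nsq (\<lambda>x. a * f x + b * g x) \<le> (\<integral>x. 2 * (cmod a)\<^sup>2 * (cmod (f x))\<^sup>2 + 2 * (cmod b)\<^sup>2 * (cmod (g x))\<^sup>2 \<partial>half_line)"
    by (intro Bochner_Integration.integral_mono cmod_lincomb_sq_le Bochner_Integration.integrable_add i L2_half_integrable_sq L2_half_lincomb f g)
  also have "\<dots> = 2 * (cmod a)\<^sup>2 * nsq f + 2 * (cmod b)\<^sup>2 * nsq g"
    by (subst Bochner_Integration.integral_add[OF i]) simp
  finally show ?thesis .
qed

section \<open>The resolvent of \<open>H\<close>\<close>

text \<open>The coefficient of the decaying homogeneous solution \<open>e\<^sup>-\<^sup>p\<^sup>x\<close> on edge \<open>j\<close> that makes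
  the free resolvent satisfy the vertex condition.\<close>
definition vertex_coeff :: "real \<Rightarrow> real \<Rightarrow> ('n::finite) wavefun \<Rightarrow> 'n \<Rightarrow> complex" where
  "vertex_coeff \<alpha> p f j = (\<Sum>l\<in>UNIV. lap p (f l)) / of_real (\<alpha> + real CARD('n) * p) - lap p (f j) / of_real (2 * p)"

text \<open>The first part is the integral of f against the whole-line Green function
  \<open>e^(-p |x-y|) / (2 p)\<close>; the second is a decaying homogeneous solution on each edge,
  tuned to the vertex condition.\<close>

definition star_resolvent :: "real \<Rightarrow> real \<Rightarrow> ('n::finite) wavefun \<Rightarrow> 'n wavefun" where
  "star_resolvent \<alpha> p f = (\<lambda>j x. (conv_left p (f j) x + conv_right p (f j) x) / of_real (2 * p)
     + vertex_coeff \<alpha> p f j * of_real (exp (- p * x)))"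

definition star_resolvent_deriv :: "real \<Rightarrow> real \<Rightarrow> ('n::finite) wavefun \<Rightarrow> 'n wavefun" where
  "star_resolvent_deriv \<alpha> p f = (\<lambda>j x. (conv_right p (f j) x - conv_left p (f j) x) / 2
     - of_real p * vertex_coeff \<alpha> p f j * of_real (exp (- p * x)))"

lemma has_integral_exp_neg:
  assumes "0 \<le> x"
  shows "((\<lambda>y. complex_of_real (- p * exp (- p * y))) has_integral (of_real (exp (- p * x)) - 1)) {0..x}"
proof -
  have "((\<lambda>y. - p * exp (- p * y)) has_integral (exp (- p * x) - exp (- p * 0))) {0..x}"
    by (rule fundamental_theorem_of_calculus[OF assms])
       (auto intro!: derivative_eq_intros simp: has_real_derivative_iff_has_vector_derivative[symmetric])
  from has_integral_of_real[OF this] show ?thesis by simp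
qed

context
  fixes \<alpha> p :: real and f :: "('n::finite) wavefun"
  assumes \<alpha>: "\<alpha> > 0" and p: "p > 0" and f: "f \<in> L2"
begin

lemma L2_component_abs_integrable: "f j absolutely_integrable_on {0..b}"
  using f by (auto simp: L2_def intro: L2_half_abs_integrable)

lemma star_resolvent_primitive:
  assumes x: "0 \<le> x"
  shows "(star_resolvent_deriv \<alpha> p f j has_integral (star_resolvent \<alpha> p f j x - star_resolvent \<alpha> p f j 0)) {0..x}"
proof -
  note P = conv_left_primitive[OF L2_component_abs_integrable x, of p j] and Q = conv_right_primitive[OF L2_component_abs_integrable x, of p j]
  note E = has_integral_exp_neg[OF x, of p]
  have "((\<lambda>y. (of_real p * conv_right p (f j) y - of_real p * conv_left p (f j) y) * (1 / of_real (2 * p))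
      + of_real (- p * exp (- p * y)) * vertex_coeff \<alpha> p f j) has_integral
     ((conv_right p (f j) x - lap p (f j) + integral {0..x} (f j)) - (integral {0..x} (f j) - conv_left p (f j) x)) * (1 / of_real (2 * p))
      + (of_real (exp (- p * x)) - 1) * vertex_coeff \<alpha> p f j) {0..x}"
    by (intro has_integral_add has_integral_mult_left has_integral_diff P Q E)
  moreover have "(of_real p * conv_right p (f j) y - of_real p * conv_left p (f j) y) * (1 / of_real (2 * p))
      + of_real (- p * exp (- p * y)) * vertex_coeff \<alpha> p f j = star_resolvent_deriv \<alpha> p f j y" for y
    using p by (simp add: star_resolvent_deriv_def field_simps)
  moreover have "((conv_right p (f j) x - lap p (f j) + integral {0..x} (f j)) - (integral {0..x} (f j) - conv_left p (f j) x)) * (1 / of_real (2 * p))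
      + (of_real (exp (- p * x)) - 1) * vertex_coeff \<alpha> p f j = star_resolvent \<alpha> p f j x - star_resolvent \<alpha> p f j 0"
    by (simp add: star_resolvent_def add_divide_distrib diff_divide_distrib algebra_simps)
  ultimately show ?thesis by (simp only:)
qed

text \<open>The resolvent equation u'' = p^2 u - f in integrated form. The two convolutions each
  contribute the primitive of f, and half of their sum cancels the inhomogeneity.\<close>

lemma star_resolvent_deriv_primitive:
  assumes x: "0 \<le> x"
  shows "((\<lambda>y. of_real (p\<^sup>2) * star_resolvent \<alpha> p f j y - f j y) has_integral
     (star_resolvent_deriv \<alpha> p f j x - star_resolvent_deriv \<alpha> p f j 0)) {0..x}"
proof -
  note P = conv_left_primitive[OF L2_component_abs_integrable x, of p j] and Q = conv_right_primitive[OF L2_component_abs_integrable x, of p j]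
  note E = has_integral_exp_neg[OF x, of p]
  have F: "(f j has_integral integral {0..x} (f j)) {0..x}"
    by (rule integrable_integral[OF set_lebesgue_integral_eq_integral(1)[OF L2_component_abs_integrable]])
  have "((\<lambda>y. (of_real p * conv_right p (f j) y + of_real p * conv_left p (f j) y) * (1 / 2)
      + of_real (- p * exp (- p * y)) * (- of_real p * vertex_coeff \<alpha> p f j) - f j y) has_integral
     ((conv_right p (f j) x - lap p (f j) + integral {0..x} (f j)) + (integral {0..x} (f j) - conv_left p (f j) x)) * (1 / 2)
      + (of_real (exp (- p * x)) - 1) * (- of_real p * vertex_coeff \<alpha> p f j) - integral {0..x} (f j)) {0..x}"
    by (intro has_integral_add has_integral_mult_left has_integral_diff P Q E F)
  moreover have "(of_real p * conv_right p (f j) y + of_real p * conv_left p (f j) y) * (1 / 2)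
      + of_real (- p * exp (- p * y)) * (- of_real p * vertex_coeff \<alpha> p f j) - f j y
      = of_real (p\<^sup>2) * star_resolvent \<alpha> p f j y - f j y" for y
    using p by (simp add: star_resolvent_def field_simps power2_eq_square)
  moreover have "((conv_right p (f j) x - lap p (f j) + integral {0..x} (f j)) + (integral {0..x} (f j) - conv_left p (f j) x)) * (1 / 2)
      + (of_real (exp (- p * x)) - 1) * (- of_real p * vertex_coeff \<alpha> p f j) - integral {0..x} (f j)
      = star_resolvent_deriv \<alpha> p f j x - star_resolvent_deriv \<alpha> p f j 0"
    by (simp add: star_resolvent_deriv_def add_divide_distrib diff_divide_distrib algebra_simps)
  ultimately show ?thesis by (simp only:)
qed

lemma star_resolvent_continuous:
  "continuous_on {0..X} (star_resolvent \<alpha> p f j)" "continuous_on {0..X} (star_resolvent_deriv \<alpha> p f j)"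
  unfolding star_resolvent_def star_resolvent_deriv_def
  by (intro continuous_intros conv_left_continuous conv_right_continuous L2_component_abs_integrable; use p in simp)+

lemma star_resolvent_L2: "star_resolvent \<alpha> p f j \<in> L2_half" "star_resolvent_deriv \<alpha> p f j \<in> L2_half"
proof -
  have fj: "f j \<in> L2_half" using f by (simp add: L2_def)
  note c = conv_L2(1)[OF fj p] conv_L2(3)[OF fj p]
  have "(\<lambda>x. 1 * (1 / of_real (2 * p) * conv_left p (f j) x + 1 / of_real (2 * p) * conv_right p (f j) x)
      + vertex_coeff \<alpha> p f j * of_real (exp (- p * x))) \<in> L2_half"
    by (intro L2_half_lincomb c exp_L2_half p)
  then show "star_resolvent \<alpha> p f j \<in> L2_half" by (simp add: star_resolvent_def add_divide_distrib)
  have "(\<lambda>x. 1 * (1 / 2 * conv_right p (f j) x + (- 1 / 2) * conv_left p (f j) x)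
      + (- of_real p * vertex_coeff \<alpha> p f j) * of_real (exp (- p * x))) \<in> L2_half"
    by (intro L2_half_lincomb c exp_L2_half p)
  then show "star_resolvent_deriv \<alpha> p f j \<in> L2_half" by (simp add: star_resolvent_deriv_def diff_divide_distrib)
qed

lemma star_resolvent_in_star_H:
  "(star_resolvent \<alpha> p f, \<lambda>j x. f j x - of_real (p\<^sup>2) * star_resolvent \<alpha> p f j x) \<in> star_H \<alpha>"
proof -
  let ?u = "star_resolvent \<alpha> p f" and ?u' = "star_resolvent_deriv \<alpha> p f"
  let ?S = "\<Sum>l\<in>UNIV. lap p (f l)" and ?N = "real CARD('n)"
  have ds: "\<alpha> + ?N * p > 0" using \<alpha> p by (intro add_pos_nonneg) auto
  then have d: "complex_of_real (\<alpha> + ?N * p) \<noteq> 0" by (metis less_irrefl of_real_eq_0_iff)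
  have fj: "f j \<in> L2_half" for j using f by (simp add: L2_def)
  have u: "?u \<in> L2" by (simp add: L2_def star_resolvent_L2)
  have 2: "(\<lambda>x. of_real (p\<^sup>2) * ?u j x - f j x) \<in> L2_half" for j
    using L2_half_lincomb[OF star_resolvent_L2(1) fj, of "of_real (p\<^sup>2)" j "-1" j] by simp
  have trace: "has_trace g (g 0)" if "\<And>X. continuous_on {0..X} g" for g
    unfolding has_trace_def using continuous_on_atLeast_0[OF that] by auto
  \<comment> \<open>The edge-dependent terms \<open>lap p (f j) / (2 p)\<close> of the free part and
    of the vertex coefficient cancel, which leaves one value common to all edges.\<close>
  have u0: "?u j 0 = ?S / of_real (\<alpha> + ?N * p)" for j
    using p by (simp add: star_resolvent_def vertex_coeff_def)
  have d0: "?u' j 0 = lap p (f j) - of_real p * (?S / of_real (\<alpha> + ?N * p))" for j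
    using p by (simp add: star_resolvent_deriv_def vertex_coeff_def field_simps)
  \<comment> \<open>With S the sum of the transforms, the outgoing derivatives add up to S - N p S /
    (\<alpha> + N p) = \<alpha> S / (\<alpha> + N p), that is, \<alpha> times the vertex
    value.\<close>
  have "(\<Sum>j\<in>UNIV. ?u' j 0) = ?S - of_nat CARD('n) * (of_real p * (?S / of_real (\<alpha> + ?N * p)))"
    unfolding d0 by (simp add: sum_subtractf)
  also have "\<dots> = of_real \<alpha> * (?S / of_real (\<alpha> + ?N * p))"
  proof -
    have "?S = of_real (\<alpha> + ?N * p) * (?S / of_real (\<alpha> + ?N * p))" using d by simp
    then have "?S = (of_real \<alpha> + of_nat CARD('n) * of_real p) * (?S / of_real (\<alpha> + ?N * p))" by (simp only: of_real_add of_real_mult of_real_of_nat_eq)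
    then show ?thesis by (simp only: ring_distribs mult.assoc) (metis add_diff_cancel_right')
  qed
  finally have vertex: "(\<Sum>j\<in>UNIV. ?u' j 0) = of_real \<alpha> * (?S / of_real (\<alpha> + ?N * p))" .
  have "sobolev_H2 (?u j) (?u' j) (\<lambda>x. of_real (p\<^sup>2) * ?u j x - f j x)" for j
    unfolding sobolev_H2_def
  proof (intro conjI star_resolvent_L2 2)
    show "has_weak_deriv (?u j) (?u' j)"
      by (rule weak_deriv_of_primitive[OF L2_half_abs_integrable[OF star_resolvent_L2(2)] star_resolvent_primitive])
    show "has_weak_deriv (?u' j) (\<lambda>x. of_real (p\<^sup>2) * ?u j x - f j x)"
      by (rule weak_deriv_of_primitive[OF L2_half_abs_integrable[OF 2] star_resolvent_deriv_primitive])
  qed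
  moreover have "has_trace (?u j) (?S / of_real (\<alpha> + ?N * p))" for j
    using trace[of "?u j"] star_resolvent_continuous(1)[of _ j] by (simp add: u0)
  moreover have "has_trace (?u' j) (?u' j 0)" for j
    using trace[of "?u' j"] star_resolvent_continuous(2)[of _ j] by simp
  moreover have "(\<lambda>j x. f j x - of_real (p\<^sup>2) * ?u j x) \<in> L2"
    using L2_lincomb[OF f u, of 1 "- of_real (p\<^sup>2)"] by simp
  moreover have "ae_eq (\<lambda>j x. f j x - of_real (p\<^sup>2) * ?u j x) (\<lambda>j x. - (of_real (p\<^sup>2) * ?u j x - f j x))"
    by (simp add: ae_eq_def)
  ultimately show ?thesis
    unfolding star_H_def using u vertex
    by (intro CollectI case_prodI conjI exI[of _ ?u'] exI[of _ "\<lambda>j x. of_real (p\<^sup>2) * ?u j x - f j x"]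
        exI[of _ "?S / of_real (\<alpha> + ?N * p)"] exI[of _ "\<lambda>j. ?u' j 0"]) auto
qed

end

lemma nsq_le_sqn: "nsq (f j) \<le> sqn f"
  unfolding sqn_eq by (rule member_le_sum[of j UNIV "\<lambda>j. nsq (f j)"]) auto

text \<open>Only a bound for each fixed p is sought; it feeds \<open>spectral_nonneg\<close>. The
  convolutions are bounded by the Schur test, the homogeneous part by the pointwise bound on the
  transforms.\<close>

lemma star_resolvent_bounded:
  assumes \<alpha>: "\<alpha> > 0" and p: "p > 0"
  shows "\<exists>C. \<forall>f\<in>L2. sqn (star_resolvent \<alpha> p f :: ('n::finite) wavefun) \<le> C * sqn f"
proof -
  define N where "N = real CARD('n)"
  define D where "D = nsq (\<lambda>x. of_real (exp (- p * x)))"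
  \<comment> \<open>If L bounds all transforms of the components, then c L bounds every vertex
    coefficient. In K the first summand comes from the two convolutions, the second from the
    homogeneous part with squared norm D; the factors 2 stem from
    \<open>nsq_lincomb\<close>.\<close>
  define c where "c = N / (\<alpha> + N * p) + 1 / (2 * p)"
  define K where "K = 2 * (2 * (1 / (2 * p))\<^sup>2 * (2 / p)\<^sup>2 + 2 * (1 / (2 * p))\<^sup>2 * (2 / p)\<^sup>2) + 2 * (c\<^sup>2 * (2 / p)) * D"
  have N: "N > 0" unfolding N_def by simp
  have ds: "\<alpha> + N * p > 0" using \<alpha> p N by (intro add_pos_nonneg) auto
  have c: "c \<ge> 0" unfolding c_def using N p ds by simp
  have D: "D \<ge> 0" unfolding D_def by simp
  have "sqn (star_resolvent \<alpha> p f) \<le> N * K * sqn f" if f: "f \<in> L2" for f :: "'n wavefun"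
  proof -
    have fj: "f j \<in> L2_half" for j using f by (simp add: L2_def)
    define L where "L = sqrt (2 / p * sqn f)"
    have L: "L \<ge> 0" "L\<^sup>2 = 2 / p * sqn f" using p sqn_nonneg[of f] by (auto simp: L_def)
    have lapL: "cmod (lap p (f j)) \<le> L" for j
    proof (rule power2_le_imp_le[OF _ L(1)])
      have "(cmod (lap p (f j)))\<^sup>2 \<le> 2 / p * nsq (f j)" by (rule lap_bound[OF fj p])
      also have "\<dots> \<le> 2 / p * sqn f" using p by (intro mult_left_mono nsq_le_sqn) auto
      finally show "(cmod (lap p (f j)))\<^sup>2 \<le> L\<^sup>2" by (simp only: L(2))
    qed
    have A: "(cmod (vertex_coeff \<alpha> p f j))\<^sup>2 \<le> c\<^sup>2 * (2 / p) * sqn f" for j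
    proof -
      have "cmod (vertex_coeff \<alpha> p f j) \<le> cmod (\<Sum>l\<in>UNIV. lap p (f l)) / (\<alpha> + N * p) + cmod (lap p (f j)) / (2 * p)"
        unfolding vertex_coeff_def N_def[symmetric]
        by (rule order_trans[OF norm_triangle_ineq4]) (use ds p in \<open>simp add: norm_divide del: of_real_add of_real_mult\<close>)
      also have "\<dots> \<le> (N * L) / (\<alpha> + N * p) + L / (2 * p)"
      proof (intro add_mono divide_right_mono lapL)
        have "cmod (\<Sum>l\<in>UNIV. lap p (f l)) \<le> of_nat (card (UNIV :: 'n set)) * L"
          by (rule order_trans[OF norm_sum sum_bounded_above]) (rule lapL)
        then show "cmod (\<Sum>l\<in>UNIV. lap p (f l)) \<le> N * L" by (simp add: N_def)
      qed (use ds p in auto)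
      also have "\<dots> = c * L" by (simp add: c_def algebra_simps)
      finally have "(cmod (vertex_coeff \<alpha> p f j))\<^sup>2 \<le> (c * L)\<^sup>2" by (rule power_mono) simp
      then show ?thesis by (simp add: power_mult_distrib L(2) mult.assoc)
    qed
    have "nsq (star_resolvent \<alpha> p f j) \<le> K * sqn f" for j
    proof -
      let ?PQ = "\<lambda>x. 1 / of_real (2 * p) * conv_left p (f j) x + 1 / of_real (2 * p) * conv_right p (f j) x"
      note cL = conv_L2[OF fj p, of j]
      have k: "cmod (1 / of_real (2 * p)) = 1 / (2 * p)" using p by (simp add: norm_divide)
      have PQ: "?PQ \<in> L2_half" by (intro L2_half_lincomb cL)
      have bnd: "nsq (conv_left p (f j)) \<le> (2 / p)\<^sup>2 * sqn f" "nsq (conv_right p (f j)) \<le> (2 / p)\<^sup>2 * sqn f"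
        by (rule order_trans[OF cL(2)] order_trans[OF cL(4)], rule mult_left_mono[OF nsq_le_sqn], simp)+
      have "nsq ?PQ \<le> 2 * (1 / (2 * p))\<^sup>2 * nsq (conv_left p (f j)) + 2 * (1 / (2 * p))\<^sup>2 * nsq (conv_right p (f j))"
        using nsq_lincomb[OF cL(1) cL(3), of "1 / of_real (2 * p)" "1 / of_real (2 * p)"] unfolding k .
      also have "\<dots> \<le> 2 * (1 / (2 * p))\<^sup>2 * ((2 / p)\<^sup>2 * sqn f) + 2 * (1 / (2 * p))\<^sup>2 * ((2 / p)\<^sup>2 * sqn f)"
        by (intro add_mono mult_left_mono bnd) auto
      finally have PQb: "nsq ?PQ \<le> (2 * (1 / (2 * p))\<^sup>2 * (2 / p)\<^sup>2 + 2 * (1 / (2 * p))\<^sup>2 * (2 / p)\<^sup>2) * sqn f"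
        by (simp only: ring_distribs mult.assoc)
      have "star_resolvent \<alpha> p f j = (\<lambda>x. 1 * ?PQ x + vertex_coeff \<alpha> p f j * of_real (exp (- p * x)))"
        by (simp add: star_resolvent_def add_divide_distrib fun_eq_iff)
      then have "nsq (star_resolvent \<alpha> p f j) = nsq (\<lambda>x. 1 * ?PQ x + vertex_coeff \<alpha> p f j * of_real (exp (- p * x)))" by (rule arg_cong)
      also have "\<dots> \<le> 2 * (cmod 1)\<^sup>2 * nsq ?PQ + 2 * (cmod (vertex_coeff \<alpha> p f j))\<^sup>2 * D"
        unfolding D_def by (rule nsq_lincomb[OF PQ exp_L2_half[OF p]])
      also have "\<dots> \<le> 2 * (cmod 1)\<^sup>2 * ((2 * (1 / (2 * p))\<^sup>2 * (2 / p)\<^sup>2 + 2 * (1 / (2 * p))\<^sup>2 * (2 / p)\<^sup>2) * sqn f) + 2 * (c\<^sup>2 * (2 / p) * sqn f) * D"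
        by (intro add_mono mult_left_mono mult_right_mono PQb A D) auto
      also have "\<dots> = K * sqn f" unfolding K_def by (simp add: algebra_simps)
      finally show ?thesis .
    qed
    then have "sqn (star_resolvent \<alpha> p f) \<le> of_nat (card (UNIV :: 'n set)) * (K * sqn f)"
      unfolding sqn_eq[of "star_resolvent \<alpha> p f"] by (intro sum_bounded_above)
    then show ?thesis by (simp add: N_def mult.assoc)
  qed
  then show ?thesis by blast
qed

section \<open>Laplace transform of the solution formula\<close>

lemma conv_left_nonpos: "x \<le> 0 \<Longrightarrow> conv_left q f x = 0"
  by (cases "x = 0") (auto simp: conv_left_def)

lemma conv_left_zero_exponent: "conv_left 0 f x = integral {0..x} f"
  by (simp add: conv_left_def)

text \<open>The integral over {0..x} is 0 for negative x, so \<open>conv_left\<close> continues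
  itself by zero, continuously. Shifted and reflected arguments thereby need no case distinction
  later.\<close>

lemma conv_left_continuous_UNIV:
  assumes "\<And>b. f absolutely_integrable_on {0..b}"
  shows "continuous_on UNIV (conv_left q f)"
proof -
  have "continuous_on UNIV (\<lambda>x. conv_left q f (max 0 x))"
    by (rule continuous_on_compose2[OF continuous_on_atLeast_0[OF conv_left_continuous[OF assms]]])
       (auto intro!: continuous_intros)
  moreover have "conv_left q f (max 0 x) = conv_left q f x" for x
    by (simp add: max_def conv_left_nonpos)
  ultimately show ?thesis by simp
qed

lemma conv_left_bound:
  assumes f: "f \<in> L2_half" and p: "p > 0" and x: "0 \<le> x"
  shows "cmod (conv_left p f x) \<le> sqrt (2 / p * nsq f)"
proof -
  have "ennreal ((cmod (conv_left p f x))\<^sup>2) = (ennreal (cmod (conv_left p f x)))\<^sup>2" by (simp add: ennreal_power)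
  also have "\<dots> \<le> (exp_conv p f x)\<^sup>2" by (intro power_mono conv_left_le_exp_conv[OF f x]) simp
  also have "\<dots> \<le> ennreal (2 / p * nsq f)" by (rule exp_conv_sq_pointwise[OF f p])
  finally have "(cmod (conv_left p f x))\<^sup>2 \<le> 2 / p * nsq f" using p by (subst (asm) ennreal_le_iff) auto
  then show ?thesis by (rule real_le_rsqrt)
qed

text \<open>For q > 0 the function is even bounded. For q = 0 the primitive F satisfies F = M +
  (integral of M) with M = \<open>conv_left 1 f\<close> bounded, which gives linear growth.\<close>

lemma conv_left_linear_growth:
  assumes f: "f \<in> L2_half" and q: "q \<ge> 0"
  shows "\<exists>B\<ge>0. \<forall>x\<ge>0. cmod (conv_left q f x) \<le> B * (1 + x)"
proof (cases "q = 0")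
  case False
  then have q: "q > 0" using assms by simp
  let ?B = "sqrt (2 / q * nsq f)"
  have B: "?B \<ge> 0" using q by (intro real_sqrt_ge_zero mult_nonneg_nonneg) auto
  have "cmod (conv_left q f x) \<le> ?B * (1 + x)" if "x \<ge> 0" for x
  proof -
    have "cmod (conv_left q f x) \<le> ?B * 1" using conv_left_bound[OF f q that] by simp
    also have "\<dots> \<le> ?B * (1 + x)" by (rule mult_left_mono[OF _ B]) (use that in simp)
    finally show ?thesis .
  qed
  then show ?thesis using B by blast
next
  case True
  let ?B = "sqrt (2 / 1 * nsq f)"
  have B: "?B \<ge> 0" by (intro real_sqrt_ge_zero mult_nonneg_nonneg) auto
  have "cmod (conv_left q f x) \<le> ?B * (1 + x)" if x: "x \<ge> 0" for x
  proof -
    have P: "(conv_left 1 f has_integral (integral {0..x} f - conv_left 1 f x)) {0..x}"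
      using conv_left_primitive[OF L2_half_abs_integrable[OF f] x, of 1] by simp
    have "cmod (integral {0..x} f - conv_left 1 f x) \<le> ?B * x"
      using has_integral_bound_real[OF B finite.emptyI P] conv_left_bound[OF f, of 1] x by simp
    moreover have "cmod (integral {0..x} f) \<le> cmod (integral {0..x} f - conv_left 1 f x) + cmod (conv_left 1 f x)"
      using norm_triangle_sub[of "integral {0..x} f" "conv_left 1 f x"] by simp
    ultimately have "cmod (integral {0..x} f) \<le> ?B * x + ?B"
      using conv_left_bound[OF f, of 1 x] x by simp
    then show ?thesis unfolding True conv_left_zero_exponent by (simp add: algebra_simps)
  qed
  then show ?thesis using B by blast
qed

lemma exp_linear_tendsto_0:
  fixes p :: real
  assumes p: "p > 0"
  shows "((\<lambda>x. exp (- p * x) * (1 + x)) \<longlongrightarrow> 0) at_top"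
proof (rule Lim_null_comparison)
  have "((\<lambda>x. exp (- (p / 2 * x))) \<longlongrightarrow> 0) at_top"
    using p by (intro filterlim_compose[OF exp_at_bot] filterlim_compose[OF filterlim_uminus_at_bot_at_top]
          filterlim_tendsto_pos_mult_at_top[OF tendsto_const _ filterlim_ident]) auto
  then show "((\<lambda>x. exp (- (p / 2 * x)) * (1 + 2 / p)) \<longlongrightarrow> 0) at_top" by (rule tendsto_mult_left_zero)
  show "\<forall>\<^sub>F x in at_top. norm (exp (- p * x) * (1 + x)) \<le> exp (- (p / 2 * x)) * (1 + 2 / p)"
  proof (rule eventually_at_top_linorderI[of 0])
    fix x :: real assume x: "0 \<le> x"
    have "1 + p / 2 * x \<le> exp (p / 2 * x)" by (rule exp_ge_add_one_self)
    moreover have "0 \<le> p / 2 * x" using p x by simp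
    ultimately have "p / 2 * x \<le> exp (p / 2 * x)" "1 \<le> exp (p / 2 * x)" by linarith+
    then have "2 / p * (p / 2 * x) \<le> 2 / p * exp (p / 2 * x)" using p by (intro mult_left_mono) auto
    moreover have "2 / p * (p / 2 * x) = x" using p by simp
    moreover have "exp (p / 2 * x) * (1 + 2 / p) = exp (p / 2 * x) + 2 / p * exp (p / 2 * x)" by (simp add: algebra_simps)
    ultimately have "1 + x \<le> exp (p / 2 * x) * (1 + 2 / p)"
      using \<open>1 \<le> exp (p / 2 * x)\<close> by linarith
    then have "exp (- p * x) * (1 + x) \<le> exp (- p * x) * (exp (p / 2 * x) * (1 + 2 / p))"
      by (intro mult_left_mono) auto
    also have "\<dots> = exp (- (p / 2 * x)) * (1 + 2 / p)"
      by (simp add: mult.assoc[symmetric] exp_add[symmetric])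
    finally show "norm (exp (- p * x) * (1 + x)) \<le> exp (- (p / 2 * x)) * (1 + 2 / p)" using x by simp
  qed
qed

lemma lap_limit:
  assumes f: "f \<in> L2_half" and p: "p > 0"
  shows "((\<lambda>X. integral {0..X} (\<lambda>y. of_real (exp (- p * y)) * f y)) \<longlongrightarrow> lap p f) at_top"
proof -
  let ?h = "\<lambda>y. of_real (exp (- p * y)) * f y"
  have i: "integrable half_line ?h" by (rule lap_integrable[OF f p])
  have m: "(\<lambda>y. indicator {0..X} y *\<^sub>R ?h y) \<in> borel_measurable half_line" for X
  proof (cases "X \<ge> 0")
    case True
    show ?thesis using conv_left_eq_integral(1)[OF f True, of "- p"] by (rule borel_measurable_integrable)
  qed simp
  have "((\<lambda>X. \<integral>y. indicator {0..X} y *\<^sub>R ?h y \<partial>half_line) \<longlongrightarrow> (\<integral>y. ?h y \<partial>half_line)) at_top"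
  proof (rule integral_dominated_convergence_at_top[where w="\<lambda>y. norm (?h y)"])
    show "AE y in half_line. ((\<lambda>X. indicator {0..X} y *\<^sub>R ?h y) \<longlongrightarrow> ?h y) at_top"
    proof (rule AE_I2)
      fix y :: real assume "y \<in> space half_line"
      then have "\<forall>\<^sub>F X in at_top. indicator {0..X} y *\<^sub>R ?h y = ?h y"
        by (intro eventually_at_top_linorderI[of y]) (auto simp: indicator_def)
      then show "((\<lambda>X. indicator {0..X} y *\<^sub>R ?h y) \<longlongrightarrow> ?h y) at_top" by (rule tendsto_eventually)
    qed
    show "\<forall>\<^sub>F X in at_top. AE y in half_line. norm (indicator {0..X} y *\<^sub>R ?h y) \<le> norm (?h y)"
      by (intro always_eventually allI AE_I2) (auto simp: indicator_def)
  qed (use i m in \<open>auto intro: borel_measurable_integrable\<close>)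
  moreover have "\<forall>\<^sub>F X in at_top. (\<integral>y. indicator {0..X} y *\<^sub>R ?h y \<partial>half_line) = integral {0..X} ?h"
  proof (rule eventually_at_top_linorderI[of 0])
    fix X :: real assume X: "0 \<le> X"
    show "(\<integral>y. indicator {0..X} y *\<^sub>R ?h y \<partial>half_line) = integral {0..X} ?h"
      using conv_left_eq_integral(2)[OF f X, of "- p"] by (simp add: conv_left_def)
  qed
  ultimately show ?thesis unfolding lap_def by (rule Lim_transform_eventually)
qed

text \<open>The convolution theorem: the kernel \<open>e^(-q t)\<close> has transform 1/(p + q). It
  comes from integrating the indefinite integral of \<open>e^(q y) f\<close> by parts against
  \<open>e^(-(p+q) y)\<close>; the boundary term dies by linear growth.\<close>

lemma laplace_conv_left:
  assumes f: "f \<in> L2_half" and p: "p > 0" and q: "q \<ge> 0"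
  shows "((\<lambda>X. integral {0..X} (\<lambda>t. of_real (exp (- p * t)) * conv_left q f t)) \<longlongrightarrow> lap p f / of_real (p + q)) at_top"
proof -
  have a: "f absolutely_integrable_on {0..b}" for b by (rule L2_half_abs_integrable[OF f])
  have pq: "p + q > 0" using p q by simp
  have eq: "integral {0..X} (\<lambda>t. of_real (exp (- p * t)) * conv_left q f t)
     = (integral {0..X} (\<lambda>y. of_real (exp (- p * y)) * f y) - of_real (exp (- p * X)) * conv_left q f X) / of_real (p + q)"
    if X: "0 \<le> X" for X
  proof -
    have e: "exp (q * y) * exp (- (p + q) * y) = exp (- p * y)" for y
      by (simp add: exp_add[symmetric] algebra_simps)
    have c: "integral {0..y} (\<lambda>y. of_real (exp (q * y)) * f y) = of_real (exp (q * y)) * conv_left q f y" for y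
    proof -
      have "complex_of_real (exp (q * y)) * of_real (exp (- q * y)) = 1"
        unfolding of_real_mult[symmetric] exp_add[symmetric] by simp
      then show ?thesis unfolding conv_left_def mult.assoc[symmetric] by simp
    qed
    have "((\<lambda>y. integral {0..y} (\<lambda>y. of_real (exp (q * y)) * f y) * of_real (- (p + q) * exp (- (p + q) * y))) has_integral
      (integral {0..X} (\<lambda>y. of_real (exp (q * y)) * f y) * of_real (exp (- (p + q) * X))
       - integral {0..X} (\<lambda>y. of_real (exp (q * y)) * f y * of_real (exp (- (p + q) * y))))) {0..X}"
      by (rule primitive_integration_by_parts[OF exp_mult_abs_integrable[OF a] X])
         (auto intro!: derivative_eq_intros continuous_intros)
    moreover have "of_real (exp (q * y)) * z * of_real (exp (- (p + q) * y)) = of_real (exp (- p * y)) * z" for y and z :: complex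
      unfolding e[of y, symmetric] of_real_mult by (simp only: mult_ac)
    moreover have "of_real (exp (q * y)) * z * of_real (- (p + q) * exp (- (p + q) * y)) = of_real (- (p + q)) * (of_real (exp (- p * y)) * z)" for y and z :: complex
      unfolding e[of y, symmetric] of_real_mult by (simp only: mult_ac)
    ultimately have "((\<lambda>y. of_real (- (p + q)) * (of_real (exp (- p * y)) * conv_left q f y)) has_integral
      (of_real (exp (- p * X)) * conv_left q f X - integral {0..X} (\<lambda>y. of_real (exp (- p * y)) * f y))) {0..X}"
      unfolding c by (simp only:)
    from has_integral_mult_right[OF this, of "- 1 / of_real (p + q)"]
    have "((\<lambda>y. of_real (exp (- p * y)) * conv_left q f y) has_integral
      (- 1 / of_real (p + q)) * (of_real (exp (- p * X)) * conv_left q f X - integral {0..X} (\<lambda>y. of_real (exp (- p * y)) * f y))) {0..X}"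
    proof (rule has_integral_eq[rotated])
      have "complex_of_real (p + q) \<noteq> 0" using pq by (metis less_irrefl of_real_eq_0_iff)
      then show "- 1 / of_real (p + q) * (of_real (- (p + q)) * (of_real (exp (- p * y)) * conv_left q f y)) = of_real (exp (- p * y)) * conv_left q f y" for y
        by (simp only: of_real_minus) (simp add: field_simps del: of_real_add)
    qed
    then show ?thesis by (simp add: integral_unique diff_divide_distrib del: of_real_add)
  qed
  obtain B where B: "B \<ge> 0" "\<And>x. x \<ge> 0 \<Longrightarrow> cmod (conv_left q f x) \<le> B * (1 + x)"
    using conv_left_linear_growth[OF f q] by blast
  have "((\<lambda>X. of_real (exp (- p * X)) * conv_left q f X) \<longlongrightarrow> 0) at_top"
  proof (rule Lim_null_comparison)
    show "\<forall>\<^sub>F X in at_top. norm (of_real (exp (- p * X)) * conv_left q f X) \<le> exp (- p * X) * (1 + X) * B"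
      using B(2) by (intro eventually_at_top_linorderI[of 0]) (auto simp: norm_mult mult_ac)
    show "((\<lambda>X. exp (- p * X) * (1 + X) * B) \<longlongrightarrow> 0) at_top"
      by (rule tendsto_mult_left_zero[OF exp_linear_tendsto_0[OF p]])
  qed
  from tendsto_divide[OF tendsto_diff[OF lap_limit[OF f p] this] tendsto_const[of "of_real (p + q)"]]
  have "((\<lambda>X. (integral {0..X} (\<lambda>y. of_real (exp (- p * y)) * f y) - of_real (exp (- p * X)) * conv_left q f X) / of_real (p + q))
      \<longlongrightarrow> lap p f / of_real (p + q)) at_top"
    using pq by (simp del: of_real_add)
  moreover have "\<forall>\<^sub>F X in at_top. (integral {0..X} (\<lambda>y. of_real (exp (- p * y)) * f y) - of_real (exp (- p * X)) * conv_left q f X) / of_real (p + q)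
     = integral {0..X} (\<lambda>t. of_real (exp (- p * t)) * conv_left q f t)"
    using eq by (intro eventually_at_top_linorderI[of 0]) simp
  ultimately show ?thesis by (rule Lim_transform_eventually)
qed

text \<open>Integration by parts on the bounded interval. Since no decay is involved, r may have
  either sign: -p serves the left shift, p the reflection.\<close>

lemma exp_mult_primitive:
  assumes f: "\<And>b. f absolutely_integrable_on {0..b}" and b: "0 \<le> b"
  shows "((\<lambda>y. of_real r * (of_real (exp (r * y)) * conv_left 0 f y)) has_integral
     (of_real (exp (r * b)) * (conv_left 0 f b - conv_left r f b))) {0..b}"
proof -
  have "((\<lambda>y. integral {0..y} f * of_real (r * exp (r * y))) has_integral
      (integral {0..b} f * of_real (exp (r * b)) - integral {0..b} (\<lambda>y. f y * of_real (exp (r * y))))) {0..b}"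
    by (rule primitive_integration_by_parts[OF f b]) (auto intro!: derivative_eq_intros continuous_intros)
  moreover have "integral {0..b} (\<lambda>y. f y * of_real (exp (r * y))) = of_real (exp (r * b)) * conv_left r f b"
  proof -
    have "complex_of_real (exp (r * b)) * of_real (exp (- r * b)) = 1"
      unfolding of_real_mult[symmetric] exp_add[symmetric] by simp
    then show ?thesis unfolding conv_left_def mult.assoc[symmetric] by (simp add: mult.commute)
  qed
  ultimately show ?thesis by (simp add: conv_left_zero_exponent algebra_simps)
qed

text \<open>\<open>wave_primitive \<alpha> f j t b\<close> is the integral over \<open>0 < x < b\<close> of the claimed solution at time \<open>t\<close>.
  The primitives of the two last terms of the solution formula combine, because
  \<open>M = conv_left (\<alpha>/N) f\<close> satisfies \<open>M = F - (\<alpha>/N) \<integral> M\<close>.\<close>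
definition wave_primitive :: "real \<Rightarrow> ('n::finite) wavefun \<Rightarrow> 'n \<Rightarrow> real \<Rightarrow> real \<Rightarrow> complex" where
  "wave_primitive \<alpha> f j t b = (conv_left 0 (f j) \<bar>t - b\<bar> + conv_left 0 (f j) (t + b)) / 2 - conv_left 0 (f j) t
     + (\<Sum>l\<in>UNIV. conv_left (\<alpha> / real CARD('n)) (f l) t - conv_left (\<alpha> / real CARD('n)) (f l) (t - b)) / of_nat CARD('n)"

context
  fixes g :: "real \<Rightarrow> complex" and p b :: real
  assumes g: "g \<in> L2_half" and p: "p > 0" and b: "b > 0"
begin

lemma conv_left_exp_has_integral:
  "((\<lambda>t. of_real (exp (- p * t)) * conv_left q g (\<phi> t)) has_integral
     integral {c..d} (\<lambda>t. of_real (exp (- p * t)) * conv_left q g (\<phi> t))) {c..d}"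
  if "continuous_on UNIV \<phi>" for \<phi> :: "real \<Rightarrow> real"
  by (intro integrable_integral integrable_continuous_interval continuous_intros
      continuous_on_compose2[OF conv_left_continuous_UNIV[OF L2_half_abs_integrable[OF g]]]
      continuous_on_subset[OF that]) auto

text \<open>The usual delay rule, valid without correction because \<open>conv_left\<close> vanishes
  for t < b.\<close>

lemma laplace_shift_right:
  assumes q: "q \<ge> 0"
  shows "((\<lambda>X. integral {0..X} (\<lambda>t. of_real (exp (- p * t)) * conv_left q g (t - b))) \<longlongrightarrow>
     of_real (exp (- p * b)) * (lap p g / of_real (p + q))) at_top"
proof -
  let ?h = "\<lambda>t. of_real (exp (- p * t)) * conv_left q g t"
  have "((\<lambda>X. integral {0..X - b} ?h) \<longlongrightarrow> lap p g / of_real (p + q)) at_top"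
    using filterlim_compose[OF laplace_conv_left[OF g p q] filterlim_tendsto_add_at_top[OF tendsto_const[of "- b"] filterlim_ident]]
    by simp
  then have "((\<lambda>X. of_real (exp (- p * b)) * integral {0..X - b} ?h) \<longlongrightarrow> of_real (exp (- p * b)) * (lap p g / of_real (p + q))) at_top"
    by (intro tendsto_mult tendsto_const)
  moreover have "\<forall>\<^sub>F X in at_top. of_real (exp (- p * b)) * integral {0..X - b} ?h = integral {0..X} (\<lambda>t. of_real (exp (- p * t)) * conv_left q g (t - b))"
  proof (rule eventually_at_top_linorderI[of b])
    fix X assume X: "b \<le> X"
    have "(?h has_integral integral {0..X - b} ?h) {0..X - b}"
      using conv_left_exp_has_integral[OF continuous_on_id, of q 0 "X - b"] by simp
    then have "((\<lambda>t. ?h (t + (- b))) has_integral integral {0..X - b} ?h) {b..X}"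
      using has_integral_shift_real_ivl[of ?h _ 0 "X - b" "- b"] by simp
    then have "((\<lambda>t. of_real (exp (- p * b)) * ?h (t + (- b))) has_integral of_real (exp (- p * b)) * integral {0..X - b} ?h) {b..X}"
      by (rule has_integral_mult_right)
    moreover have "of_real (exp (- p * b)) * ?h (t + (- b)) = of_real (exp (- p * t)) * conv_left q g (t - b)" for t
      by (simp only: mult.assoc[symmetric] of_real_mult[symmetric] exp_add[symmetric] diff_conv_add_uminus)
         (simp add: algebra_simps)
    ultimately have 1: "((\<lambda>t. of_real (exp (- p * t)) * conv_left q g (t - b)) has_integral of_real (exp (- p * b)) * integral {0..X - b} ?h) {b..X}"
      by (simp only:)
    have 2: "((\<lambda>t. of_real (exp (- p * t)) * conv_left q g (t - b)) has_integral 0) {0..b}"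
      by (rule has_integral_is_0) (simp add: conv_left_nonpos)
    from has_integral_combine[OF less_imp_le[OF b] X 2 1]
    show "of_real (exp (- p * b)) * integral {0..X - b} ?h = integral {0..X} (\<lambda>t. of_real (exp (- p * t)) * conv_left q g (t - b))"
      by (simp add: integral_unique)
  qed
  ultimately show ?thesis by (rule Lim_transform_eventually)
qed

text \<open>Advancing by b loses the piece of the transform over (0,b). That piece, a
  \<open>conv_left\<close> with parameter -p, combines with the growing exponential times
  \<open>lap p g\<close> into exactly \<open>conv_right\<close>.\<close>

lemma laplace_shift_left:
  "((\<lambda>X. integral {0..X} (\<lambda>t. of_real (exp (- p * t)) * conv_left 0 g (t + b))) \<longlongrightarrow>
     (conv_left 0 g b + conv_right p g b) / of_real p) at_top"
proof -
  let ?h = "\<lambda>t. of_real (exp (- p * t)) * conv_left 0 g t"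
  have hi: "(?h has_integral integral {c..d} ?h) {c..d}" for c d
    using conv_left_exp_has_integral[OF continuous_on_id, of 0 c d] by simp
  have e1: "complex_of_real (exp (p * b)) * of_real (exp (- p * b)) = 1"
    unfolding of_real_mult[symmetric] exp_add[symmetric] by simp
  have p0: "complex_of_real p \<noteq> 0" using p by simp
  have I0: "of_real (exp (p * b)) * integral {0..b} ?h = (conv_left (- p) g b - conv_left 0 g b) / of_real p"
  proof -
    have "((\<lambda>y. of_real (- p) * (of_real (exp (- p * y)) * conv_left 0 g y)) has_integral
     (of_real (exp (- p * b)) * (conv_left 0 g b - conv_left (- p) g b))) {0..b}"
      using exp_mult_primitive[OF L2_half_abs_integrable[OF g] less_imp_le[OF b], of "- p"] .
    from has_integral_unique[OF this has_integral_mult_right[OF hi]]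
    have "- of_real p * integral {0..b} ?h = of_real (exp (- p * b)) * (conv_left 0 g b - conv_left (- p) g b)"
      by simp
    then have "of_real (exp (p * b)) * (- of_real p * integral {0..b} ?h) = of_real (exp (p * b)) * (of_real (exp (- p * b)) * (conv_left 0 g b - conv_left (- p) g b))"
      by (rule arg_cong)
    also have "\<dots> = conv_left 0 g b - conv_left (- p) g b" unfolding mult.assoc[symmetric] e1 by simp
    finally show ?thesis using p0 by (simp add: field_simps)
  qed
  have "((\<lambda>X. integral {0..X + b} ?h) \<longlongrightarrow> lap p g / of_real (p + 0)) at_top"
    using filterlim_compose[OF laplace_conv_left[OF g p order_refl] filterlim_tendsto_add_at_top[OF tendsto_const[of b] filterlim_ident]]
    by (simp add: add.commute)
  then have "((\<lambda>X. of_real (exp (p * b)) * (integral {0..X + b} ?h - integral {0..b} ?h)) \<longlongrightarrow>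
      of_real (exp (p * b)) * (lap p g / of_real (p + 0) - integral {0..b} ?h)) at_top"
    by (intro tendsto_mult tendsto_diff tendsto_const)
  also have "of_real (exp (p * b)) * (lap p g / of_real (p + 0) - integral {0..b} ?h) = (conv_left 0 g b + conv_right p g b) / of_real p"
    unfolding right_diff_distrib I0 conv_right_def by (simp add: diff_divide_distrib add_divide_distrib)
  finally have L: "((\<lambda>X. of_real (exp (p * b)) * (integral {0..X + b} ?h - integral {0..b} ?h)) \<longlongrightarrow>
      (conv_left 0 g b + conv_right p g b) / of_real p) at_top" .
  moreover have "\<forall>\<^sub>F X in at_top. of_real (exp (p * b)) * (integral {0..X + b} ?h - integral {0..b} ?h) = integral {0..X} (\<lambda>t. of_real (exp (- p * t)) * conv_left 0 g (t + b))"
  proof (rule eventually_at_top_linorderI[of 0])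
    fix X :: real assume X: "0 \<le> X"
    have s: "integral {0..X + b} ?h - integral {0..b} ?h = integral {b..X + b} ?h"
      using Henstock_Kurzweil_Integration.integral_combine[of 0 b "X + b" ?h] hi[of 0 "X + b"] b X
      by (auto simp: has_integral_integrable_integral algebra_simps)
    have "((\<lambda>t. ?h (t + b)) has_integral integral {b..X + b} ?h) {0..X}"
      using has_integral_shift_real_ivl[OF hi[of b "X + b"], of b] by simp
    then have "((\<lambda>t. of_real (exp (p * b)) * ?h (t + b)) has_integral of_real (exp (p * b)) * integral {b..X + b} ?h) {0..X}"
      by (rule has_integral_mult_right)
    moreover have "of_real (exp (p * b)) * ?h (t + b) = of_real (exp (- p * t)) * conv_left 0 g (t + b)" for t
      by (simp only: mult.assoc[symmetric] of_real_mult[symmetric] exp_add[symmetric])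
         (simp add: algebra_simps)
    ultimately show "of_real (exp (p * b)) * (integral {0..X + b} ?h - integral {0..b} ?h) = integral {0..X} (\<lambda>t. of_real (exp (- p * t)) * conv_left 0 g (t + b))"
      unfolding s by (simp only: integral_unique)
  qed
  ultimately show ?thesis by (rule Lim_transform_eventually)
qed

text \<open>F(b - t) vanishes for t > b, so the truncated transform is constant once X \<ge> b, and
  y = b - t reduces it to a finite integral.\<close>

lemma laplace_reflect:
  "((\<lambda>X. integral {0..X} (\<lambda>t. of_real (exp (- p * t)) * conv_left 0 g (b - t))) \<longlongrightarrow>
     (conv_left 0 g b - conv_left p g b) / of_real p) at_top"
proof (rule tendsto_eventually, rule eventually_at_top_linorderI[of b])
  fix X assume X: "b \<le> X"
  let ?k = "\<lambda>y. of_real (exp (- p * (b - y))) * conv_left 0 g y"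
  have p0: "complex_of_real p \<noteq> 0" using p by simp
  have "((\<lambda>y. of_real (exp (- p * b)) / of_real p * (of_real p * (of_real (exp (p * y)) * conv_left 0 g y))) has_integral
     of_real (exp (- p * b)) / of_real p * (of_real (exp (p * b)) * (conv_left 0 g b - conv_left p g b))) {0..b}"
    by (intro has_integral_mult_right exp_mult_primitive L2_half_abs_integrable g less_imp_le[OF b])
  moreover have "of_real (exp (- p * b)) / of_real p * (of_real p * (of_real (exp (p * y)) * conv_left 0 g y)) = ?k y" for y
  proof -
    have "exp (- p * (b - y)) = exp (- p * b) * exp (p * y)" by (simp add: exp_add[symmetric] algebra_simps)
    then show ?thesis using p0 by simp
  qed
  moreover have "of_real (exp (- p * b)) / of_real p * (of_real (exp (p * b)) * z) = z / of_real p" for z :: complex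
  proof -
    have "complex_of_real (exp (- p * b)) * of_real (exp (p * b)) = 1"
      unfolding of_real_mult[symmetric] exp_add[symmetric] by simp
    then show ?thesis by (metis mult.assoc mult_1 times_divide_eq_left)
  qed
  ultimately have "(?k has_integral (conv_left 0 g b - conv_left p g b) / of_real p) {0..b}" by (simp only:)
  then have "((\<lambda>y. ?k (- y)) has_integral (conv_left 0 g b - conv_left p g b) / of_real p) {- b..- 0}"
    by (rule has_integral_reflect_real[where f="?k", THEN iffD2])
  then have "((\<lambda>t. ?k (- (t + (- b)))) has_integral (conv_left 0 g b - conv_left p g b) / of_real p) {0..b}"
    using has_integral_shift_real_ivl[of "\<lambda>y. ?k (- y)" _ "- b" "- 0" "- b"] by simp
  then have 1: "((\<lambda>t. of_real (exp (- p * t)) * conv_left 0 g (b - t)) has_integral (conv_left 0 g b - conv_left p g b) / of_real p) {0..b}"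
    by (simp add: algebra_simps)
  have 2: "((\<lambda>t. of_real (exp (- p * t)) * conv_left 0 g (b - t)) has_integral 0) {b..X}"
    by (rule has_integral_is_0) (simp add: conv_left_nonpos)
  from has_integral_combine[OF less_imp_le[OF b] X 1 2]
  show "integral {0..X} (\<lambda>t. of_real (exp (- p * t)) * conv_left 0 g (b - t)) = (conv_left 0 g b - conv_left p g b) / of_real p"
    by (simp add: integral_unique)
qed

text \<open>Of F(b - t) and F(t - b) one always vanishes, so their sum is F at the absolute
  value.\<close>

lemma laplace_abs:
  "((\<lambda>X. integral {0..X} (\<lambda>t. of_real (exp (- p * t)) * conv_left 0 g \<bar>t - b\<bar>)) \<longlongrightarrow>
     (conv_left 0 g b - conv_left p g b) / of_real p + of_real (exp (- p * b)) * (lap p g / of_real (p + 0))) at_top"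
proof -
  have split: "conv_left 0 g \<bar>t - b\<bar> = conv_left 0 g (b - t) + conv_left 0 g (t - b)" for t
    by (cases "t \<le> b") (auto simp: abs_if conv_left_nonpos)
  have "integral {0..X} (\<lambda>t. of_real (exp (- p * t)) * conv_left 0 g \<bar>t - b\<bar>)
     = integral {0..X} (\<lambda>t. of_real (exp (- p * t)) * conv_left 0 g (b - t))
      + integral {0..X} (\<lambda>t. of_real (exp (- p * t)) * conv_left 0 g (t - b))" for X
    unfolding split distrib_left
    by (rule integral_unique, intro has_integral_add conv_left_exp_has_integral continuous_intros)
  then show ?thesis
    by (simp only:) (intro tendsto_add laplace_reflect laplace_shift_right order_refl)
qed

end

text \<open>The limit of the left side is explicit by the shift rules. For the right side,
  integrating p^2 u = u'' + f over (0,b) expresses the integral of u through boundary values of u'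
  and the primitive of f. Both sides then involve only the convolutions at b and the transforms of
  the components.\<close>

lemma wave_primitive_laplace:
  fixes f :: "('n::finite) wavefun"
  assumes \<alpha>: "\<alpha> > 0" and p: "p > 0" and b: "b > 0" and f: "f \<in> L2"
  shows "((\<lambda>X. integral {0..X} (\<lambda>t. of_real (exp (- p * t)) * wave_primitive \<alpha> f j t b)) \<longlongrightarrow>
     of_real p * integral {0..b} (star_resolvent \<alpha> p f j)) at_top"
proof -
  let ?N = "of_nat CARD('n) :: complex" and ?\<beta> = "\<alpha> / real CARD('n)"
  let ?e = "\<lambda>t. complex_of_real (exp (- p * t))"
  have fj: "f l \<in> L2_half" for l using f by (simp add: L2_def)
  have \<beta>: "?\<beta> \<ge> 0" using \<alpha> by simp
  note I = conv_left_exp_has_integral[OF fj p b]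
  have eq: "integral {0..X} (\<lambda>t. ?e t * wave_primitive \<alpha> f j t b)
     = (integral {0..X} (\<lambda>t. ?e t * conv_left 0 (f j) \<bar>t - b\<bar>) + integral {0..X} (\<lambda>t. ?e t * conv_left 0 (f j) (t + b))) * (1/2)
       - integral {0..X} (\<lambda>t. ?e t * conv_left 0 (f j) t)
       + (\<Sum>l\<in>UNIV. integral {0..X} (\<lambda>t. ?e t * conv_left ?\<beta> (f l) t) - integral {0..X} (\<lambda>t. ?e t * conv_left ?\<beta> (f l) (t - b))) * (1 / ?N)" for X
  proof (rule integral_unique)
    have "((\<lambda>t. (?e t * conv_left 0 (f j) \<bar>t - b\<bar> + ?e t * conv_left 0 (f j) (t + b)) * (1/2)
       - ?e t * conv_left 0 (f j) t
       + (\<Sum>l\<in>UNIV. ?e t * conv_left ?\<beta> (f l) t - ?e t * conv_left ?\<beta> (f l) (t - b)) * (1 / ?N)) has_integral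
      (integral {0..X} (\<lambda>t. ?e t * conv_left 0 (f j) \<bar>t - b\<bar>) + integral {0..X} (\<lambda>t. ?e t * conv_left 0 (f j) (t + b))) * (1/2)
       - integral {0..X} (\<lambda>t. ?e t * conv_left 0 (f j) t)
       + (\<Sum>l\<in>UNIV. integral {0..X} (\<lambda>t. ?e t * conv_left ?\<beta> (f l) t) - integral {0..X} (\<lambda>t. ?e t * conv_left ?\<beta> (f l) (t - b))) * (1 / ?N)) {0..X}"
      by (intro has_integral_add has_integral_diff has_integral_sum has_integral_mult_left I finite continuous_intros)
    then show "((\<lambda>t. ?e t * wave_primitive \<alpha> f j t b) has_integral
      (integral {0..X} (\<lambda>t. ?e t * conv_left 0 (f j) \<bar>t - b\<bar>) + integral {0..X} (\<lambda>t. ?e t * conv_left 0 (f j) (t + b))) * (1/2)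
       - integral {0..X} (\<lambda>t. ?e t * conv_left 0 (f j) t)
       + (\<Sum>l\<in>UNIV. integral {0..X} (\<lambda>t. ?e t * conv_left ?\<beta> (f l) t) - integral {0..X} (\<lambda>t. ?e t * conv_left ?\<beta> (f l) (t - b))) * (1 / ?N)) {0..X}"
      by (rule has_integral_eq[rotated])
         (simp add: wave_primitive_def right_diff_distrib distrib_left sum_distrib_left sum_divide_distrib sum_subtractf diff_divide_distrib add_divide_distrib)
  qed
  let ?F = "conv_left 0 (f j) b" and ?P = "conv_left p (f j) b" and ?Q = "conv_right p (f j) b" and ?a = "lap p (f j)"
  let ?Lim = "((?F - ?P) / of_real p + ?e b * (?a / of_real (p + 0)) + (?F + ?Q) / of_real p) * (1/2)
     - ?a / of_real (p + 0)
     + (\<Sum>l\<in>UNIV. lap p (f l) / of_real (p + ?\<beta>) - ?e b * (lap p (f l) / of_real (p + ?\<beta>))) * (1 / ?N)"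
  have L: "((\<lambda>X. integral {0..X} (\<lambda>t. ?e t * wave_primitive \<alpha> f j t b)) \<longlongrightarrow> ?Lim) at_top"
    unfolding eq
    by (intro tendsto_add tendsto_diff tendsto_mult tendsto_const tendsto_sum laplace_abs laplace_shift_left laplace_shift_right
        laplace_conv_left fj p b \<beta> order_refl)
  let ?S = "\<Sum>l\<in>UNIV. lap p (f l)" and ?c = "vertex_coeff \<alpha> p f j"
  have p0: "complex_of_real p \<noteq> 0" using p by simp
  have "((\<lambda>y. of_real (p\<^sup>2) * star_resolvent \<alpha> p f j y) has_integral
     (star_resolvent_deriv \<alpha> p f j b - star_resolvent_deriv \<alpha> p f j 0) + ?F) {0..b}"
  proof -
    have "(f j has_integral ?F) {0..b}"
      unfolding conv_left_zero_exponent
      by (rule integrable_integral[OF set_lebesgue_integral_eq_integral(1)[OF L2_half_abs_integrable[OF fj]]])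
    from has_integral_add[OF star_resolvent_deriv_primitive[OF \<alpha> p f less_imp_le[OF b], of j] this]
    show ?thesis by simp
  qed
  moreover have "(star_resolvent \<alpha> p f j has_integral integral {0..b} (star_resolvent \<alpha> p f j)) {0..b}"
    by (intro integrable_integral integrable_continuous_interval star_resolvent_continuous \<alpha> p f)
  then have "((\<lambda>y. of_real (p\<^sup>2) * star_resolvent \<alpha> p f j y) has_integral of_real (p\<^sup>2) * integral {0..b} (star_resolvent \<alpha> p f j)) {0..b}"
    by (rule has_integral_mult_right)
  ultimately have "of_real (p\<^sup>2) * integral {0..b} (star_resolvent \<alpha> p f j) = (star_resolvent_deriv \<alpha> p f j b - star_resolvent_deriv \<alpha> p f j 0) + ?F"
    by (metis has_integral_unique)
  then have "of_real p * integral {0..b} (star_resolvent \<alpha> p f j) = ((star_resolvent_deriv \<alpha> p f j b - star_resolvent_deriv \<alpha> p f j 0) + ?F) / of_real p"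
    using p0 by (simp add: power2_eq_square field_simps)
  also have "\<dots> = ((?Q - ?P) / 2 - ?a / 2 + ?F) / of_real p + ?c * (1 - ?e b)"
    using p0 by (simp add: star_resolvent_deriv_def field_simps)
  also have "\<dots> = ?Lim"
  proof -
    \<comment> \<open>Here the vertex constant meets the memory kernel: the denominator of the
      vertex coefficient is N times the one produced by
      \<open>conv_left (\<alpha>/N)\<close>.\<close>
    have d: "complex_of_real (\<alpha> + real CARD('n) * p) = ?N * of_real (p + ?\<beta>)"
      by (simp add: field_simps)
    have c: "?c = ?S / of_real (p + ?\<beta>) / ?N - ?a / (2 * of_real p)"
      unfolding vertex_coeff_def d by simp
    have s: "(\<Sum>l\<in>UNIV. lap p (f l) / of_real (p + ?\<beta>) - ?e b * (lap p (f l) / of_real (p + ?\<beta>))) * (1 / ?N)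
       = (?S / of_real (p + ?\<beta>) / ?N) * (1 - ?e b)"
      unfolding sum_subtractf sum_distrib_left[symmetric] sum_divide_distrib[symmetric]
      by (simp add: algebra_simps diff_divide_distrib del: of_real_add)
    show ?thesis unfolding s c using p0 by (simp add: field_simps del: of_real_add)
  qed
  finally show ?thesis using L by simp
qed

lemma wave_primitive_continuous:
  assumes f: "f \<in> L2"
  shows "continuous_on UNIV (\<lambda>t. wave_primitive \<alpha> f j t b)"
proof -
  have c: "continuous_on UNIV (conv_left q (f l))" for q l
    using f by (intro conv_left_continuous_UNIV L2_half_abs_integrable) (simp add: L2_def)
  show ?thesis
    unfolding wave_primitive_def
    by (intro continuous_intros continuous_on_compose2[OF c]) auto
qed

lemma wave_primitive_growth:
  assumes f: "f \<in> L2" and \<alpha>: "\<alpha> > 0" and b: "b > 0"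
  shows "\<exists>B. \<forall>t\<ge>0. cmod (wave_primitive \<alpha> f j t b) \<le> B * (1 + t)"
proof -
  let ?n = "CARD('a)"
  have fj: "f l \<in> L2_half" for l using f by (simp add: L2_def)
  obtain B0 where B0: "B0 \<ge> 0" "\<And>x. x \<ge> 0 \<Longrightarrow> cmod (conv_left 0 (f j) x) \<le> B0 * (1 + x)"
    using conv_left_linear_growth[OF fj order_refl] by blast
  have "\<exists>B\<ge>0. \<forall>x\<ge>0. cmod (conv_left (\<alpha> / real ?n) (f l) x) \<le> B * (1 + x)" for l
    using conv_left_linear_growth[OF fj, of "\<alpha> / real ?n"] \<alpha> by simp
  then obtain B1 where B1: "\<And>l. B1 l \<ge> 0" "\<And>l x. x \<ge> 0 \<Longrightarrow> cmod (conv_left (\<alpha> / real ?n) (f l) x) \<le> B1 l * (1 + x)"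
    by metis
  \<comment> \<open>One bound for all arguments |t - b|, t + b, t and t - b: each is at most t + b,
    and negative arguments give 0.\<close>
  have grow: "cmod (conv_left q (f l) s) \<le> K * (1 + b) * (1 + t)"
    if K: "K \<ge> 0" "\<And>x. x \<ge> 0 \<Longrightarrow> cmod (conv_left q (f l) x) \<le> K * (1 + x)" and s: "s \<le> t + b" and t: "0 \<le> t" for K q l s t
  proof (cases "s \<ge> 0")
    case True
    have "0 \<le> b * t" using b t by simp
    then have "1 + s \<le> (1 + b) * (1 + t)" using s by (simp add: algebra_simps)
    then have "K * (1 + s) \<le> K * ((1 + b) * (1 + t))" by (rule mult_left_mono[OF _ K(1)])
    then show ?thesis using K(2)[OF True] by (simp add: mult.assoc)
  qed (use K b t in \<open>simp add: conv_left_nonpos\<close>)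
  define B where "B = (B0 * (1 + b) + B0 * (1 + b)) / 2 + B0 * (1 + b) + (\<Sum>l\<in>UNIV. B1 l * (1 + b) + B1 l * (1 + b)) / real ?n"
  have "cmod (wave_primitive \<alpha> f j t b) \<le> B * (1 + t)" if t: "t \<ge> 0" for t
  proof -
    let ?F = "conv_left 0 (f j)" and ?M = "\<lambda>l. conv_left (\<alpha> / real ?n) (f l)"
    have "cmod (wave_primitive \<alpha> f j t b) \<le> cmod ((?F \<bar>t - b\<bar> + ?F (t + b)) / 2) + cmod (?F t)
       + cmod ((\<Sum>l\<in>UNIV. ?M l t - ?M l (t - b)) / of_nat ?n)"
      unfolding wave_primitive_def by (intro order_trans[OF norm_triangle_ineq] add_right_mono norm_triangle_ineq4)
    also have "\<dots> \<le> (B0 * (1 + b) * (1 + t) + B0 * (1 + b) * (1 + t)) / 2 + B0 * (1 + b) * (1 + t)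
       + (\<Sum>l\<in>UNIV. B1 l * (1 + b) * (1 + t) + B1 l * (1 + b) * (1 + t)) / real ?n"
    proof (intro add_mono)
      have "cmod (?F \<bar>t - b\<bar> + ?F (t + b)) \<le> B0 * (1 + b) * (1 + t) + B0 * (1 + b) * (1 + t)"
        using t b by (intro norm_triangle_mono grow[OF B0]) auto
      then show "cmod ((?F \<bar>t - b\<bar> + ?F (t + b)) / 2) \<le> (B0 * (1 + b) * (1 + t) + B0 * (1 + b) * (1 + t)) / 2"
        by (simp add: norm_divide)
      show "cmod (?F t) \<le> B0 * (1 + b) * (1 + t)" using t b by (intro grow[OF B0]) auto
      have "cmod (\<Sum>l\<in>UNIV. ?M l t - ?M l (t - b)) \<le> (\<Sum>l\<in>UNIV. B1 l * (1 + b) * (1 + t) + B1 l * (1 + b) * (1 + t))"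
        using t b by (intro sum_norm_le order_trans[OF norm_triangle_ineq4] add_mono grow[OF B1]) auto
      then show "cmod ((\<Sum>l\<in>UNIV. ?M l t - ?M l (t - b)) / of_nat ?n) \<le> (\<Sum>l\<in>UNIV. B1 l * (1 + b) * (1 + t) + B1 l * (1 + b) * (1 + t)) / real ?n"
        by (simp add: norm_divide divide_right_mono)
    qed
    also have "\<dots> = B * (1 + t)"
      unfolding B_def
      by (simp add: sum_distrib_right[symmetric] distrib_right[symmetric]) (simp add: algebra_simps add_divide_distrib)
    finally show ?thesis .
  qed
  then show ?thesis by blast
qed

section \<open>Comparing the abstract cosine with the explicit formula on (0,b)\<close>

lemma cut_off_L2: "(\<lambda>l x. if l = j \<and> x \<le> b then 1 else 0) \<in> L2"
proof -
  have "(\<lambda>x. if x \<le> b then 1 else 0 :: complex) \<in> L2_half"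
  proof -
    note [measurable] = half_line_id_measurable
    have m: "(\<lambda>x. if x \<le> b then 1 else 0 :: complex) \<in> borel_measurable half_line" by measurable
    have a: "(\<lambda>x. if x \<le> b then 1 else 0 :: complex) absolutely_integrable_on {0..max b 0}"
      by (rule absolutely_integrable_spike[OF absolutely_integrable_continuous_real[of 0 "max b 0" "\<lambda>_. if b \<ge> 0 then 1 else 0"], of "{0}"])
         auto
    have "integrable half_line (\<lambda>x. if x \<le> b then 1 else 0 :: complex)"
      by (rule half_line_integral_bounded_support(1)[OF a]) auto
    then have "integrable half_line (\<lambda>x. norm (if x \<le> b then 1 else 0 :: complex))" by (rule integrable_norm)
    moreover have "(cmod (if x \<le> b then 1 else 0))\<^sup>2 = norm (if x \<le> b then 1 else 0 :: complex)" for x by simp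
    ultimately show ?thesis using m unfolding L2_half_def by (simp only: mem_Collect_eq)
  qed
  then have "(\<lambda>x. if l = j \<and> x \<le> b then 1 else 0 :: complex) \<in> L2_half" for l
    using L2_half_zero by (cases "l = j") simp_all
  then show ?thesis by (simp add: L2_def)
qed

lemma l2_inner_cut_off:
  assumes h: "h \<in> L2" and b: "b > 0"
  shows "l2_inner h (\<lambda>l x. if l = j \<and> x \<le> b then 1 else 0) = integral {0..b} (h j)"
proof -
  have hj: "h j absolutely_integrable_on {0..b}" using h by (simp add: L2_def L2_half_abs_integrable)
  have a: "(\<lambda>x. if x \<le> b then h j x else 0) absolutely_integrable_on {0..b}"
    by (rule absolutely_integrable_spike[OF hj, of "{}"]) auto
  have "l2_inner h (\<lambda>l x. if l = j \<and> x \<le> b then 1 else 0)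
     = (\<Sum>l\<in>UNIV. if l = j then (\<integral>x. (if x \<le> b then h j x else 0) \<partial>half_line) else 0)"
    unfolding l2_inner_def
    by (intro sum.cong refl) (auto intro!: Bochner_Integration.integral_cong)
  also have "\<dots> = (\<integral>x. (if x \<le> b then h j x else 0) \<partial>half_line)" by simp
  also have "\<dots> = integral {0..b} (\<lambda>x. if x \<le> b then h j x else 0)"
    by (rule half_line_integral_bounded_support(2)[OF a]) (use b in auto)
  also have "\<dots> = integral {0..b} (h j)" by (rule integral_cong) auto
  finally show ?thesis .
qed

text \<open>As functions of t, the form of the cosine against the cut-off of edge j and the explicit
  primitive are continuous and at most linearly growing, with equal Laplace transforms at all
  integers m \<ge> 2. Hence they agree at every t \<ge> 0.\<close>

lemma (in pvm) cos_solution_primitive: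
  assumes sp: "spectral_resolution (star_H \<alpha>) E" and \<alpha>: "\<alpha> > 0" and t: "t > 0" and b: "b > 0"
    and h: "has_spectral_integral E (\<lambda>r. cos (t * sqrt r)) f h"
  shows "integral {0..b} (h j) = wave_primitive \<alpha> f j t b"
proof -
  have f: "f \<in> L2" and hL: "h \<in> L2" using h by (auto simp: has_spectral_integral_def)
  define g :: "'n wavefun" where "g = (\<lambda>l x. if l = j \<and> x \<le> b then 1 else 0)"
  have g: "g \<in> L2" unfolding g_def by (rule cut_off_L2)
  have res: "resolvent_pair p f (star_resolvent \<alpha> p f)" if "p > 0" "f \<in> L2" for p and f :: "'n wavefun"
    using star_resolvent_in_star_H[OF \<alpha> that] sp that(2) by (simp add: resolvent_pair_def spectral_resolution_def)
  \<comment> \<open>The explicit resolvents exist and are bounded for every p > 0, which is all that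
    \<open>spectral_nonneg\<close> asks for.\<close>
  have nonneg: "AE r in spectral_dist E f. r \<ge> 0" if f: "f \<in> L2" for f
  proof (rule spectral_nonneg[OF _ f])
    fix p :: real assume p: "p > 0"
    from star_resolvent_bounded[OF \<alpha> p] obtain C where "\<forall>f\<in>L2. sqn (star_resolvent \<alpha> p f :: 'n wavefun) \<le> C * sqn f" by blast
    then show "\<exists>C. \<forall>f\<in>L2. \<exists>u. resolvent_pair p f u \<and> sqn u \<le> C * sqn f" using res[OF p] by blast
  qed
  let ?c = "\<lambda>t. sform (\<lambda>r. cos (t * sqrt r)) f g" and ?w = "\<lambda>t. wave_primitive \<alpha> f j t b"
  have cc: "continuous_on UNIV ?c" by (rule sform_cos_continuous[OF f g])
  have cw: "continuous_on UNIV ?w" by (rule wave_primitive_continuous[OF f])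
  obtain B where B: "\<And>t. t \<ge> 0 \<Longrightarrow> cmod (?w t) \<le> B * (1 + t)"
    using wave_primitive_growth[OF f \<alpha> b] by blast
  have "?c t - ?w t = 0"
  proof (rule laplace_injective[where h="\<lambda>t. ?c t - ?w t" and C="sqn f + sqn g + B"])
    show "continuous_on {0..} (\<lambda>t. ?c t - ?w t)"
      by (intro continuous_intros continuous_on_subset[OF cc] continuous_on_subset[OF cw]) auto
    show "cmod (?c t - ?w t) \<le> (sqn f + sqn g + B) * (1 + t)" if t: "t \<ge> 0" for t
    proof -
      have s: "0 \<le> sqn f + sqn g" using sqn_nonneg[of f] sqn_nonneg[of g] by simp
      have "cmod (?c t) \<le> sqn f + sqn g" using sform_bound[OF bounded_borel_cos f g] by simp
      also have "\<dots> \<le> (sqn f + sqn g) * (1 + t)" using mult_left_mono[of 1 "1 + t", OF _ s] t by simp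
      finally have "cmod (?c t) + cmod (?w t) \<le> (sqn f + sqn g) * (1 + t) + B * (1 + t)" using B[OF t] by (rule add_mono)
      with norm_triangle_ineq4[of "?c t" "?w t"] show ?thesis by (simp add: algebra_simps)
    qed
    fix m :: nat assume "m \<ge> 2"
    then have m: "real m > 0" by simp
    let ?u = "star_resolvent \<alpha> (real m) f"
    let ?e = "\<lambda>t. complex_of_real (exp (- real m * t))"
    have "(\<lambda>n. integral {0..real n} (\<lambda>t. ?e t * ?c t)) \<longlonglongrightarrow> of_real (real m) * sform (\<lambda>r. 1 / ((real m)\<^sup>2 + \<bar>r\<bar>)) f g"
      by (rule sform_cos_laplace[OF f g m])
    \<comment> \<open>Pairing the resolvent with the cut-off gives the integral of its j-th
      component over (0,b), the same number that appears in
      \<open>wave_primitive_laplace\<close>.\<close>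
    also have "sform (\<lambda>r. 1 / ((real m)\<^sup>2 + \<bar>r\<bar>)) f g = integral {0..b} (?u j)"
      using resolvent_sform[OF nonneg res[OF m f] m g] l2_inner_cut_off[OF resolvent_pair_L2(2)[OF res[OF m f]] b, of j]
      unfolding g_def by simp
    finally have 1: "(\<lambda>n. integral {0..real n} (\<lambda>t. ?e t * ?c t)) \<longlonglongrightarrow> of_real (real m) * integral {0..b} (?u j)" .
    have 2: "(\<lambda>n. integral {0..real n} (\<lambda>t. ?e t * ?w t)) \<longlonglongrightarrow> of_real (real m) * integral {0..b} (?u j)"
      by (rule filterlim_compose[OF wave_primitive_laplace[OF \<alpha> m b f] filterlim_real_sequentially])
    have "integral {0..real n} (\<lambda>t. ?e t * (?c t - ?w t)) = integral {0..real n} (\<lambda>t. ?e t * ?c t) - integral {0..real n} (\<lambda>t. ?e t * ?w t)" for n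
      unfolding right_diff_distrib
      by (intro Henstock_Kurzweil_Integration.integral_diff integrable_continuous_interval continuous_intros
          continuous_on_subset[OF cc] continuous_on_subset[OF cw]) auto
    with tendsto_diff[OF 1 2] show "(\<lambda>n. integral {0..real n} (\<lambda>t. ?e t * (?c t - ?w t))) \<longlonglongrightarrow> 0" by simp
  qed (use t in simp)
  moreover have "l2_inner h g = ?c t" by (rule has_spectral_integral_sform[OF h bounded_borel_cos g])
  moreover have "l2_inner h g = integral {0..b} (h j)" unfolding g_def by (rule l2_inner_cut_off[OF hL b])
  ultimately show ?thesis by simp
qed

section \<open>The pointwise formula, its primitive, and the kernel\<close>

lemma has_integral_reflect_about:
  fixes \<phi> :: "real \<Rightarrow> complex"
  assumes "(\<phi> has_integral I) {c..d}"
  shows "((\<lambda>x. \<phi> (t - x)) has_integral I) {t-d..t-c}"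
proof -
  have "((\<lambda>y. \<phi> (- y)) has_integral I) {- d..- c}"
    using assms by (rule has_integral_reflect_real[where f=\<phi>, THEN iffD2])
  from has_integral_shift_real_ivl[OF this, of "- t"] show ?thesis by (simp add: algebra_simps)
qed

text \<open>Integrals over arbitrary intervals reduce to those starting at 0, according to the
  position of 0 relative to the interval. It handles shifted and reflected data uniformly.\<close>

lemma has_integral_extend_zero:
  fixes \<phi> \<Phi> :: "real \<Rightarrow> complex"
  assumes z: "\<And>x. x \<le> 0 \<Longrightarrow> \<phi> x = 0" "\<And>x. x \<le> 0 \<Longrightarrow> \<Phi> x = 0"
    and I: "\<And>s. 0 \<le> s \<Longrightarrow> (\<phi> has_integral \<Phi> s) {0..s}" and cd: "c \<le> d"
  shows "(\<phi> has_integral (\<Phi> d - \<Phi> c)) {c..d}"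
proof (cases "c \<ge> 0")
  case True
  have i: "\<phi> integrable_on {0..d}" using I[of d] True cd by auto
  have "integral {0..c} \<phi> + integral {c..d} \<phi> = integral {0..d} \<phi>"
    by (rule Henstock_Kurzweil_Integration.integral_combine[OF True cd i])
  then have "integral {c..d} \<phi> = \<Phi> d - \<Phi> c"
    using integral_unique[OF I[of c]] integral_unique[OF I[of d]] True cd by (simp add: algebra_simps)
  moreover have "\<phi> integrable_on {c..d}" by (rule integrable_on_subinterval[OF i]) (use True in auto)
  ultimately show ?thesis by (metis integrable_integral)
next
  case c: False
  show ?thesis
  proof (cases "d \<ge> 0")
    case True
    have "(\<phi> has_integral 0) {c..0}" by (rule has_integral_is_0) (use z in auto)
    from has_integral_combine[OF _ True this I[OF True]] show ?thesis using c z by simp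
  next
    case False
    have "(\<phi> has_integral 0) {c..d}" by (rule has_integral_is_0) (use z False in auto)
    then show ?thesis using c False z by simp
  qed
qed

lemma zero_ext_has_integral:
  assumes f: "f \<in> L2_half" and cd: "c \<le> d"
  shows "(zero_ext f has_integral (conv_left 0 f d - conv_left 0 f c)) {c..d}"
proof (rule has_integral_extend_zero[OF _ _ _ cd])
  fix s :: real
  have "(f has_integral conv_left 0 f s) {0..s}"
    unfolding conv_left_zero_exponent
    by (rule integrable_integral[OF set_lebesgue_integral_eq_integral(1)[OF L2_half_abs_integrable[OF f]]])
  then show "(zero_ext f has_integral conv_left 0 f s) {0..s}"
    by (rule has_integral_spike[OF negligible_sing[of 0], rotated]) (auto simp: zero_ext_def)
qed (auto simp: zero_ext_def conv_left_nonpos)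

lemma conv_left_has_integral:
  assumes f: "f \<in> L2_half" and cd: "c \<le> d"
  shows "((\<lambda>x. of_real q * conv_left q f x) has_integral ((conv_left 0 f d - conv_left q f d) - (conv_left 0 f c - conv_left q f c))) {c..d}"
proof (rule has_integral_extend_zero[OF _ _ _ cd])
  fix s :: real assume "0 \<le> s"
  from conv_left_primitive[OF L2_half_abs_integrable[OF f] this, of q]
  show "((\<lambda>x. of_real q * conv_left q f x) has_integral (conv_left 0 f s - conv_left q f s)) {0..s}"
    by (simp add: conv_left_zero_exponent)
qed (auto simp: conv_left_nonpos)

lemma zero_ext_abs_integrable_affine:
  assumes f: "f \<in> L2_half" and c: "\<bar>c\<bar> = 1"
  shows "(\<lambda>x. zero_ext f (s + c * x)) absolutely_integrable_on {0..b}"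
proof -
  \<comment> \<open>Large enough that s + c x stays in {-K..K} for all x in {0..b}, because |c| =
    1.\<close>
  define K where "K = \<bar>s\<bar> + \<bar>b\<bar>"
  have K: "K \<ge> 0" by (simp add: K_def)
  have z0: "zero_ext f absolutely_integrable_on {0..K}"
    by (rule absolutely_integrable_spike[OF L2_half_abs_integrable[OF f] negligible_sing[of 0]]) (auto simp: zero_ext_def)
  have e: "{x \<in> {0..K} - {-K..K}. zero_ext f x \<noteq> 0} = {}" "{x \<in> {-K..K} - {0..K}. zero_ext f x \<noteq> 0} = {}"
    using K by (auto simp: zero_ext_def)
  have "zero_ext f absolutely_integrable_on {-K..K}"
    by (rule absolutely_integrable_spike_set[OF z0]) (simp_all only: e negligible_empty)
  then have "integrable lebesgue (\<lambda>y. indicator {-K..K} y *\<^sub>R zero_ext f y)" by (simp add: set_integrable_def)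
  then have "integrable lebesgue (\<lambda>x. indicator {-K..K} (s + c * x) *\<^sub>R zero_ext f (s + c * x))"
    by (rule lebesgue_integrable_real_affine) (use c in auto)
  moreover have "indicator {-K..K} (s + c * x) = (indicator {x. s + c * x \<in> {-K..K}} x :: real)" for x
    by (simp add: indicator_def)
  ultimately have "(\<lambda>x. zero_ext f (s + c * x)) absolutely_integrable_on {x. s + c * x \<in> {-K..K}}"
    by (simp add: set_integrable_def)
  then show ?thesis
  proof (rule set_integrable_subset)
    show "{0..b} \<subseteq> {x. s + c * x \<in> {-K..K}}"
    proof
      fix x assume x: "x \<in> {0..b}"
      have "\<bar>s + c * x\<bar> \<le> \<bar>s\<bar> + \<bar>c * x\<bar>" by (rule abs_triangle_ineq)
      also have "\<dots> \<le> K" using x c by (simp add: abs_mult K_def)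
      finally show "x \<in> {x. s + c * x \<in> {-K..K}}" by (simp add: abs_le_iff)
    qed
  qed simp
qed

text \<open>The common normal form to which both the kernel action and the explicit formula are
  reduced: the memory integral is written through \<open>conv_left\<close>, whose vanishing at
  nonpositive arguments takes over the role of the step function.\<close>

definition wave_solution :: "real \<Rightarrow> ('n::finite) wavefun \<Rightarrow> 'n \<Rightarrow> real \<Rightarrow> real \<Rightarrow> complex" where
  "wave_solution \<alpha> f j t x = 1/2 * (zero_ext (f j) (x - t) + zero_ext (f j) (x + t)) - 1/2 * zero_ext (f j) (t - x)
     + 1 / of_nat CARD('n) * (\<Sum>l\<in>UNIV. zero_ext (f l) (t - x))
     - 1 / of_nat CARD('n) * (\<Sum>l\<in>UNIV. of_real (\<alpha> / real CARD('n)) * conv_left (\<alpha> / real CARD('n)) (f l) (t - x))"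

lemma wave_solution_abs_integrable:
  assumes f: "f \<in> L2"
  shows "wave_solution \<alpha> f j t absolutely_integrable_on {0..b}"
proof -
  have fj: "f l \<in> L2_half" for l using f by (simp add: L2_def)
  have 1: "(\<lambda>x. zero_ext (f l) (x - t)) absolutely_integrable_on {0..b}" for l
    using zero_ext_abs_integrable_affine[OF fj[of l], of 1 b "- t"] by simp
  have 2: "(\<lambda>x. zero_ext (f l) (x + t)) absolutely_integrable_on {0..b}" for l
    using zero_ext_abs_integrable_affine[OF fj[of l], of 1 b t] by (simp add: add.commute)
  have 3: "(\<lambda>x. zero_ext (f l) (t - x)) absolutely_integrable_on {0..b}" for l
    using zero_ext_abs_integrable_affine[OF fj[of l], of "- 1" b t] by simp
  have 4: "(\<lambda>x. conv_left q (f l) (t - x)) absolutely_integrable_on {0..b}" for q l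
    by (intro absolutely_integrable_continuous_real
        continuous_on_compose2[OF conv_left_continuous_UNIV[OF L2_half_abs_integrable[OF fj]]] continuous_intros) auto
  show ?thesis
    unfolding wave_solution_def
    by (intro set_integral_diff(1) set_integral_add(1) set_integrable_mult_right absolutely_integrable_sum impI 1 2 3 4) auto
qed

lemma wave_solution_has_integral:
  assumes f: "f \<in> L2" and t: "t > 0" and b: "b > 0"
  shows "(wave_solution \<alpha> f j t has_integral wave_primitive \<alpha> f j t b) {0..b}"
proof -
  have fj: "f l \<in> L2_half" for l using f by (simp add: L2_def)
  let ?F = "\<lambda>l. conv_left 0 (f l)" and ?\<beta> = "\<alpha> / real CARD('a)" and ?N = "of_nat CARD('a) :: complex"
  let ?M = "\<lambda>l. conv_left ?\<beta> (f l)"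
  have 1: "((\<lambda>x. zero_ext (f j) (x - t)) has_integral ?F j (b - t)) {0..b}"
    using has_integral_shift_real_ivl[OF zero_ext_has_integral[OF fj[of j], of "- t" "b - t"], of "- t"] b t
    by (simp add: conv_left_nonpos)
  have 2: "((\<lambda>x. zero_ext (f j) (x + t)) has_integral (?F j (b + t) - ?F j t)) {0..b}"
    using has_integral_shift_real_ivl[OF zero_ext_has_integral[OF fj[of j], of t "b + t"], of t] b by simp
  have 3: "((\<lambda>x. zero_ext (f l) (t - x)) has_integral (?F l t - ?F l (t - b))) {0..b}" for l
    using has_integral_reflect_about[OF zero_ext_has_integral[OF fj[of l], of "t - b" t], of t] b by simp
  have 4: "((\<lambda>x. of_real ?\<beta> * ?M l (t - x)) has_integral ((?F l t - ?M l t) - (?F l (t - b) - ?M l (t - b)))) {0..b}" for l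
    using has_integral_reflect_about[OF conv_left_has_integral[OF fj[of l], of "t - b" t ?\<beta>], of t] b by simp
  have "(wave_solution \<alpha> f j t has_integral
     (1/2 * (?F j (b - t) + (?F j (b + t) - ?F j t)) - 1/2 * (?F j t - ?F j (t - b))
      + 1 / ?N * (\<Sum>l\<in>UNIV. ?F l t - ?F l (t - b))
      - 1 / ?N * (\<Sum>l\<in>UNIV. (?F l t - ?M l t) - (?F l (t - b) - ?M l (t - b))))) {0..b}"
    unfolding wave_solution_def
    by (intro has_integral_add has_integral_diff has_integral_mult_right has_integral_sum 1 2 3 4 finite)
  moreover have "1/2 * (?F j (b - t) + (?F j (b + t) - ?F j t)) - 1/2 * (?F j t - ?F j (t - b))
      + 1 / ?N * (\<Sum>l\<in>UNIV. ?F l t - ?F l (t - b))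
      - 1 / ?N * (\<Sum>l\<in>UNIV. (?F l t - ?M l t) - (?F l (t - b) - ?M l (t - b))) = wave_primitive \<alpha> f j t b"
  proof -
    \<comment> \<open>The wave moving away from the vertex and half of the reflected wave together
      produce the term with the absolute value in \<open>wave_primitive\<close>.\<close>
    have "?F j \<bar>t - b\<bar> = ?F j (b - t) + ?F j (t - b)"
      by (cases "t \<le> b") (auto simp: abs_if conv_left_nonpos)
    then show ?thesis
      unfolding wave_primitive_def
      by (simp add: sum_subtractf sum.distrib algebra_simps add_divide_distrib diff_divide_distrib)
  qed
  ultimately show ?thesis by simp
qed

text \<open>When the zero a is not positive, the set of admissible zeros is empty and the sum is 0,
  which agrees with the extension of f by zero.\<close>

lemma delta_pairing_simple_zero:
  assumes "\<And>y. h y = 0 \<longleftrightarrow> y = a" "\<bar>deriv h a\<bar> = 1"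
  shows "delta_pairing h f = zero_ext f a"
proof -
  have "{y. 0 < y \<and> h y = 0} = (if 0 < a then {a} else {})" using assms(1) by auto
  then show ?thesis using assms(2) by (simp add: delta_pairing_def zero_ext_def)
qed

lemma delta_pairings:
  "delta_pairing (\<lambda>y. x - y - t) f = zero_ext f (x - t)"
  "delta_pairing (\<lambda>y. x - y + t) f = zero_ext f (x + t)"
  "delta_pairing (\<lambda>y. x + y - t) f = zero_ext f (t - x)"
proof -
  have "deriv (\<lambda>y. x - y - t) a = - 1" "deriv (\<lambda>y. x - y + t) a = - 1" "deriv (\<lambda>y. x + y - t) a = 1" for a :: real
    by (rule DERIV_imp_deriv; auto intro!: derivative_eq_intros)+
  then show "delta_pairing (\<lambda>y. x - y - t) f = zero_ext f (x - t)"
    "delta_pairing (\<lambda>y. x - y + t) f = zero_ext f (x + t)"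
    "delta_pairing (\<lambda>y. x + y - t) f = zero_ext f (t - x)"
    by (auto intro!: delta_pairing_simple_zero)
qed

lemma step_kernel_integral:
  assumes f: "f \<in> L2_half" and x: "x > 0"
  shows "(\<integral>y. of_real (\<alpha> / N\<^sup>2 * exp (- \<alpha> * (t - y - x) / N) * unit_step (t - y - x)) * f y \<partial>half_line)
     = of_real (\<alpha> / N\<^sup>2) * conv_left (\<alpha> / N) f (t - x)"
proof (cases "t - x > 0")
  case True
  let ?s = "t - x" and ?k = "\<lambda>y. of_real (\<alpha> / N\<^sup>2 * exp (- \<alpha> * (t - y - x) / N) * unit_step (t - y - x)) * f y"
  let ?g = "\<lambda>y. of_real (\<alpha> / N\<^sup>2) * (of_real (exp (- (\<alpha> / N) * ?s)) * (of_real (exp (\<alpha> / N * y)) * f y))"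
  have g: "?g absolutely_integrable_on {0..?s}"
    by (intro set_integrable_mult_right impI exp_mult_abs_integrable L2_half_abs_integrable f)
  \<comment> \<open>The endpoint y = t - x is excluded because \<open>unit_step\<close> is 0 there
    while the exponential is 1; a single point does not affect the integral.\<close>
  have e: "?k y = ?g y" if "y \<in> {0..?s} - {?s}" for y
  proof -
    have "exp (- \<alpha> * (t - y - x) / N) = exp (- (\<alpha> / N) * ?s) * exp (\<alpha> / N * y)"
      by (simp add: exp_add[symmetric] add_divide_distrib diff_divide_distrib algebra_simps)
    moreover have "unit_step (t - y - x) = 1" using that by (auto simp: unit_step_def)
    ultimately show ?thesis by (simp only: of_real_mult of_real_1 mult_1_right mult.assoc)
  qed
  have k: "?k absolutely_integrable_on {0..?s}"
    by (rule absolutely_integrable_spike[OF g negligible_sing[of ?s] e])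
  have "(\<integral>y. ?k y \<partial>half_line) = integral {0..?s} ?k"
    by (rule half_line_integral_bounded_support(2)[OF k]) (use True in \<open>auto simp: unit_step_def\<close>)
  also have "\<dots> = integral {0..?s} ?g"
    by (rule integral_spike[OF negligible_sing[of ?s] e[symmetric]])
  also have "\<dots> = of_real (\<alpha> / N\<^sup>2) * conv_left (\<alpha> / N) f ?s"
    unfolding conv_left_def by (simp only: integral_mult_right)
  finally show ?thesis .
next
  case False
  have "(\<integral>y. of_real (\<alpha> / N\<^sup>2 * exp (- \<alpha> * (t - y - x) / N) * unit_step (t - y - x)) * f y \<partial>half_line)
     = (\<integral>y. 0 \<partial>half_line)"
    by (rule Bochner_Integration.integral_cong) (use False in \<open>auto simp: unit_step_def\<close>)
  then show ?thesis using False by (simp add: conv_left_nonpos)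
qed

lemma kernel_eq_wave_solution:
  fixes f :: "('n::finite) wavefun"
  assumes f: "f \<in> L2" and x: "x > 0"
  shows "(\<Sum>l\<in>UNIV. G_S \<alpha> j l t x (f l)) = wave_solution \<alpha> f j t x"
proof -
  let ?N = "real CARD('n)"
  have fj: "f l \<in> L2_half" for l using f by (simp add: L2_def)
  have k: "(\<Sum>l\<in>UNIV. kronecker j l * X l) = X j" for X :: "'n \<Rightarrow> complex"
  proof -
    have "(\<Sum>l\<in>UNIV. kronecker j l * X l) = (\<Sum>l\<in>UNIV. if l = j then X l else 0)"
      by (intro sum.cong) (auto simp: kronecker_def)
    then show ?thesis by simp
  qed
  have "G_S \<alpha> j l t x (f l) = kronecker j l * (1/2 * (zero_ext (f l) (x - t) + zero_ext (f l) (x + t)) - 1/2 * zero_ext (f l) (t - x))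
     + 1 / of_nat CARD('n) * zero_ext (f l) (t - x)
     - 1 / of_nat CARD('n) * (of_real (\<alpha> / ?N) * conv_left (\<alpha> / ?N) (f l) (t - x))" for l
    unfolding G_S_def Let_def delta_pairings step_kernel_integral[OF fj x]
    by (simp add: power2_eq_square algebra_simps)
  then show ?thesis
    unfolding wave_solution_def by (simp add: sum.distrib sum_subtractf k sum_distrib_left sum_divide_distrib)
qed

text \<open>The substitution y = s - \<epsilon> turns the memory integral of the formula into
  \<open>conv_left\<close>. The point y = 0, where \<open>zero_ext\<close> may change f, is
  negligible.\<close>

lemma exp_zero_ext_integral:
  assumes f: "f \<in> L2_half" and s: "s > 0"
  shows "(\<lambda>\<epsilon>. of_real (exp (- q * \<epsilon>)) * zero_ext f (s - \<epsilon>)) absolutely_integrable_on {0..s}"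
    "((\<lambda>\<epsilon>. of_real (exp (- q * \<epsilon>)) * zero_ext f (s - \<epsilon>)) has_integral conv_left q f s) {0..s}"
proof -
  have "(\<lambda>x. zero_ext f (s - x)) absolutely_integrable_on {0..s}"
    using zero_ext_abs_integrable_affine[OF f, of "- 1" s s] by simp
  then show "(\<lambda>\<epsilon>. of_real (exp (- q * \<epsilon>)) * zero_ext f (s - \<epsilon>)) absolutely_integrable_on {0..s}"
    by (intro abs_integrable_mult_continuous continuous_intros)
  have "((\<lambda>y. of_real (exp (- q * s)) * (of_real (exp (q * y)) * f y)) has_integral conv_left q f s) {0..s}"
    unfolding conv_left_def
    by (intro has_integral_mult_right integrable_integral set_lebesgue_integral_eq_integral(1) exp_mult_abs_integrable L2_half_abs_integrable f)
  then have "((\<lambda>y. of_real (exp (- q * (s - y))) * zero_ext f y) has_integral conv_left q f s) {0..s}"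
  proof (rule has_integral_spike[OF negligible_sing[of 0], rotated])
    fix y assume y: "y \<in> {0..s} - {0}"
    have "exp (- q * (s - y)) = exp (- q * s) * exp (q * y)" by (simp add: exp_add[symmetric] algebra_simps)
    then show "of_real (exp (- q * (s - y))) * zero_ext f y = of_real (exp (- q * s)) * (of_real (exp (q * y)) * f y)"
      using y by (simp add: zero_ext_def)
  qed
  from has_integral_reflect_about[OF this, of s]
  show "((\<lambda>\<epsilon>. of_real (exp (- q * \<epsilon>)) * zero_ext f (s - \<epsilon>)) has_integral conv_left q f s) {0..s}" by simp
qed

lemma wave_solution_formula:
  fixes f :: "('n::finite) wavefun"
  assumes f: "f \<in> L2"
  shows "1/2 * (zero_ext (f j) (x - t) + zero_ext (f j) (x + t))
              - 1/2 * zero_ext (f j) (t - x)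
              + 1 / of_nat CARD('n) * (\<Sum>l\<in>UNIV. zero_ext (f l) (t - x))
              - of_real (\<alpha> / (real CARD('n))\<^sup>2 * unit_step (t - x)) *
                (LINT \<epsilon>:{0..t - x}|lebesgue.
                   of_real (exp (- \<alpha> * \<epsilon> / real CARD('n))) *
                   (\<Sum>l\<in>UNIV. zero_ext (f l) (t - x - \<epsilon>))) = wave_solution \<alpha> f j t x"
proof -
  let ?N = "real CARD('n)"
  have fj: "f l \<in> L2_half" for l using f by (simp add: L2_def)
  have "of_real (\<alpha> / ?N\<^sup>2 * unit_step (t - x)) *
                (LINT \<epsilon>:{0..t - x}|lebesgue.
                   of_real (exp (- \<alpha> * \<epsilon> / ?N)) * (\<Sum>l\<in>UNIV. zero_ext (f l) (t - x - \<epsilon>)))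
     = 1 / of_nat CARD('n) * (\<Sum>l\<in>UNIV. of_real (\<alpha> / ?N) * conv_left (\<alpha> / ?N) (f l) (t - x))"
  proof (cases "t - x > 0")
    case True
    let ?h = "\<lambda>l \<epsilon>. of_real (exp (- (\<alpha> / ?N) * \<epsilon>)) * zero_ext (f l) (t - x - \<epsilon>)"
    have eq: "of_real (exp (- \<alpha> * \<epsilon> / ?N)) * (\<Sum>l\<in>UNIV. zero_ext (f l) (t - x - \<epsilon>)) = (\<Sum>l\<in>UNIV. ?h l \<epsilon>)" for \<epsilon>
      by (simp add: sum_distrib_left)
    have "(LINT \<epsilon>:{0..t - x}|lebesgue. \<Sum>l\<in>UNIV. ?h l \<epsilon>) = integral {0..t - x} (\<lambda>\<epsilon>. \<Sum>l\<in>UNIV. ?h l \<epsilon>)"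
      by (intro set_lebesgue_integral_eq_integral(2) absolutely_integrable_sum exp_zero_ext_integral(1) fj True) auto
    also have "\<dots> = (\<Sum>l\<in>UNIV. conv_left (\<alpha> / ?N) (f l) (t - x))"
      by (intro integral_unique has_integral_sum exp_zero_ext_integral(2) fj True) auto
    finally show ?thesis
      unfolding eq using True by (simp add: unit_step_def sum_distrib_left sum_divide_distrib power2_eq_square)
  next
    case False
    then show ?thesis by (simp add: unit_step_def conv_left_nonpos)
  qed
  then show ?thesis unfolding wave_solution_def by (simp only:)
qed

theorem mainTheorem3:
  fixes \<alpha> t :: real
    and E :: "real set \<Rightarrow> ('n::finite) wavefun \<Rightarrow> 'n wavefun"
    and f :: "'n wavefun"
  assumes "\<alpha> > 0"
    and "spectral_resolution (star_H \<alpha>) E"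
    and "t > 0"
    and "f \<in> L2"
  shows "(\<forall>j. AE x in half_line.
            cos_sqrt_op E t f j x = (\<Sum>l\<in>UNIV. G_S \<alpha> j l t x (f l)))
       \<and> (\<forall>j. AE x in half_line.
            cos_sqrt_op E t f j x =
              1/2 * (zero_ext (f j) (x - t) + zero_ext (f j) (x + t))
              - 1/2 * zero_ext (f j) (t - x)
              + 1 / of_nat CARD('n) * (\<Sum>l\<in>UNIV. zero_ext (f l) (t - x))
              - of_real (\<alpha> / (real CARD('n))\<^sup>2 * unit_step (t - x)) *
                (LINT \<epsilon>:{0..t - x}|lebesgue.
                   of_real (exp (- \<alpha> * \<epsilon> / real CARD('n))) *
                   (\<Sum>l\<in>UNIV. zero_ext (f l) (t - x - \<epsilon>))))"
proof -
  interpret pvm E using assms(2) by unfold_locales (simp add: spectral_resolution_def)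
  define h where "h = cos_sqrt_op E t f"
  \<comment> \<open>The cosine is bounded, so the value chosen by \<open>SOME\<close> really is a
    spectral integral of f.\<close>
  have h: "has_spectral_integral E (\<lambda>r. cos (t * sqrt r)) f h"
    unfolding h_def cos_sqrt_op_def functional_calculus_def
    by (rule someI_ex[OF has_spectral_integral_exists[OF bounded_borel_cos assms(4)]])
  then have hL: "h \<in> L2" by (simp add: has_spectral_integral_def)
  have sol: "AE x in half_line. h j x = wave_solution \<alpha> f j t x" for j
  proof -
    have hj: "h j absolutely_integrable_on {0..b}" for b
      using hL by (simp add: L2_def L2_half_abs_integrable)
    \<comment> \<open>Both functions are locally integrable with the same integral over every (0,b),
      so their difference vanishes almost everywhere.\<close>
    have "AE x in half_line. h j x - wave_solution \<alpha> f j t x = 0"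
    proof (rule AE_half_line_zero)
      show "(\<lambda>x. h j x - wave_solution \<alpha> f j t x) absolutely_integrable_on {0..b}" for b
        by (intro set_integral_diff(1) hj wave_solution_abs_integrable assms)
      fix b :: real assume b: "0 < b"
      have "(h j has_integral wave_primitive \<alpha> f j t b) {0..b}"
        using integrable_integral[OF set_lebesgue_integral_eq_integral(1)[OF hj[of b]]]
          cos_solution_primitive[OF assms(2,1,3) b h] by simp
      from has_integral_diff[OF this wave_solution_has_integral[OF assms(4,3) b, of \<alpha> j]]
      show "integral {0..b} (\<lambda>x. h j x - wave_solution \<alpha> f j t x) = 0" by (simp add: integral_unique)
    qed
    then show ?thesis by eventually_elim simp
  qed
  \<comment> \<open>The kernel identity holds for x > 0, which \<open>AE_space\<close> supplies on
    \<open>half_line\<close>.\<close>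
  have "AE x in half_line. h j x = (\<Sum>l\<in>UNIV. G_S \<alpha> j l t x (f l))" for j
    using sol[of j] AE_space
    by eventually_elim (simp add: kernel_eq_wave_solution[OF assms(4)])
  then show ?thesis
    unfolding wave_solution_formula[OF assms(4)] using sol unfolding h_def by blast
qed

end
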